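(* Assume $1<\kappa_*\le\kappa^*<\infty$. The following two eigenvalue problems, considered for $\lambda\in\mathbb{C}\setminus\{0\}$, are equivalent. (E1) Find $\lambda$ and $0\ne u\in H^1_0(\mathrm{div},\Omega)$ such that $$\big(P(\nabla\nabla\cdot u+\lambda u),\ \nabla\nabla\cdot v+\lambda A^{-1}v\big)=0\qquad\text{for all } v\in H^1_0(\mathrm{div},\Omega).$$ (E2) Find $\lambda$ and $0\neq(\varphi,y,r)\in V$ such that for all $(\psi,z,s)\in V$ $$\begin{aligned}((I+Q)\nabla\varphi,\nabla\psi)+(Qy,\nabla\psi)&=\lambda\big((\varphi,\psi)+(r,\psi)\big),\\ (Q\nabla\varphi,z)+(Qy,z)-(\nabla r,z)&=0,\\ -(y,\nabla s)&=\lambda(\varphi,s).\end{aligned}$$ Equivalence means: if $(\lambda,(\varphi,y,r))$ is an eigenpair of (E2), then $(\lambda,y/\lambda)$ is an eigenpair of (E1); and if $(\lambda,u)$ is an eigenpair of (E1), then there is a unique $r\in\tilde H^1(\Omega)$ such that $(\lambda,(\nabla\cdot u,\lambda u,r))$ is an eigenpair of (E2).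
   Context: Let $\Omega\subset\mathbb{R}^d$, $d\in\{2,3\}$, be a bounded connected polygon ($d=2$) or polyhedron ($d=3$). Let $A:\Omega\to\mathbb{R}^{d\times d}$ be a measurable matrix field that is symmetric positive definite everywhere, and set $\kappa_*:=\inf_{x\in\Omega}\inf_{|\xi|=1}\xi^\top A(x)\xi$ and $\kappa^*:=\sup_{x\in\Omega}\sup_{|\xi|=1}\xi^\top A(x)\xi$, where $\xi\in\mathbb{R}^d$ and $|\cdot|$ is the Euclidean norm. Let $I$ be the $d\times d$ identity matrix, $P:=(A^{-1}-I)^{-1}$ and $Q:=(A-I)^{-1}$ (pointwise in $x$). Functions are complex-valued and $(f,g)=\int_\Omega f\cdot g\,dx$ is the bilinear $L^2$ pairing (no conjugation) for scalar or vector functions. $L^2_0(\Omega)=\{\tau\in L^2(\Omega):(\tau,1)=0\}$, $\tilde H^1_0(\Omega)=H^1_0(\Omega)\cap L^2_0(\Omega)$, $\tilde H^1(\Omega)=H^1(\Omega)\cap L^2_0(\Omega)$, and $V:=\tilde H^1_0(\Omega)\times (L^2(\Omega))^d\times\tilde H^1(\Omega)$. $H_0(\mathrm{div},\Omega)$ is the space of $\tau\in (L^2(\Omega))^d$ with $\nabla\cdot\tau\in L^2(\Omega)$ and zero normal trace on $\partial\Omega$, and $H^1_0(\mathrm{div},\Omega)=\{\tau\in H_0(\mathrm{div},\Omega):\nabla\cdot\tau\in H^1_0(\Omega)\}$. *)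

theory Defs
  imports "HOL-Analysis.Analysis"
begin

section \<open>Domains and coefficients\<close>

text \<open>An open, connected, nonempty polygon/polyhedron of arbitrary shape: the interior of a
  finite union of (compact) convex polytopes. Boundedness is implied. Neither convexity, nor simple
  connectedness, nor a connected boundary is required; slits are excluded.\<close>

definition polyhedral_domain :: "(real ^ 'd) set \<Rightarrow> bool" where
  "polyhedral_domain \<Omega> \<longleftrightarrow>
     (\<exists>K. finite K \<and> (\<forall>S\<in>K. polytope S) \<and> \<Omega> = interior (\<Union>K)) \<and> connected \<Omega> \<and> \<Omega> \<noteq> {}"

definition spd :: "real ^ 'd ^ 'd \<Rightarrow> bool" where
  "spd M \<longleftrightarrow> transpose M = M \<and> (\<forall>\<xi>. \<xi> \<noteq> 0 \<longrightarrow> \<xi> \<bullet> (M *v \<xi>) > 0)"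

text \<open>Extended-real valued, since the infimum and supremum of an unbounded set of reals are
  unspecified values of type \<^typ>\<open>real\<close>.\<close>

definition kappa_lower :: "(real ^ 'd) set \<Rightarrow> (real ^ 'd \<Rightarrow> real ^ 'd ^ 'd) \<Rightarrow> ereal" where
  "kappa_lower \<Omega> A = (INF x\<in>\<Omega>. INF \<xi>\<in>{\<xi>. norm \<xi> = 1}. ereal (\<xi> \<bullet> (A x *v \<xi>)))"

definition kappa_upper :: "(real ^ 'd) set \<Rightarrow> (real ^ 'd \<Rightarrow> real ^ 'd ^ 'd) \<Rightarrow> ereal" where
  "kappa_upper \<Omega> A = (SUP x\<in>\<Omega>. SUP \<xi>\<in>{\<xi>. norm \<xi> = 1}. ereal (\<xi> \<bullet> (A x *v \<xi>)))"

definition P_field :: "(real ^ 'd \<Rightarrow> real ^ 'd ^ 'd) \<Rightarrow> real ^ 'd \<Rightarrow> real ^ 'd ^ 'd" where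
  "P_field A x = matrix_inv (matrix_inv (A x) - mat 1)"

definition Q_field :: "(real ^ 'd \<Rightarrow> real ^ 'd ^ 'd) \<Rightarrow> real ^ 'd \<Rightarrow> real ^ 'd ^ 'd" where
  "Q_field A x = matrix_inv (A x - mat 1)"

text \<open>A real matrix acting on a complex vector.\<close>

definition cmv :: "real ^ 'd ^ 'd \<Rightarrow> complex ^ 'd \<Rightarrow> complex ^ 'd"  (infixl \<open>*c\<close> 70) where
  "M *c w = (\<chi> i j. complex_of_real (M $ i $ j)) *v w"


section \<open>Square-integrable functions and the bilinear pairings\<close>

text \<open>Elements of the function spaces below are functions, not classes; their values outside
  \<open>\<Omega>\<close> and on null sets are irrelevant. Accordingly, equality in these spaces is
  almost-everywhere equality on \<open>\<Omega>\<close>.\<close>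

definition L2 :: "'a::euclidean_space set \<Rightarrow> ('a \<Rightarrow> 'b::euclidean_space) set" where
  "L2 \<Omega> = {f. f \<in> borel_measurable (lebesgue_on \<Omega>) \<and>
              integrable (lebesgue_on \<Omega>) (\<lambda>x. (norm (f x))\<^sup>2)}"

definition ae_eq ::
  "'a::euclidean_space set \<Rightarrow> ('a \<Rightarrow> 'b::euclidean_space) \<Rightarrow> ('a \<Rightarrow> 'b) \<Rightarrow> bool" where
  "ae_eq \<Omega> f g \<longleftrightarrow> (AE x in lebesgue_on \<Omega>. f x = g x)"

definition spair ::
  "'a::euclidean_space set \<Rightarrow> ('a \<Rightarrow> complex) \<Rightarrow> ('a \<Rightarrow> complex) \<Rightarrow> complex" where
  "spair \<Omega> f g = (LINT x|lebesgue_on \<Omega>. f x * g x)"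

definition vpair ::
  "(real ^ 'd) set \<Rightarrow> (real ^ 'd \<Rightarrow> complex ^ 'd) \<Rightarrow> (real ^ 'd \<Rightarrow> complex ^ 'd) \<Rightarrow> complex" where
  "vpair \<Omega> f g = (LINT x|lebesgue_on \<Omega>. (\<Sum>i\<in>UNIV. f x $ i * g x $ i))"


section \<open>Weak derivatives\<close>

primrec Ck :: "nat \<Rightarrow> ('a::euclidean_space \<Rightarrow> 'b::real_normed_vector) \<Rightarrow> bool" where
  "Ck 0 f \<longleftrightarrow> continuous_on UNIV f"
| "Ck (Suc k) f \<longleftrightarrow>
     (\<forall>x. f differentiable (at x)) \<and> (\<forall>v. Ck k (\<lambda>x. frechet_derivative f (at x) v))"

definition test_functions :: "'a::euclidean_space set \<Rightarrow> ('a \<Rightarrow> complex) set" where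
  "test_functions \<Omega> = {\<eta>. (\<forall>k. Ck k \<eta>) \<and>
     compact (closure {x. \<eta> x \<noteq> 0}) \<and> closure {x. \<eta> x \<noteq> 0} \<subseteq> \<Omega>}"

definition classical_grad :: "(real ^ 'd \<Rightarrow> complex) \<Rightarrow> real ^ 'd \<Rightarrow> complex ^ 'd" where
  "classical_grad \<eta> x = (\<chi> i. frechet_derivative \<eta> (at x) (axis i 1))"

definition has_weak_grad ::
  "(real ^ 'd) set \<Rightarrow> (real ^ 'd \<Rightarrow> complex) \<Rightarrow> (real ^ 'd \<Rightarrow> complex ^ 'd) \<Rightarrow> bool" where
  "has_weak_grad \<Omega> f G \<longleftrightarrow> f \<in> L2 \<Omega> \<and> G \<in> L2 \<Omega> \<and>
     (\<forall>\<eta>\<in>test_functions \<Omega>. \<forall>i.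
        spair \<Omega> f (\<lambda>x. classical_grad \<eta> x $ i) = - spair \<Omega> (\<lambda>x. G x $ i) \<eta>)"

definition has_weak_div ::
  "(real ^ 'd) set \<Rightarrow> (real ^ 'd \<Rightarrow> complex ^ 'd) \<Rightarrow> (real ^ 'd \<Rightarrow> complex) \<Rightarrow> bool" where
  "has_weak_div \<Omega> \<tau> g \<longleftrightarrow> \<tau> \<in> L2 \<Omega> \<and> g \<in> L2 \<Omega> \<and>
     (\<forall>\<eta>\<in>test_functions \<Omega>. vpair \<Omega> \<tau> (classical_grad \<eta>) = - spair \<Omega> g \<eta>)"

text \<open>Weak gradient and divergence are unique up to null sets; the operators pick a representative
  and are only meaningful when a weak gradient (divergence) exists.\<close>

definition wgrad :: "(real ^ 'd) set \<Rightarrow> (real ^ 'd \<Rightarrow> complex) \<Rightarrow> real ^ 'd \<Rightarrow> complex ^ 'd" where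
  "wgrad \<Omega> f = (SOME G. has_weak_grad \<Omega> f G)"

definition wdiv :: "(real ^ 'd) set \<Rightarrow> (real ^ 'd \<Rightarrow> complex ^ 'd) \<Rightarrow> real ^ 'd \<Rightarrow> complex" where
  "wdiv \<Omega> \<tau> = (SOME g. has_weak_div \<Omega> \<tau> g)"


section \<open>Function spaces\<close>

definition H1 :: "(real ^ 'd) set \<Rightarrow> (real ^ 'd \<Rightarrow> complex) set" where
  "H1 \<Omega> = {f \<in> L2 \<Omega>. \<exists>G. has_weak_grad \<Omega> f G}"

definition H1_norm :: "(real ^ 'd) set \<Rightarrow> (real ^ 'd \<Rightarrow> complex) \<Rightarrow> real" where
  "H1_norm \<Omega> f = sqrt ((LINT x|lebesgue_on \<Omega>. (norm (f x))\<^sup>2) +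
                       (LINT x|lebesgue_on \<Omega>. (norm (wgrad \<Omega> f x))\<^sup>2))"

text \<open>The closure of the test functions in the \<open>H1\<close> norm.\<close>

definition H10 :: "(real ^ 'd) set \<Rightarrow> (real ^ 'd \<Rightarrow> complex) set" where
  "H10 \<Omega> = {f \<in> H1 \<Omega>. \<forall>\<epsilon>>0. \<exists>\<eta>\<in>test_functions \<Omega>. H1_norm \<Omega> (\<lambda>x. f x - \<eta> x) < \<epsilon>}"

definition L2_mean0 :: "'a::euclidean_space set \<Rightarrow> ('a \<Rightarrow> complex) set" where
  "L2_mean0 \<Omega> = {f \<in> L2 \<Omega>. spair \<Omega> f (\<lambda>x. 1) = 0}"

definition Hdiv :: "(real ^ 'd) set \<Rightarrow> (real ^ 'd \<Rightarrow> complex ^ 'd) set" where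
  "Hdiv \<Omega> = {\<tau> \<in> L2 \<Omega>. \<exists>g. has_weak_div \<Omega> \<tau> g}"

text \<open>The normal trace of a field in \<open>Hdiv\<close> is the functional on (the traces of) \<open>H1\<close> functions
  given by Green's formula.\<close>

definition normal_trace ::
  "(real ^ 'd) set \<Rightarrow> (real ^ 'd \<Rightarrow> complex ^ 'd) \<Rightarrow> (real ^ 'd \<Rightarrow> complex) \<Rightarrow> complex" where
  "normal_trace \<Omega> \<tau> s = vpair \<Omega> \<tau> (wgrad \<Omega> s) + spair \<Omega> (wdiv \<Omega> \<tau>) s"

definition H0div :: "(real ^ 'd) set \<Rightarrow> (real ^ 'd \<Rightarrow> complex ^ 'd) set" where
  "H0div \<Omega> = {\<tau> \<in> Hdiv \<Omega>. \<forall>s\<in>H1 \<Omega>. normal_trace \<Omega> \<tau> s = 0}"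

definition H10div :: "(real ^ 'd) set \<Rightarrow> (real ^ 'd \<Rightarrow> complex ^ 'd) set" where
  "H10div \<Omega> = {\<tau> \<in> H0div \<Omega>. wdiv \<Omega> \<tau> \<in> H10 \<Omega>}"

definition V_space :: "(real ^ 'd) set \<Rightarrow>
    ((real ^ 'd \<Rightarrow> complex) \<times> (real ^ 'd \<Rightarrow> complex ^ 'd) \<times> (real ^ 'd \<Rightarrow> complex)) set" where
  "V_space \<Omega> = (H10 \<Omega> \<inter> L2_mean0 \<Omega>) \<times> L2 \<Omega> \<times> (H1 \<Omega> \<inter> L2_mean0 \<Omega>)"


section \<open>The two eigenvalue problems\<close>

definition eigenpair_E1 :: "(real ^ 'd) set \<Rightarrow> (real ^ 'd \<Rightarrow> real ^ 'd ^ 'd) \<Rightarrow>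
    complex \<Rightarrow> (real ^ 'd \<Rightarrow> complex ^ 'd) \<Rightarrow> bool" where
  "eigenpair_E1 \<Omega> A lam u \<longleftrightarrow>
     lam \<noteq> 0 \<and> u \<in> H10div \<Omega> \<and> \<not> ae_eq \<Omega> u (\<lambda>x. 0) \<and>
     (\<forall>v\<in>H10div \<Omega>.
        vpair \<Omega> (\<lambda>x. P_field A x *c (wgrad \<Omega> (wdiv \<Omega> u) x + lam *s u x))
                (\<lambda>x. wgrad \<Omega> (wdiv \<Omega> v) x + lam *s (matrix_inv (A x) *c v x)) = 0)"

definition eigenpair_E2 :: "(real ^ 'd) set \<Rightarrow> (real ^ 'd \<Rightarrow> real ^ 'd ^ 'd) \<Rightarrow> complex \<Rightarrow>
    (real ^ 'd \<Rightarrow> complex) \<times> (real ^ 'd \<Rightarrow> complex ^ 'd) \<times> (real ^ 'd \<Rightarrow> complex) \<Rightarrow> bool" where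
  "eigenpair_E2 \<Omega> A lam = (\<lambda>(\<phi>, y, r).
     lam \<noteq> 0 \<and> (\<phi>, y, r) \<in> V_space \<Omega> \<and>
     \<not> (ae_eq \<Omega> \<phi> (\<lambda>x. 0) \<and> ae_eq \<Omega> y (\<lambda>x. 0) \<and> ae_eq \<Omega> r (\<lambda>x. 0)) \<and>
     (\<forall>(\<psi>, z, s)\<in>V_space \<Omega>.
        vpair \<Omega> (\<lambda>x. (mat 1 + Q_field A x) *c wgrad \<Omega> \<phi> x) (wgrad \<Omega> \<psi>)
          + vpair \<Omega> (\<lambda>x. Q_field A x *c y x) (wgrad \<Omega> \<psi>)
          = lam * (spair \<Omega> \<phi> \<psi> + spair \<Omega> r \<psi>) \<and>
        vpair \<Omega> (\<lambda>x. Q_field A x *c wgrad \<Omega> \<phi> x) z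
          + vpair \<Omega> (\<lambda>x. Q_field A x *c y x) z - vpair \<Omega> (wgrad \<Omega> r) z = 0 \<and>
        - vpair \<Omega> y (wgrad \<Omega> s) = lam * spair \<Omega> \<phi> s))"

end

theory Submission
  imports Defs
begin

text \<open>Pointwise \<open>P = - (I + Q)\<close> and \<open>A\<^sup>-\<^sup>1 P = - Q\<close>, so with \<open>\<phi> = \<nabla>\<cdot>u\<close>, \<open>y = \<lambda>u\<close>
  and \<open>a = \<nabla>\<phi> + y\<close> problem (E1) reads \<open>((I + Q) a, \<nabla>\<nabla>\<cdot>v) + \<lambda>(Q a, v) = 0\<close>. The second
  equation of (E2) says \<open>Q a = \<nabla>r\<close> and the third that \<open>y\<close> has divergence \<open>\<lambda>\<phi>\<close> and no normal
  trace, so (E2) implies (E1) by Green's formula. Conversely, testing (E1) with divergence-free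
  fields shows that \<open>Q a\<close> is orthogonal to the complement of the gradients, hence a gradient
  \<open>\<nabla>r\<close>, and the first equation follows since every \<open>\<psi>\<close> of mean zero is the divergence of some
  \<open>v\<close>. Both facts are the solvability of a Neumann problem, obtained by minimising its energy.

  Coercivity of the energy is the Poincare inequality. On a convex subset it follows from
  integrating \<open>s(x + h) - s(x) = \<integral>\<^sub>0\<^sup>1 h \<cdot> \<nabla>s(x + t h) dt\<close> over \<open>x\<close> and \<open>h\<close>. It spreads over the
  domain, a null set apart a finite union of convex open pieces, because the condition
  \<open>\<integral>\<^sub>X \<integral>\<^sub>Y |s(x) - s(y)|\<^sup>2 \<le> C \<parallel>\<nabla>s\<parallel>\<^sup>2\<close> is a transitive relation between sets of positive measure.\<close>

section \<open>Smooth bump functions\<close>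

text \<open>Two features of the setting shape the argument. The pairings are bilinear without
  conjugation, so positivity is recovered by pairing with the conjugate field \<open>vcnj\<close>,
  and the energy is minimised for a real inner product; the complex identity is regained by testing
  with multiples by the imaginary unit. The operators \<open>wgrad\<close> and \<open>wdiv\<close>
  choose representatives, so identities are carried along up to null sets; that the choice is
  harmless rests on the fundamental lemma, hence on a supply of smooth bumps.

  One Neumann problem serves two purposes. With data \<open>F\<close> and no source its solution is
  the gradient part of \<open>F\<close>; with the source \<open>- \<psi>\<close> and no field, the
  gradient found is a field of divergence \<psi> without normal trace. The source must have mean
  zero, a condition that \<psi> satisfies by the choice of spaces in (E2).

  The estimate of differences comes directly from the definition of the weak gradient by translating
  test functions along segments. Convexity keeps the translated supports inside the domain. No
  approximation by smooth functions and no compactness argument is involved.\<close>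

lemma Ck_SucD: "Ck (Suc k) f \<Longrightarrow> Ck k f"
proof (induction k arbitrary: f)
  case 0
  then show ?case
    by (auto intro!: continuous_at_imp_continuous_on differentiable_imp_continuous_within)
next
  case (Suc k)
  then show ?case by (metis Ck.simps(2))
qed

text \<open>Trades the chosen \<open>frechet_derivative\<close> for an explicit formula, so that
  smoothness of a class of functions stable under differentiation becomes an induction on the
  order.\<close>

lemma Ck_SucI:
  assumes "\<And>x. (f has_derivative f' x) (at x)" and "\<And>v. Ck k (\<lambda>x. f' x v)"
  shows "Ck (Suc k) f"
proof -
  have "frechet_derivative f (at x) = f' x" for x
    using frechet_derivative_at[OF assms(1)] by simp
  then show ?thesis
    using assms by (auto simp: differentiable_def)
qed

lemma Ck_has_derivative:
  assumes "Ck (Suc k) f"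
  shows "(f has_derivative frechet_derivative f (at x)) (at x)"
  using assms by (simp add: frechet_derivative_works)

lemma Ck_const: "Ck k (\<lambda>x. c)"
proof (induction k arbitrary: c)
  case (Suc k)
  show ?case by (rule Ck_SucI[where f' = "\<lambda>x v. 0"]) (auto intro: Suc)
qed (simp)

lemma Ck_add: "Ck k f \<Longrightarrow> Ck k g \<Longrightarrow> Ck k (\<lambda>x. f x + g x)"
proof (induction k arbitrary: f g)
  case 0
  then show ?case by (auto intro: continuous_on_add)
next
  case (Suc k)
  show ?case
    by (rule Ck_SucI, rule has_derivative_add[OF Ck_has_derivative Ck_has_derivative])
      (use Suc in auto)
qed

lemma Ck_mult:
  fixes f g :: "'a::euclidean_space \<Rightarrow> 'b::real_normed_algebra"
  shows "Ck k f \<Longrightarrow> Ck k g \<Longrightarrow> Ck k (\<lambda>x. f x * g x)"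
proof (induction k arbitrary: f g)
  case 0
  then show ?case by (auto intro: continuous_on_mult)
next
  case (Suc k)
  have "Ck k f" "Ck k g"
    using Suc.prems Ck_SucD by blast+
  then have "Ck k (\<lambda>x. f x * frechet_derivative g (at x) v + frechet_derivative f (at x) v * g x)" for v
    using Suc by (intro Ck_add) auto
  then show ?case
    by (rule Ck_SucI[OF has_derivative_mult[OF Ck_has_derivative[OF Suc.prems(1)] Ck_has_derivative[OF Suc.prems(2)]]])
qed

lemma Ck_prod:
  fixes f :: "'i \<Rightarrow> 'a::euclidean_space \<Rightarrow> 'b::real_normed_field"
  assumes "\<And>i. i \<in> I \<Longrightarrow> Ck k (f i)"
  shows "Ck k (\<lambda>x. \<Prod>i\<in>I. f i x)"
  using assms by (induction I rule: infinite_finite_induct) (auto intro: Ck_const Ck_mult)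

lemma has_derivative_translate:
  fixes f :: "'a::real_normed_vector \<Rightarrow> 'b::real_normed_vector"
  assumes "(f has_derivative f') (at (x + a))"
  shows "((\<lambda>x. f (x + a)) has_derivative f') (at x)"
proof -
  have "((\<lambda>x. x + a) has_derivative (\<lambda>x. x)) (at x)"
    by (auto intro!: derivative_eq_intros)
  from has_derivative_compose[OF this assms] show ?thesis .
qed

lemma Ck_translate: "Ck k f \<Longrightarrow> Ck k (\<lambda>x. f (x + a))"
proof (induction k arbitrary: f)
  case 0
  then show ?case
    by (auto intro!: continuous_on_compose2[of UNIV f] continuous_intros)
next
  case (Suc k)
  show ?case
    by (rule Ck_SucI, rule has_derivative_translate, rule Ck_has_derivative) (use Suc in auto)
qed

text \<open>With \<open>k = 0\<close> this is the classical smooth function that is not analytic at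
  the origin. The powers in the denominator are included because each derivative is a combination of
  two further members of the family.\<close>

definition flat :: "nat \<Rightarrow> real \<Rightarrow> real" where
  "flat k t = (if t > 0 then exp (- 1 / t) / t ^ k else 0)"

text \<open>In the variable \<open>inverse x\<close> this is the decay of a power against the
  exponential at infinity.\<close>

lemma flat_tendsto_0: "(flat k \<longlongrightarrow> 0) (at_right 0)"
proof -
  have "((\<lambda>x. inverse x ^ k / exp (inverse x :: real)) \<longlongrightarrow> 0) (at_right 0)"
    by (rule filterlim_compose[OF tendsto_power_div_exp_0 filterlim_inverse_at_top_right])
  moreover have "\<forall>\<^sub>F x in at_right 0. inverse x ^ k / exp (inverse x :: real) = flat k x"
    unfolding eventually_at_filter
    by (intro always_eventually) (auto simp: flat_def exp_minus field_simps)
  ultimately show ?thesis by (rule Lim_transform_eventually)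
qed

lemma flat_has_derivative:
  "(flat k has_real_derivative flat (k + 2) t - real k * flat (k + 1) t) (at t)"
proof -
  consider "t > 0" | "t < 0" | "t = 0" by linarith
  then show ?thesis
  proof cases
    case 1
    \<comment> \<open>The power rule lowers the exponent to \<open>k - 1\<close>, so the exponents 0
      and 1 are treated apart from the others.\<close>
    have "((\<lambda>t. exp (- 1 / t) / t ^ k) has_real_derivative flat (k + 2) t - real k * flat (k + 1) t) (at t)"
      using 1
    proof (cases k)
      case (Suc n)
      then show ?thesis
        using 1 by (cases n)
          (auto intro!: derivative_eq_intros simp: flat_def field_simps power2_eq_square,
            metis One_nat_def power_eq_if)
    qed (auto intro!: derivative_eq_intros simp: flat_def power2_eq_square)
    moreover have "\<forall>\<^sub>F x in nhds t. flat k x = exp (- 1 / x) / x ^ k"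
      using eventually_nhds_in_open[of "{0<..}" t] 1
      by (auto elim!: eventually_mono simp: flat_def)
    ultimately show ?thesis
      using DERIV_cong_ev[of t t "flat k" "\<lambda>x. exp (- 1 / x) / x ^ k"] by auto
  next
    case 2
    have "((\<lambda>t. 0) has_real_derivative flat (k + 2) t - real k * flat (k + 1) t) (at t)"
      using 2 by (auto simp: flat_def)
    moreover have "\<forall>\<^sub>F x in nhds t. flat k x = 0"
      using eventually_nhds_in_open[of "{..<0}" t] 2
      by (auto elim!: eventually_mono simp: flat_def)
    ultimately show ?thesis
      using DERIV_cong_ev[of t t "flat k" "\<lambda>x. 0"] by auto
  next
    case 3
    \<comment> \<open>The difference quotient of \<open>flat k\<close> at the origin is
      \<open>flat (Suc k)\<close>, so only the one-sided limits of the latter are needed.\<close>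
    have "(flat (Suc k) \<longlongrightarrow> 0) (at_left 0)"
      by (rule tendsto_eventually) (auto simp: eventually_at_filter flat_def)
    then have "(flat (Suc k) \<longlongrightarrow> 0) (at 0)"
      using flat_tendsto_0 filterlim_split_at by blast
    then have "((\<lambda>h. (flat k (0 + h) - flat k 0) / h) \<longlongrightarrow> 0) (at 0)"
      by (rule Lim_transform_eventually)
        (auto simp: eventually_at_filter flat_def field_simps)
    then show ?thesis
      using 3 by (simp add: DERIV_def flat_def)
  qed
qed

text \<open>The induction leaves \<open>k\<close> free because differentiation raises it. Affine
  arguments in one coordinate are built in, since the chain rule reproduces them up to a constant
  factor.\<close>

lemma Ck_flat:
  "Ck n (\<lambda>x::real^'d. complex_of_real (flat k (c * x $ i + d)))"
proof (induction n arbitrary: k)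
  case 0
  have "continuous_on UNIV (flat k)"
    using flat_has_derivative by (intro DERIV_continuous_on[where D = "\<lambda>t. flat (k + 2) t - real k * flat (k + 1) t"]) auto
  then show ?case
    by (auto intro!: continuous_intros continuous_on_compose2[of UNIV "flat k"])
next
  case (Suc n)
  let ?g = "\<lambda>t. flat (k + 2) t - real k * flat (k + 1) t"
  show ?case
  proof (rule Ck_SucI)
    fix x :: "real^'d"
    have "((\<lambda>x::real^'d. c * x $ i + d) has_derivative (\<lambda>v. c * v $ i)) (at x)"
      by (auto intro!: derivative_eq_intros bounded_linear.has_derivative[OF bounded_linear_vec_nth])
    from has_derivative_compose[OF this flat_has_derivative[THEN has_field_derivative_imp_has_derivative]]
    have "((\<lambda>x::real^'d. flat k (c * x $ i + d)) has_derivative (\<lambda>v. ?g (c * x $ i + d) * (c * v $ i))) (at x)" .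
    from has_derivative_of_real[OF this]
    have "((\<lambda>x::real^'d. complex_of_real (flat k (c * x $ i + d))) has_derivative
      (\<lambda>v. complex_of_real (?g (c * x $ i + d) * (c * v $ i)))) (at x)" .
    then show "((\<lambda>x::real^'d. complex_of_real (flat k (c * x $ i + d))) has_derivative
      (\<lambda>v. (complex_of_real (flat (k + 2) (c * x $ i + d)) + complex_of_real (- real k) * complex_of_real (flat (k + 1) (c * x $ i + d))) * complex_of_real (c * v $ i))) (at x)"
      by (simp add: algebra_simps)
  next
    fix v
    show "Ck n (\<lambda>x::real^'d. (complex_of_real (flat (k + 2) (c * x $ i + d)) + complex_of_real (- real k) * complex_of_real (flat (k + 1) (c * x $ i + d))) * complex_of_real (c * v $ i))"
      by (intro Ck_mult Ck_add Ck_const Suc.IH)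
  qed
qed

text \<open>Each coordinate contributes a cutoff in \<open>m * (x $ i - a $ i) - 1\<close> and one
  in \<open>m * (b $ i - x $ i) - 1\<close>. The \<open>- 1\<close> pushes the support into a closed
  box at distance \<open>1 / m\<close> from the faces, so that it is compact inside the open box;
  the factor \<open>m\<close> drives both arguments to infinity at each interior point.\<close>

definition bump :: "real^'d \<Rightarrow> real^'d \<Rightarrow> real \<Rightarrow> real^'d \<Rightarrow> complex" where
  "bump a b m x = (\<Prod>i\<in>UNIV. complex_of_real (flat 0 (m * x $ i + (- m * a $ i - 1)))
                             * complex_of_real (flat 0 ((- m) * x $ i + (m * b $ i - 1))))"

lemma flat0_bounds: "0 \<le> flat 0 t" "flat 0 t \<le> 1"
  by (auto simp: flat_def)

lemma norm_bump_le_1: "norm (bump a b m x) \<le> 1"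
proof -
  have "norm (bump a b m x) = (\<Prod>i\<in>UNIV. flat 0 (m * x $ i + (- m * a $ i - 1))
                             * flat 0 ((- m) * x $ i + (m * b $ i - 1)))"
    using flat0_bounds(1) by (simp add: bump_def prod_norm[symmetric] norm_mult)
  also have "\<dots> \<le> (\<Prod>i\<in>(UNIV::'a set). 1)"
    by (intro prod_mono conjI mult_nonneg_nonneg mult_le_one flat0_bounds)
  finally show ?thesis by simp
qed

lemma bump_eq_0:
  assumes "m > 0" "x \<notin> cbox (\<chi> i. a $ i + 1 / m) (\<chi> i. b $ i - 1 / m)"
  shows "bump a b m x = 0"
proof -
  from assms(2) obtain i where "x $ i < a $ i + 1 / m \<or> x $ i > b $ i - 1 / m"
    by (auto simp: mem_box_cart not_le)
  then have "m * x $ i + (- m * a $ i - 1) \<le> 0 \<or> (- m) * x $ i + (m * b $ i - 1) \<le> 0"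
    using assms(1) by (auto simp: field_simps)
  then have "\<exists>i. complex_of_real (flat 0 (m * x $ i + (- m * a $ i - 1)))
                             * complex_of_real (flat 0 ((- m) * x $ i + (m * b $ i - 1))) = 0"
    by (intro exI[of _ i]) (auto simp: flat_def)
  then show ?thesis
    unfolding bump_def by (subst prod_zero_iff) auto
qed

lemma cbox_shrink_subset_box:
  fixes a b :: "real^'d"
  assumes "m > 0"
  shows "cbox (\<chi> i. a $ i + 1 / m) (\<chi> i. b $ i - 1 / m) \<subseteq> box a b"
proof
  fix x assume "x \<in> cbox (\<chi> i. a $ i + 1 / m) (\<chi> i. b $ i - 1 / m)"
  then have *: "a $ i + 1 / m \<le> x $ i" "x $ i \<le> b $ i - 1 / m" for i
    by (auto simp: mem_box_cart)
  have "1 / m > 0" using assms(1) by simp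
  then have "a $ i < x $ i" "x $ i < b $ i" for i
    using *[of i] by linarith+
  then show "x \<in> box a b" by (auto simp: mem_box_cart)
qed

lemma bump_support:
  assumes "m > 0"
  shows "closure {x. bump a b m x \<noteq> 0} \<subseteq> cbox (\<chi> i. a $ i + 1 / m) (\<chi> i. b $ i - 1 / m)"
  by (rule closure_minimal) (use bump_eq_0[OF assms] in auto)

lemma bump_in_test_functions:
  assumes "m > 0" "box a b \<subseteq> \<Omega>"
  shows "bump a b m \<in> test_functions \<Omega>"
proof -
  have "Ck k (bump a b m)" for k
    unfolding bump_def by (intro Ck_prod Ck_mult Ck_flat)
  moreover have "closure {x. bump a b m x \<noteq> 0} \<subseteq> \<Omega>"
    using cbox_shrink_subset_box[OF assms(1), of a b] bump_support[OF assms(1), of a b] assms(2) by blast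
  moreover have "compact (closure {x. bump a b m x \<noteq> 0})"
    using bump_support[OF assms(1), of a b] bounded_subset[OF bounded_cbox] compact_eq_bounded_closed by blast
  ultimately show ?thesis
    unfolding test_functions_def by blast
qed

lemma flat0_tendsto_1:
  assumes "t > 0"
  shows "(\<lambda>n. flat 0 (real (Suc n) * t - 1)) \<longlonglongrightarrow> 1"
proof -
  have lim: "filterlim (\<lambda>n. real (Suc n) * t - 1) at_top sequentially"
    unfolding filterlim_at_top
  proof
    fix Z
    obtain N where N: "real N > (Z + 1) / t"
      using reals_Archimedean2 by blast
    have "Z \<le> real (Suc n) * t - 1" if "n \<ge> N" for n
    proof -
      have "(Z + 1) / t \<le> real (Suc n)" using N that by simp
      then show ?thesis using assms by (simp add: field_simps)
    qed
    then show "\<forall>\<^sub>F n in sequentially. Z \<le> real (Suc n) * t - 1"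
      by (auto simp: eventually_sequentially)
  qed
  have "((\<lambda>u::real. exp (- 1 / u)) \<longlongrightarrow> 1) at_top"
    using tendsto_exp[OF tendsto_divide_0[OF tendsto_const filterlim_at_top_imp_at_infinity[OF filterlim_ident]], of "-1"]
    by simp
  then have "(flat 0 \<longlongrightarrow> 1) at_top"
    by (rule Lim_transform_eventually)
      (use eventually_gt_at_top[of 0] in \<open>auto elim!: eventually_mono simp: flat_def\<close>)
  from filterlim_compose[OF this lim] show ?thesis .
qed

lemma bump_tendsto_indicator:
  "(\<lambda>n. bump a b (real (Suc n)) x) \<longlonglongrightarrow> indicator (box a b) x"
proof (cases "x \<in> box a b")
  case True
  have "(\<lambda>n. bump a b (real (Suc n)) x) \<longlonglongrightarrow> (\<Prod>i\<in>(UNIV::'a set). complex_of_real 1 * complex_of_real 1)"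
    unfolding bump_def
  proof (intro tendsto_prod tendsto_mult tendsto_of_real)
    fix i
    have "x $ i - a $ i > 0" "b $ i - x $ i > 0"
      using True by (auto simp: mem_box_cart)
    from this[THEN flat0_tendsto_1]
    show "(\<lambda>n. flat 0 (real (Suc n) * x $ i + (- real (Suc n) * a $ i - 1))) \<longlonglongrightarrow> 1"
      "(\<lambda>n. flat 0 (- real (Suc n) * x $ i + (real (Suc n) * b $ i - 1))) \<longlonglongrightarrow> 1"
      by (simp_all add: algebra_simps)
  qed
  then show ?thesis using True by simp
next
  case False
  have "bump a b (real (Suc n)) x = 0" for n
  proof (rule bump_eq_0)
    show "x \<notin> cbox (\<chi> i. a $ i + 1 / real (Suc n)) (\<chi> i. b $ i - 1 / real (Suc n))"
      using False cbox_shrink_subset_box[of "real (Suc n)" a b] by auto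
  qed simp
  then show ?thesis using False by simp
qed

section \<open>Square-integrable functions and the fundamental lemma\<close>

lemma L2_measurable: "f \<in> L2 \<Omega> \<Longrightarrow> f \<in> borel_measurable (lebesgue_on \<Omega>)"
  by (simp add: L2_def)

lemma L2_integrable_norm_sq: "f \<in> L2 \<Omega> \<Longrightarrow> integrable (lebesgue_on \<Omega>) (\<lambda>x. (norm (f x))\<^sup>2)"
  by (simp add: L2_def)

abbreviation sqint :: "'a::euclidean_space set \<Rightarrow> ('a \<Rightarrow> 'b::euclidean_space) \<Rightarrow> real" where
  "sqint \<Omega> f \<equiv> (LINT x|lebesgue_on \<Omega>. (norm (f x))\<^sup>2)"

lemma L2_zero: "(\<lambda>x. 0) \<in> L2 \<Omega>"
  by (simp add: L2_def)

lemma L2_bound: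
  assumes "g \<in> L2 \<Omega>" "f \<in> borel_measurable (lebesgue_on \<Omega>)"
    and "AE x in lebesgue_on \<Omega>. norm (f x) \<le> c * norm (g x)"
  shows "f \<in> L2 \<Omega>"
  unfolding L2_def
proof (intro CollectI conjI assms(2))
  show "integrable (lebesgue_on \<Omega>) (\<lambda>x. (norm (f x))\<^sup>2)"
  proof (rule Bochner_Integration.integrable_bound)
    show "integrable (lebesgue_on \<Omega>) (\<lambda>x. c\<^sup>2 * (norm (g x))\<^sup>2)"
      using L2_integrable_norm_sq[OF assms(1)] by simp
    show "AE x in lebesgue_on \<Omega>. norm ((norm (f x))\<^sup>2) \<le> norm (c\<^sup>2 * (norm (g x))\<^sup>2)"
      using assms(3)
    proof eventually_elim
      case (elim x)
      then have "(norm (f x))\<^sup>2 \<le> (c * norm (g x))\<^sup>2" by (intro power_mono) auto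
      then show ?case by (simp add: power_mult_distrib)
    qed
  qed (use assms(2) in measurable)
qed

lemma L2_ae_cong:
  assumes "f \<in> L2 \<Omega>" "g \<in> borel_measurable (lebesgue_on \<Omega>)" "AE x in lebesgue_on \<Omega>. g x = f x"
  shows "g \<in> L2 \<Omega>"
  using assms by (intro L2_bound[where c = 1, OF assms(1,2)]) auto

lemma L2_add:
  assumes "f \<in> L2 \<Omega>" "g \<in> L2 \<Omega>"
  shows "(\<lambda>x. f x + g x) \<in> L2 \<Omega>"
  unfolding L2_def
proof (intro CollectI conjI)
  note [measurable] = assms[THEN L2_measurable]
  show "(\<lambda>x. f x + g x) \<in> borel_measurable (lebesgue_on \<Omega>)" by measurable
  show "integrable (lebesgue_on \<Omega>) (\<lambda>x. (norm (f x + g x))\<^sup>2)"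
  proof (rule Bochner_Integration.integrable_bound)
    show "integrable (lebesgue_on \<Omega>) (\<lambda>x. 2 * (norm (f x))\<^sup>2 + 2 * (norm (g x))\<^sup>2)"
      using assms[THEN L2_integrable_norm_sq] by simp
    have "(norm (f x + g x))\<^sup>2 \<le> 2 * (norm (f x))\<^sup>2 + 2 * (norm (g x))\<^sup>2" for x
    proof -
      have "(norm (f x + g x))\<^sup>2 \<le> (norm (f x) + norm (g x))\<^sup>2"
        by (intro power_mono norm_triangle_ineq) auto
      also have "\<dots> \<le> 2 * (norm (f x))\<^sup>2 + 2 * (norm (g x))\<^sup>2"
        using sum_squares_ge_zero[of "norm (f x) - norm (g x)" 0]
        by (simp add: power2_eq_square algebra_simps)
      finally show ?thesis .
    qed
    then show "AE x in lebesgue_on \<Omega>. norm ((norm (f x + g x))\<^sup>2) \<le> norm (2 * (norm (f x))\<^sup>2 + 2 * (norm (g x))\<^sup>2)"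
      by auto
  qed measurable
qed

lemma L2_bounded_linear:
  assumes "bounded_linear T" "f \<in> L2 \<Omega>"
  shows "(\<lambda>x. T (f x)) \<in> L2 \<Omega>"
proof -
  obtain K where "\<And>x. norm (T x) \<le> norm x * K"
    using bounded_linear.bounded[OF assms(1)] by blast
  moreover have "(\<lambda>x. T (f x)) \<in> borel_measurable (lebesgue_on \<Omega>)"
    using L2_measurable[OF assms(2)] borel_measurable_continuous_onI[OF linear_continuous_on[OF assms(1)]]
      measurable_compose by blast
  ultimately show ?thesis
    by (intro L2_bound[where c = K, OF assms(2)]) (auto simp: mult.commute)
qed

lemma L2_diff: "f \<in> L2 \<Omega> \<Longrightarrow> g \<in> L2 \<Omega> \<Longrightarrow> (\<lambda>x. f x - g x) \<in> L2 \<Omega>"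
  using L2_add[of f \<Omega> "\<lambda>x. - g x"] L2_bounded_linear[of uminus g \<Omega>]
  by (simp add: bounded_linear_minus bounded_linear_ident)

lemma L2_scaleR: "f \<in> L2 \<Omega> \<Longrightarrow> (\<lambda>x. c *\<^sub>R f x) \<in> L2 \<Omega>"
  by (rule L2_bounded_linear[OF bounded_linear_scaleR_right])

lemma L2_cmult: "f \<in> L2 \<Omega> \<Longrightarrow> (\<lambda>x. c * f x :: complex) \<in> L2 \<Omega>"
  by (rule L2_bounded_linear[OF bounded_linear_mult_right])

lemma bounded_linear_vector_smult: "bounded_linear (\<lambda>v::complex^'n. c *s v)"
proof -
  have "linear (\<lambda>v::complex^'n. c *s v)"
    by (rule linearI) (auto simp: vec_eq_iff algebra_simps)
  then show ?thesis by (simp add: linear_conv_bounded_linear)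
qed

lemma L2_smult: "f \<in> L2 \<Omega> \<Longrightarrow> (\<lambda>x. c *s f x :: complex^'n) \<in> L2 \<Omega>"
  by (rule L2_bounded_linear[OF bounded_linear_vector_smult])

lemma L2_nth: "f \<in> L2 \<Omega> \<Longrightarrow> (\<lambda>x. f x $ i) \<in> L2 \<Omega>"
  by (rule L2_bounded_linear[OF bounded_linear_vec_nth])

text \<open>Since \<open>vpair\<close> has no conjugation, \<open>vdot a a\<close> may vanish for a
  nonzero \<open>a\<close>. Pairing with \<open>vcnj a\<close> restores the squared norm.\<close>

definition vcnj :: "complex^'n \<Rightarrow> complex^'n" where
  "vcnj v = (\<chi> i. cnj (v $ i))"

lemma bounded_linear_vcnj: "bounded_linear (vcnj :: complex^'n \<Rightarrow> complex^'n)"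
proof -
  have "linear (vcnj :: complex^'n \<Rightarrow> complex^'n)"
    by (rule linearI) (auto simp: vec_eq_iff vcnj_def)
  then show ?thesis by (simp add: linear_conv_bounded_linear)
qed

lemma L2_vcnj: "f \<in> L2 \<Omega> \<Longrightarrow> (\<lambda>x. vcnj (f x)) \<in> L2 \<Omega>"
  by (rule L2_bounded_linear[OF bounded_linear_vcnj])

lemma L2_cnj: "f \<in> L2 \<Omega> \<Longrightarrow> (\<lambda>x. cnj (f x)) \<in> L2 \<Omega>"
  by (rule L2_bounded_linear[OF bounded_linear_cnj])

text \<open>A product of norms is at most the sum of their squares. The bilinear map is kept general
  because \<open>vdot\<close>, complex multiplication, the real inner product and scalar
  multiplication are all used.\<close>

lemma L2_bilinear_integrable:
  fixes B :: "'b::euclidean_space \<Rightarrow> 'c::euclidean_space \<Rightarrow> 'e::euclidean_space"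
  assumes "bounded_bilinear B" "f \<in> L2 \<Omega>" "g \<in> L2 \<Omega>"
  shows "integrable (lebesgue_on \<Omega>) (\<lambda>x. B (f x) (g x))"
proof -
  interpret bounded_bilinear B by fact
  obtain K where K: "\<And>a b. norm (B a b) \<le> norm a * norm b * K" "K > 0"
    using pos_bounded by blast
  note [measurable] = assms(2,3)[THEN L2_measurable]
  have "norm (B (f x) (g x)) \<le> K * (norm (f x))\<^sup>2 + K * (norm (g x))\<^sup>2" for x
  proof -
    have "norm (f x) * norm (g x) \<le> (norm (f x))\<^sup>2 + (norm (g x))\<^sup>2"
      using sum_squares_bound[of "norm (f x)" "norm (g x)"]
        mult_nonneg_nonneg[OF norm_ge_zero[of "f x"] norm_ge_zero[of "g x"]] by linarith
    then have "norm (f x) * norm (g x) * K \<le> ((norm (f x))\<^sup>2 + (norm (g x))\<^sup>2) * K"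
      using K(2) by (intro mult_right_mono) auto
    then show ?thesis using K(1)[of "f x" "g x"] by (simp add: algebra_simps)
  qed
  moreover have "0 \<le> K * (norm (f x))\<^sup>2 + K * (norm (g x))\<^sup>2" for x
    using K(2) by simp
  ultimately have *: "norm (B (f x) (g x)) \<le> norm (K * (norm (f x))\<^sup>2 + K * (norm (g x))\<^sup>2)" for x
    by (metis abs_of_nonneg real_norm_def)
  show ?thesis
  proof (rule Bochner_Integration.integrable_bound)
    show "integrable (lebesgue_on \<Omega>) (\<lambda>x. K * (norm (f x))\<^sup>2 + K * (norm (g x))\<^sup>2)"
      using assms(2,3)[THEN L2_integrable_norm_sq] by simp
    have "continuous_on UNIV (\<lambda>p. B (fst p) (snd p))"
      by (intro continuous_on continuous_intros)
    from borel_measurable_continuous_onI[OF this]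
    have "(\<lambda>p. B (fst p) (snd p)) \<in> borel_measurable (borel \<Otimes>\<^sub>M borel)"
      by (simp add: borel_prod)
    from measurable_compose[OF _ this, of "\<lambda>x. (f x, g x)" "lebesgue_on \<Omega>"]
    show "(\<lambda>x. B (f x) (g x)) \<in> borel_measurable (lebesgue_on \<Omega>)" by simp
  qed (use * in auto)
qed

text \<open>The integrand of \<open>vpair\<close>, named so that facts about bounded bilinear maps
  apply to it.\<close>

definition vdot :: "complex^'n \<Rightarrow> complex^'n \<Rightarrow> complex" where
  "vdot a b = (\<Sum>i\<in>UNIV. a $ i * b $ i)"

lemma vpair_vdot: "vpair \<Omega> f g = (LINT x|lebesgue_on \<Omega>. vdot (f x) (g x))"
  by (simp add: vpair_def vdot_def)

lemma bounded_bilinear_vdot: "bounded_bilinear (vdot :: complex^'n \<Rightarrow> _)"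
proof
  show "\<exists>K. \<forall>a b::complex^'n. norm (vdot a b) \<le> norm a * norm b * K"
  proof (intro exI[of _ "real CARD('n)"] allI)
    fix a b :: "complex^'n"
    have "norm (vdot a b) \<le> (\<Sum>i\<in>(UNIV::'n set). norm (a $ i) * norm (b $ i))"
      unfolding vdot_def by (rule order_trans[OF norm_sum]) (simp add: norm_mult)
    also have "\<dots> \<le> (\<Sum>i\<in>(UNIV::'n set). norm a * norm b)"
      by (intro sum_mono mult_mono Finite_Cartesian_Product.norm_nth_le) auto
    finally show "norm (vdot a b) \<le> norm a * norm b * real CARD('n)"
      by (simp add: mult.commute)
  qed
qed (auto simp: vdot_def algebra_simps sum.distrib sum_distrib_left scaleR_sum_right)

lemmas vdot_simps =
  bounded_bilinear.add_left[OF bounded_bilinear_vdot]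
  bounded_bilinear.add_right[OF bounded_bilinear_vdot]
  bounded_bilinear.diff_left[OF bounded_bilinear_vdot]
  bounded_bilinear.diff_right[OF bounded_bilinear_vdot]
  bounded_bilinear.minus_left[OF bounded_bilinear_vdot]
  bounded_bilinear.minus_right[OF bounded_bilinear_vdot]
  bounded_bilinear.zero_left[OF bounded_bilinear_vdot]
  bounded_bilinear.zero_right[OF bounded_bilinear_vdot]

lemma vdot_smult: "vdot (c *s a) b = c * vdot a b" "vdot a (c *s b) = c * vdot a b"
  by (auto simp: vdot_def sum_distrib_left algebra_simps)

lemma vdot_commute: "vdot a b = vdot b a"
  by (simp add: vdot_def mult.commute)

lemma vdot_vcnj_self: "vdot a (vcnj a) = of_real ((norm a)\<^sup>2)"
proof -
  have "(norm a)\<^sup>2 = (\<Sum>i\<in>UNIV. (norm (a $ i))\<^sup>2)"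
    by (simp add: norm_vec_def L2_set_def sum_nonneg)
  then show ?thesis
    by (simp add: vdot_def vcnj_def complex_norm_square[symmetric])
qed

lemma inner_vcnj: "inner a (vcnj b) = Re (vdot a b)"
  by (simp add: inner_vec_def vdot_def vcnj_def inner_complex_def)

lemma inner_cnj: "inner a (cnj b) = Re (a * b)"
  by (simp add: inner_complex_def)

lemma integrable_vdot:
  "f \<in> L2 \<Omega> \<Longrightarrow> g \<in> L2 \<Omega> \<Longrightarrow> integrable (lebesgue_on \<Omega>) (\<lambda>x. vdot (f x) (g x))"
  by (rule L2_bilinear_integrable[OF bounded_bilinear_vdot])

lemma integrable_L2_mult:
  fixes f g :: "_ \<Rightarrow> complex"
  shows "f \<in> L2 \<Omega> \<Longrightarrow> g \<in> L2 \<Omega> \<Longrightarrow> integrable (lebesgue_on \<Omega>) (\<lambda>x. f x * g x)"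
  by (rule L2_bilinear_integrable[OF bounded_bilinear_mult])

lemma integrable_L2_inner:
  "f \<in> L2 \<Omega> \<Longrightarrow> g \<in> L2 \<Omega> \<Longrightarrow> integrable (lebesgue_on \<Omega>) (\<lambda>x. inner (f x) (g x))"
  by (rule L2_bilinear_integrable[OF bounded_bilinear_inner])

lemma vpair_cong_ae:
  assumes "f \<in> L2 \<Omega>" "g \<in> L2 \<Omega>" "f' \<in> L2 \<Omega>" "g' \<in> L2 \<Omega>" "ae_eq \<Omega> f f'" "ae_eq \<Omega> g g'"
  shows "vpair \<Omega> f g = vpair \<Omega> f' g'"
  unfolding vpair_vdot
  by (rule integral_cong_AE)
    (use assms borel_measurable_integrable[OF integrable_vdot] in \<open>auto simp: ae_eq_def\<close>)

lemma spair_cong_ae: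
  assumes "f \<in> L2 \<Omega>" "g \<in> L2 \<Omega>" "f' \<in> L2 \<Omega>" "g' \<in> L2 \<Omega>" "ae_eq \<Omega> f f'" "ae_eq \<Omega> g g'"
  shows "spair \<Omega> f g = spair \<Omega> f' g'"
  unfolding spair_def
  by (rule integral_cong_AE)
    (use assms borel_measurable_integrable[OF integrable_L2_mult] in \<open>auto simp: ae_eq_def\<close>)

lemma sqint_cong_ae:
  assumes "f \<in> L2 \<Omega>" "g \<in> L2 \<Omega>" "ae_eq \<Omega> f g"
  shows "sqint \<Omega> f = sqint \<Omega> g"
proof (rule integral_cong_AE)
  show "AE x in lebesgue_on \<Omega>. (norm (f x))\<^sup>2 = (norm (g x))\<^sup>2"
    using assms(3) unfolding ae_eq_def by eventually_elim simp
qed (use assms(1,2) in \<open>auto dest!: L2_measurable\<close>)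

section \<open>Borel representatives and translations on the whole space\<close>

lemma AE_lebesgue_on_iff:
  assumes "\<Omega> \<in> sets borel"
  shows "(AE x in lebesgue_on \<Omega>. P x) \<longleftrightarrow> (AE x in lborel. x \<in> \<Omega> \<longrightarrow> P x)"
  using assms by (subst AE_restrict_space_iff) (auto simp: AE_completion_iff)

lemma integrable_lebesgue_on_iff:
  fixes h :: "'a::euclidean_space \<Rightarrow> 'b::euclidean_space"
  assumes "\<Omega> \<in> sets borel" "h \<in> borel_measurable borel" "\<And>x. x \<notin> \<Omega> \<Longrightarrow> h x = 0"
  shows "integrable (lebesgue_on \<Omega>) h \<longleftrightarrow> integrable lborel h"
proof -
  have "(\<lambda>x. indicator \<Omega> x *\<^sub>R h x) = h"
    using assms(3) by (auto simp: indicator_def)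
  then show ?thesis
    using assms integrable_completion[of h lborel] by (simp add: integrable_restrict_space)
qed

lemma integral_lebesgue_on_eq:
  fixes h :: "'a::euclidean_space \<Rightarrow> 'b::euclidean_space"
  assumes "\<Omega> \<in> sets borel" "h \<in> borel_measurable borel" "\<And>x. x \<notin> \<Omega> \<Longrightarrow> h x = 0"
  shows "integral\<^sup>L (lebesgue_on \<Omega>) h = integral\<^sup>L lborel h"
proof -
  have "(\<lambda>x. indicator \<Omega> x *\<^sub>R h x) = h"
    using assms(3) by (auto simp: indicator_def)
  then show ?thesis
    using assms integral_completion[of h lborel] by (simp add: integral_restrict_space)
qed

lemma lebesgue_ex_borel_measurable:
  fixes f :: "'a::euclidean_space \<Rightarrow> 'b::euclidean_space"
  assumes "f \<in> borel_measurable lebesgue"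
  obtains g where "g \<in> borel_measurable borel" "AE x in lborel. g x = f x"
proof -
  have "\<exists>g\<in>borel_measurable lborel. AE x in lborel. inner (f x) b = g x" for b
    by (rule completion_ex_borel_measurable_real) (use assms in measurable)
  then obtain g where g: "\<And>b. g b \<in> borel_measurable lborel" "\<And>b. AE x in lborel. inner (f x) b = g b x"
    by metis
  have "AE x in lborel. \<forall>b\<in>Basis. inner (f x) b = g b x"
    using g(2) by (intro AE_finite_allI) auto
  then have "AE x in lborel. (\<Sum>b\<in>Basis. g b x *\<^sub>R b) = f x"
  proof eventually_elim
    case (elim x)
    then have "(\<Sum>b\<in>Basis. g b x *\<^sub>R b) = (\<Sum>b\<in>Basis. inner (f x) b *\<^sub>R b)" by simp
    then show ?case by (simp add: euclidean_representation)
  qed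
  moreover have "(\<lambda>x. \<Sum>b\<in>Basis. g b x *\<^sub>R b) \<in> borel_measurable borel"
    using g(1) by (simp add: borel_measurable_scaleR)
  ultimately show ?thesis using that by blast
qed

text \<open>Translations and product measures are used with \<open>lborel\<close>, hence the change
  to a Borel function; the extension by zero turns integrals over the domain into integrals over the
  whole space.\<close>

lemma L2_borel_rep:
  fixes f :: "'a::euclidean_space \<Rightarrow> 'b::euclidean_space"
  assumes "\<Omega> \<in> sets borel" "f \<in> L2 \<Omega>"
  obtains g where "g \<in> borel_measurable borel" "\<And>x. x \<notin> \<Omega> \<Longrightarrow> g x = 0" "ae_eq \<Omega> g f" "g \<in> L2 \<Omega>"
proof -
  have "(\<lambda>x. indicator \<Omega> x *\<^sub>R f x) \<in> borel_measurable lebesgue"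
    using L2_measurable[OF assms(2)] assms(1)
    by (subst (asm) borel_measurable_restrict_space_iff) auto
  then obtain g0 where g0: "g0 \<in> borel_measurable borel" "AE x in lborel. g0 x = indicator \<Omega> x *\<^sub>R f x"
    by (rule lebesgue_ex_borel_measurable)
  define g where "g x = indicator \<Omega> x *\<^sub>R g0 x" for x
  have g: "g \<in> borel_measurable borel"
    unfolding g_def using g0(1) assms(1) by simp
  have ae: "AE x in lebesgue_on \<Omega>. g x = f x"
    using g0(2) unfolding AE_lebesgue_on_iff[OF assms(1)] g_def by eventually_elim simp
  have "g \<in> borel_measurable (lebesgue_on \<Omega>)"
    using g by (intro measurable_restrict_space1 measurable_completion) simp
  then show ?thesis
    using that[OF g] ae L2_ae_cong[OF assms(2)] by (auto simp: g_def ae_eq_def)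
qed

lemma borel_imp_lebesgue_on: "g \<in> borel_measurable borel \<Longrightarrow> g \<in> borel_measurable (lebesgue_on \<Omega>)"
  by (intro measurable_restrict_space1 measurable_completion) simp

lemma lborel_shift:
  fixes f :: "'a::euclidean_space \<Rightarrow> 'b::{banach,second_countable_topology}"
  assumes [measurable]: "f \<in> borel_measurable borel"
  shows "integral\<^sup>L lborel (\<lambda>x. f (x + h)) = integral\<^sup>L lborel f"
proof -
  have "integral\<^sup>L lborel f = integral\<^sup>L (distr lborel borel ((+) h)) f"
    by (simp add: lborel_distr_plus)
  also have "\<dots> = integral\<^sup>L lborel (\<lambda>x. f (x + h))"
    by (subst integral_distr) (auto simp: add.commute)
  finally show ?thesis by simp
qed

lemma lborel_shift_integrable:
  fixes f :: "'a::euclidean_space \<Rightarrow> 'b::{banach,second_countable_topology}"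
  assumes "integrable lborel f"
  shows "integrable lborel (\<lambda>x. f (x + h))"
proof -
  have "integrable (distr lborel borel ((+) h)) f"
    using assms by (simp add: lborel_distr_plus)
  then show ?thesis
    by (subst (asm) integrable_distr_eq) (use assms in \<open>auto simp: add.commute\<close>)
qed

lemma lborel_shift_nn:
  fixes f :: "'a::euclidean_space \<Rightarrow> ennreal"
  assumes [measurable]: "f \<in> borel_measurable borel"
  shows "(\<integral>\<^sup>+x. f (x + h) \<partial>lborel) = integral\<^sup>N lborel f"
proof -
  have "integral\<^sup>N lborel f = integral\<^sup>N (distr lborel borel ((+) h)) f"
    by (simp add: lborel_distr_plus)
  also have "\<dots> = (\<integral>\<^sup>+x. f (x + h) \<partial>lborel)"
    by (subst nn_integral_distr) (auto simp: add.commute)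
  finally show ?thesis by simp
qed

text \<open>Bumps turn the hypothesis into vanishing integrals over boxes; a Dynkin argument extends this
  to all Borel subsets of a box.\<close>

lemma fundamental_lemma:
  fixes f :: "real^'d \<Rightarrow> complex"
  assumes f: "integrable lborel f" and "open U"
    and test: "\<And>\<eta>. \<eta> \<in> test_functions U \<Longrightarrow> (LINT x|lborel. f x * \<eta> x) = 0"
  shows "AE x in lborel. x \<in> U \<longrightarrow> f x = 0"
proof -
  have [measurable]: "f \<in> borel_measurable borel"
    using f by auto
  have setint: "set_integrable lborel A f" if "A \<in> sets borel" for A
    using f that by (simp add: set_integrable_def integrable_mult_indicator)
  have Bbox: "set_lebesgue_integral lborel (box a b) f = 0" if "box a b \<subseteq> U" for a b
  proof -
    have [measurable]: "bump a b m \<in> borel_measurable borel" for m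
    proof -
      have "Ck 0 (bump a b m)"
        unfolding bump_def by (intro Ck_prod Ck_mult Ck_flat)
      then show ?thesis by (simp add: borel_measurable_continuous_onI)
    qed
    have "(\<lambda>n. LINT x|lborel. f x * bump a b (real (Suc n)) x) \<longlonglongrightarrow> (LINT x|lborel. f x * indicator (box a b) x)"
    proof (rule integral_dominated_convergence)
      show "integrable lborel (\<lambda>x. norm (f x))" using f by simp
      show "AE x in lborel. (\<lambda>n. f x * bump a b (real (Suc n)) x) \<longlonglongrightarrow> f x * indicator (box a b) x"
        by (intro AE_I2 tendsto_mult_left bump_tendsto_indicator)
      show "AE x in lborel. norm (f x * bump a b (real (Suc n)) x) \<le> norm (f x)" for n
        using norm_bump_le_1[of a b "real (Suc n)"]
        by (intro AE_I2) (simp add: norm_mult mult_left_le)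
    qed measurable
    moreover have "(LINT x|lborel. f x * bump a b (real (Suc n)) x) = 0" for n
      by (intro test bump_in_test_functions that) simp
    ultimately have "(LINT x|lborel. f x * indicator (box a b) x) = 0"
      using LIMSEQ_unique[OF _ tendsto_const] by simp
    moreover have "(LINT x|lborel. f x * indicator (box a b) x) = set_lebesgue_integral lborel (box a b) f"
      unfolding set_lebesgue_integral_def
      by (intro Bochner_Integration.integral_cong) (auto simp: indicator_def)
    ultimately show ?thesis by simp
  qed
  have box0: "AE x in lborel. x \<in> box a b \<longrightarrow> f x = 0" if sub: "box a b \<subseteq> U" for a b
  proof -
    \<comment> \<open>Intersecting with a fixed box inside \<open>U\<close> keeps every set where
      the hypothesis on \<open>f\<close> is available, and gives complements a reference integral
      that vanishes.\<close>
    have 0: "set_lebesgue_integral lborel (A \<inter> box a b) f = 0" if A: "A \<in> sets borel" for A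
    proof -
      have "Int_stable (range (\<lambda>(a, b). box a b :: (real^'d) set))"
        by (auto simp: Int_stable_def box_Int_box)
      moreover have "(range (\<lambda>(a, b). box a b)) \<subseteq> Pow (UNIV :: (real^'d) set)"
        by auto
      moreover have "A \<in> sigma_sets UNIV (range (\<lambda>(a, b). box a b))"
        using A unfolding borel_eq_box by simp
      ultimately show ?thesis
      proof (induction rule: sigma_sets_induct_disjoint)
        case (basic A)
        then obtain l u where "A = box l u" by auto
        then have "\<exists>l' u'. A \<inter> box a b = box l' u'" by (auto simp: box_Int_box)
        then obtain l' u' where lu: "A \<inter> box a b = box l' u'" by blast
        then have "box l' u' \<subseteq> U" using sub by blast
        then show ?case unfolding lu by (rule Bbox)
      next
        case empty
        then show ?case by (simp add: set_lebesgue_integral_def)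
      next
        case (compl A)
        then have [measurable]: "A \<in> sets borel"
          by (simp add: borel_eq_box)
        have "set_lebesgue_integral lborel ((A \<inter> box a b) \<union> ((UNIV - A) \<inter> box a b)) f =
          set_lebesgue_integral lborel (A \<inter> box a b) f + set_lebesgue_integral lborel ((UNIV - A) \<inter> box a b) f"
          by (intro set_integral_Un setint) auto
        moreover have "(A \<inter> box a b) \<union> ((UNIV - A) \<inter> box a b) = box a b" by auto
        ultimately show ?case using Bbox[OF sub] compl by simp
      next
        case (union F)
        then have [measurable]: "\<And>i. F i \<in> sets borel"
          by (simp add: borel_eq_box subset_eq)
        have "set_lebesgue_integral lborel (\<Union>i. F i \<inter> box a b) f =
            (\<Sum>i. set_lebesgue_integral lborel (F i \<inter> box a b) f)"
          using union(1) by (intro lebesgue_integral_countable_add setint) (auto simp: disjoint_family_on_def)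
        then show ?case using union by simp
      qed
    qed
    have "AE x in lborel. indicator (box a b) x *\<^sub>R f x = 0"
    proof (rule sigma_finite_measure.density_zero[OF sigma_finite_lborel])
      show "integrable lborel (\<lambda>x. indicat_real (box a b) x *\<^sub>R f x)"
        using setint[of "box a b"] by (simp add: set_integrable_def)
      fix A :: "(real^'d) set" assume "A \<in> sets lborel"
      then have "set_lebesgue_integral lborel (A \<inter> box a b) f = 0"
        using 0 by simp
      then show "set_lebesgue_integral lborel A (\<lambda>x. indicat_real (box a b) x *\<^sub>R f x) = 0"
        by (simp add: set_lebesgue_integral_def indicator_inter_arith)
    qed
    then show ?thesis by eventually_elim (auto simp: indicator_def)
  qed
  obtain D where D: "countable D" "\<And>X. X \<in> D \<Longrightarrow> \<exists>a b. X = box a b" "\<Union>D = U"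
    using open_countable_Union_open_box[OF \<open>open U\<close>] by metis
  have "AE x in lborel. \<forall>X\<in>D. x \<in> X \<longrightarrow> f x = 0"
    unfolding AE_ball_countable[OF D(1)]
  proof
    fix X assume "X \<in> D"
    then obtain a b where "X = box a b" "box a b \<subseteq> U" using D(2,3) by blast
    then show "AE x in lborel. x \<in> X \<longrightarrow> f x = 0" using box0 by simp
  qed
  then show ?thesis
    by (rule AE_mp) (use D(3) in \<open>intro AE_I2, blast\<close>)
qed

section \<open>Test functions and integrals over segments\<close>

lemma continuous_compact_support_bounded:
  fixes f :: "'a::topological_space \<Rightarrow> 'b::real_normed_vector"
  assumes "continuous_on UNIV f" "compact K" "\<And>x. x \<notin> K \<Longrightarrow> f x = 0"
  obtains B where "B \<ge> 0" "\<And>x. norm (f x) \<le> B"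
proof -
  have "bounded (f ` K)"
    using assms(2) continuous_on_subset[OF assms(1)]
    by (intro compact_imp_bounded compact_continuous_image) auto
  then obtain B where B: "B > 0" "\<And>x. x \<in> K \<Longrightarrow> norm (f x) \<le> B"
    by (auto simp: bounded_pos)
  then have "norm (f x) \<le> B" for x
    using assms(3)[of x] by (cases "x \<in> K") auto
  then show ?thesis using B(1) by (intro that[of B]) auto
qed

lemma integrable_continuous_compact_support:
  fixes f :: "'a::euclidean_space \<Rightarrow> 'b::euclidean_space"
  assumes "continuous_on UNIV f" "compact K" "\<And>x. x \<notin> K \<Longrightarrow> f x = 0"
  shows "integrable lborel f"
proof -
  have "integrable lborel (\<lambda>x. indicator K x *\<^sub>R f x)"
    using assms(2) continuous_on_subset[OF assms(1)] by (intro borel_integrable_compact) auto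
  moreover have "(\<lambda>x. indicator K x *\<^sub>R f x) = f"
    using assms(3) by (auto simp: indicator_def)
  ultimately show ?thesis by simp
qed

text \<open>The complement of the closed support is open and the function is zero on it, so the
  derivative vanishes there as well.\<close>

lemma test_functionsD:
  assumes "\<eta> \<in> test_functions \<Omega>"
  obtains K where "compact K" "K \<subseteq> \<Omega>" "\<And>x. x \<notin> K \<Longrightarrow> \<eta> x = 0"
    "\<And>x v. x \<notin> K \<Longrightarrow> frechet_derivative \<eta> (at x) v = 0"
proof -
  let ?K = "closure {x. \<eta> x \<noteq> 0}"
  have z: "\<eta> x = 0" if "x \<notin> ?K" for x
    using that closure_subset[of "{x. \<eta> x \<noteq> 0}"] by blast
  have "frechet_derivative \<eta> (at x) v = 0" if "x \<notin> ?K" for x v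
  proof -
    have "(\<eta> has_derivative (\<lambda>v. 0)) (at x)"
    proof (rule has_derivative_transform_within_open)
      show "((\<lambda>x. 0) has_derivative (\<lambda>v. 0)) (at x)" by simp
      show "open (- ?K)" by (intro open_Compl closed_closure)
      show "x \<in> - ?K" using that by blast
      show "0 = \<eta> y" if "y \<in> - ?K" for y using z[OF ComplD[OF that]] by (rule sym)
    qed
    then show ?thesis
      by (metis frechet_derivative_at)
  qed
  moreover have "compact ?K" "?K \<subseteq> \<Omega>"
    using assms unfolding test_functions_def by blast+
  ultimately show ?thesis
    using that[of ?K] z by blast
qed

lemma test_functions_Ck: "\<eta> \<in> test_functions \<Omega> \<Longrightarrow> Ck k \<eta>"
  by (simp add: test_functions_def)

lemma test_functions_continuous: "\<eta> \<in> test_functions \<Omega> \<Longrightarrow> continuous_on UNIV \<eta>"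
  using test_functions_Ck[of \<eta> \<Omega> 0] by simp

lemma test_functions_has_derivative:
  "\<eta> \<in> test_functions \<Omega> \<Longrightarrow> (\<eta> has_derivative frechet_derivative \<eta> (at x)) (at x)"
  using Ck_has_derivative[OF test_functions_Ck[of \<eta> \<Omega> 1, simplified One_nat_def]] .

lemma test_functions_continuous_derivative:
  "\<eta> \<in> test_functions \<Omega> \<Longrightarrow> continuous_on UNIV (\<lambda>x. frechet_derivative \<eta> (at x) v)"
  using test_functions_Ck[of \<eta> \<Omega> "Suc 0"] by simp

lemma frechet_derivative_classical_grad:
  assumes "\<eta> \<in> test_functions \<Omega>"
  shows "frechet_derivative \<eta> (at x) h = (\<Sum>i\<in>UNIV. complex_of_real (h $ i) * classical_grad \<eta> x $ i)"
proof -
  have lin: "linear (frechet_derivative \<eta> (at x))"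
    using test_functions_has_derivative[OF assms] has_derivative_linear by blast
  have "h = (\<Sum>i\<in>UNIV. h $ i *\<^sub>R axis i 1)"
    by (simp add: vec_eq_iff axis_def if_distrib sum.delta cong: if_cong)
  then have "frechet_derivative \<eta> (at x) h = frechet_derivative \<eta> (at x) (\<Sum>i\<in>UNIV. h $ i *\<^sub>R axis i 1)"
    by (rule arg_cong)
  also have "\<dots> = (\<Sum>i\<in>UNIV. h $ i *\<^sub>R frechet_derivative \<eta> (at x) (axis i 1))"
    by (simp only: linear_sum[OF lin] linear_scale[OF lin])
  finally show ?thesis
    by (simp add: classical_grad_def scaleR_conv_of_real)
qed

lemma test_functions_translate:
  assumes "\<eta> \<in> test_functions U" "\<And>x. x + a \<in> U \<Longrightarrow> x \<in> \<Omega>"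
  shows "(\<lambda>x. \<eta> (x + a)) \<in> test_functions \<Omega>"
proof -
  obtain K where K: "compact K" "K \<subseteq> U" "\<And>x. x \<notin> K \<Longrightarrow> \<eta> x = 0"
    using test_functionsD[OF assms(1)] by metis
  let ?K = "(\<lambda>x. x - a) ` K"
  have cK: "compact ?K"
    using K(1) by (intro compact_continuous_image continuous_intros)
  have "{x. \<eta> (x + a) \<noteq> 0} \<subseteq> ?K"
    using K(3) by (auto simp: image_iff) (metis add_diff_cancel_right')
  then have sub: "closure {x. \<eta> (x + a) \<noteq> 0} \<subseteq> ?K"
    using cK by (intro closure_minimal compact_imp_closed)
  then have "compact (closure {x. \<eta> (x + a) \<noteq> 0})"
    using cK compact_closure bounded_subset compact_imp_bounded closure_subset by meson
  moreover have "?K \<subseteq> \<Omega>"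
    using K(2) assms(2) by auto
  ultimately show ?thesis
    using assms(1) sub by (auto simp: test_functions_def intro: Ck_translate)
qed

lemma frechet_derivative_translate:
  assumes "\<eta> \<in> test_functions U"
  shows "frechet_derivative (\<lambda>x. \<eta> (x + a)) (at x) = frechet_derivative \<eta> (at (x + a))"
  using has_derivative_translate[OF test_functions_has_derivative[OF assms]]
  by (rule frechet_derivative_at[symmetric])

abbreviation int01 :: "(real \<Rightarrow> 'a::{banach,second_countable_topology}) \<Rightarrow> 'a" where
  "int01 f \<equiv> (LINT t|lborel. indicator {0..1} t *\<^sub>R f t)"

lemma ftc_segment:
  fixes f :: "'a::euclidean_space \<Rightarrow> complex"
  assumes "\<And>x. (f has_derivative f' x) (at x)" "continuous_on UNIV (\<lambda>x. f' x h)"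
  shows "(int01 (\<lambda>t. f' (x + t *\<^sub>R h) h)) = f (x + h) - f x"
proof -
  have "(int01 (\<lambda>t. f' (x + t *\<^sub>R h) h)) = f (x + 1 *\<^sub>R h) - f (x + 0 *\<^sub>R h)"
  proof (rule integral_FTC_Icc)
    fix t :: real
    have "((\<lambda>t. x + t *\<^sub>R h) has_derivative (\<lambda>s. s *\<^sub>R h)) (at t within {0..1})"
      by (auto intro!: derivative_eq_intros)
    from has_derivative_compose[OF this assms(1)]
    have "((\<lambda>t. f (x + t *\<^sub>R h)) has_derivative (\<lambda>s. f' (x + t *\<^sub>R h) (s *\<^sub>R h))) (at t within {0..1})" .
    moreover have "f' (x + t *\<^sub>R h) (s *\<^sub>R h) = s *\<^sub>R f' (x + t *\<^sub>R h) h" for s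
      using assms(1) has_derivative_linear linear_scale by blast
    ultimately show "((\<lambda>t. f (x + t *\<^sub>R h)) has_vector_derivative f' (x + t *\<^sub>R h) h) (at t within {0..1})"
      by (simp add: has_vector_derivative_def)
  next
    show "continuous_on {0..1} (\<lambda>t. f' (x + t *\<^sub>R h) h)"
      by (rule continuous_on_compose2[OF assms(2)]) (auto intro!: continuous_intros)
  qed simp
  then show ?thesis by simp
qed

text \<open>One factor is integrable and the other bounded, in either order. Both orders occur in
  \<open>weak_ftc\<close>: the integrable \<open>s\<close> against the derivative of a test
  function, then a bounded test function against the integrable directional derivative.\<close>

lemma integrable_shift_product:
  fixes a b :: "'a::euclidean_space \<Rightarrow> complex"
  assumes [measurable]: "a \<in> borel_measurable borel" "b \<in> borel_measurable borel"
    and cases: "integrable lborel a \<and> (\<forall>x. norm (b x) \<le> B) \<or> integrable lborel b \<and> (\<forall>x. norm (a x) \<le> B)"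
  shows "integrable (lborel \<Otimes>\<^sub>M lborel) (\<lambda>(t, x). indicator {0..1::real} t *\<^sub>R (a x * b (x + t *\<^sub>R h)))"
proof -
  \<comment> \<open>Each alternative bounds the inner integral by one of the two summands; the other
    one is nonnegative.\<close>
  define C where "C = B * (LINT x|lborel. norm (a x)) + B * (LINT x|lborel. norm (b x))"
  have B: "B \<ge> 0" using cases norm_ge_zero order_trans by meson
  have *: "integrable lborel (\<lambda>x. a x * b (x + t *\<^sub>R h)) \<and> (LINT x|lborel. norm (a x * b (x + t *\<^sub>R h))) \<le> C" for t
    using cases
  proof (elim disjE conjE)
    assume a: "integrable lborel a" and b: "\<forall>x. norm (b x) \<le> B"
    have le: "norm (a x * b (x + t *\<^sub>R h)) \<le> B * norm (a x)" for x
      using b mult_right_mono[of "norm (b (x + t *\<^sub>R h))" B "norm (a x)"] by (simp add: norm_mult mult.commute)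
    have int: "integrable lborel (\<lambda>x. a x * b (x + t *\<^sub>R h))"
      by (rule Bochner_Integration.integrable_bound[where f = "\<lambda>x. B * norm (a x)"])
        (use a B le in \<open>auto intro!: AE_I2\<close>)
    have "(LINT x|lborel. norm (a x * b (x + t *\<^sub>R h))) \<le> (LINT x|lborel. B * norm (a x))"
      using a int le by (intro integral_mono) auto
    also have "\<dots> \<le> C" unfolding C_def using B by simp
    finally show ?thesis using int by simp
  next
    assume b: "integrable lborel b" and a: "\<forall>x. norm (a x) \<le> B"
    have le: "norm (a x * b (x + t *\<^sub>R h)) \<le> B * norm (b (x + t *\<^sub>R h))" for x
      using a mult_right_mono[of "norm (a x)" B "norm (b (x + t *\<^sub>R h))"] by (simp add: norm_mult)
    have bs: "integrable lborel (\<lambda>x. b (x + t *\<^sub>R h))"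
      using b by (rule lborel_shift_integrable)
    have int: "integrable lborel (\<lambda>x. a x * b (x + t *\<^sub>R h))"
      by (rule Bochner_Integration.integrable_bound[where f = "\<lambda>x. B * norm (b (x + t *\<^sub>R h))"])
        (use bs B le in \<open>auto intro!: AE_I2\<close>)
    have "(LINT x|lborel. norm (a x * b (x + t *\<^sub>R h))) \<le> (LINT x|lborel. B * norm (b (x + t *\<^sub>R h)))"
      using bs int le by (intro integral_mono) auto
    also have "\<dots> = B * (LINT x|lborel. norm (b x))"
      using lborel_shift[of "\<lambda>x. norm (b x)" "t *\<^sub>R h"] by simp
    also have "\<dots> \<le> C" unfolding C_def using B by simp
    finally show ?thesis using int by simp
  qed
  show ?thesis
  proof (rule lborel_pair.Fubini_integrable)
    show "(\<lambda>(t, x). indicator {0..1::real} t *\<^sub>R (a x * b (x + t *\<^sub>R h))) \<in> borel_measurable (lborel \<Otimes>\<^sub>M lborel)"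
      by measurable
    show "AE t in lborel. integrable lborel (\<lambda>x. case (t, x) of (t, x) \<Rightarrow> indicator {0..1::real} t *\<^sub>R (a x * b (x + t *\<^sub>R h)))"
      using * by simp
    show "integrable lborel (\<lambda>t. LINT x|lborel. norm (case (t, x) of (t, x) \<Rightarrow> indicator {0..1::real} t *\<^sub>R (a x * b (x + t *\<^sub>R h))))"
    proof (rule Bochner_Integration.integrable_bound[where f = "\<lambda>t. C * indicator {0..1::real} t"])
      show "integrable lborel (\<lambda>t. C * indicator {0..1::real} t)"
        by (intro integrable_mult_right integrable_real_indicator) auto
      have "0 \<le> (LINT x|lborel. norm (a x * b (x + t *\<^sub>R h)))" for t
        by (intro integral_nonneg_AE) auto
      then show "AE t in lborel. norm (LINT x|lborel. norm (case (t, x) of (t, x) \<Rightarrow> indicator {0..1::real} t *\<^sub>R (a x * b (x + t *\<^sub>R h)))) \<le> norm (C * indicator {0..1} t)"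
        using * by (intro AE_I2) (auto simp: indicator_def intro: order_trans[OF _ abs_ge_self])
    qed measurable
  qed
qed

lemma shift_product_fubini:
  fixes a b :: "'a::euclidean_space \<Rightarrow> complex"
  assumes "a \<in> borel_measurable borel" "b \<in> borel_measurable borel"
    and "integrable lborel a \<and> (\<forall>x. norm (b x) \<le> B) \<or> integrable lborel b \<and> (\<forall>x. norm (a x) \<le> B)"
  shows "(LINT x|lborel. a x * (int01 (\<lambda>t. b (x + t *\<^sub>R h)))) =
         (int01 (\<lambda>t. (LINT x|lborel. a x * b (x + t *\<^sub>R h))))"
    and "integrable lborel (\<lambda>x. a x * (int01 (\<lambda>t. b (x + t *\<^sub>R h))))"
proof -
  note int = integrable_shift_product[OF assms, of h]
  have eq: "a x * (int01 (\<lambda>t. b (x + t *\<^sub>R h))) =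
    (int01 (\<lambda>t. (a x * b (x + t *\<^sub>R h))))" for x
    by (subst integral_mult_right_zero[symmetric]) (simp add: mult.commute)
  show "(LINT x|lborel. a x * (int01 (\<lambda>t. b (x + t *\<^sub>R h)))) =
         (int01 (\<lambda>t. (LINT x|lborel. a x * b (x + t *\<^sub>R h))))"
    unfolding eq using lborel_pair.Fubini_integral[OF int] by simp
  show "integrable lborel (\<lambda>x. a x * (int01 (\<lambda>t. b (x + t *\<^sub>R h))))"
    unfolding eq using lborel_pair.integrable_snd[OF int] .
qed

text \<open>The integral of \<open>f (x + h) - f x\<close> over all \<open>x\<close> vanishes by
  translation invariance. Written through the derivative along the segment, it is an average over
  \<open>t\<close> of integrals of translates of the derivative, none of which depends on
  \<open>t\<close>.\<close>

lemma integral_derivative_compact_support: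
  fixes f :: "'a::euclidean_space \<Rightarrow> complex"
  assumes "\<And>x. (f has_derivative f' x) (at x)" "continuous_on UNIV (\<lambda>x. f' x h)"
    and "compact K" "\<And>x. x \<notin> K \<Longrightarrow> f x = 0" "\<And>x. x \<notin> K \<Longrightarrow> f' x h = 0"
  shows "(LINT x|lborel. f' x h) = 0"
proof -
  have cf: "continuous_on UNIV f"
    using assms(1) by (meson continuous_at_imp_continuous_on has_derivative_continuous)
  have f: "integrable lborel f" and f': "integrable lborel (\<lambda>x. f' x h)"
    using assms by (auto intro: integrable_continuous_compact_support[OF cf] integrable_continuous_compact_support)
  have [measurable]: "f \<in> borel_measurable borel" "(\<lambda>x. f' x h) \<in> borel_measurable borel"
    using f f' by auto
  \<comment> \<open>The bounded factor in the exchange of integrals is the constant 1.\<close>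
  have "(LINT x|lborel. 1 * (int01 (\<lambda>t. f' (x + t *\<^sub>R h) h))) =
         (int01 (\<lambda>t. (LINT x|lborel. 1 * f' (x + t *\<^sub>R h) h)))"
    by (rule shift_product_fubini(1)[where b = "\<lambda>x. f' x h" and B = 1]) (use f' in auto)
  also have "\<dots> = (int01 (\<lambda>t. (LINT x|lborel. f' x h)))"
    using lborel_shift[of "\<lambda>x. f' x h"] by simp
  also have "\<dots> = (LINT x|lborel. f' x h)"
    by simp
  also have "(LINT x|lborel. 1 * (int01 (\<lambda>t. f' (x + t *\<^sub>R h) h))) =
    (LINT x|lborel. f (x + h) - f x)"
    using ftc_segment[OF assms(1,2)] by simp
  also have "\<dots> = 0"
    using f lborel_shift_integrable[OF f, of h] lborel_shift[of f h] by simp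
  finally show ?thesis by simp
qed

section \<open>Weak gradients and divergences\<close>

locale bounded_domain =
  fixes \<Omega> :: "(real^'d) set"
  assumes open_dom: "open \<Omega>" and bounded_dom: "bounded \<Omega>"
begin

abbreviation "wg \<equiv> has_weak_grad \<Omega>"
abbreviation "grad \<equiv> wgrad \<Omega>"
abbreviation "wd \<equiv> wdiv \<Omega>"
abbreviation "sp \<equiv> spair \<Omega>"
abbreviation "vp \<equiv> vpair \<Omega>"
abbreviation "aeq \<equiv> ae_eq \<Omega>"
abbreviation "tests \<equiv> test_functions \<Omega>"

lemma borel_dom [measurable]: "\<Omega> \<in> sets borel"
  using open_dom by simp

lemma finite_measure_dom: "finite_measure (lebesgue_on \<Omega>)"
  by (intro finite_measure_lebesgue_on lmeasurable_open bounded_dom open_dom)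

lemma L2_const: "(\<lambda>x. c) \<in> L2 \<Omega>"
  unfolding L2_def using finite_measure.integrable_const[OF finite_measure_dom] by auto

lemma L2_integrable: "f \<in> L2 \<Omega> \<Longrightarrow> integrable (lebesgue_on \<Omega>) f"
  using L2_bilinear_integrable[OF bounded_bilinear_scaleR L2_const[of 1]] by simp

lemma L2_continuous_bounded:
  fixes f :: "real^'d \<Rightarrow> 'b::euclidean_space"
  assumes "continuous_on UNIV f" "\<And>x. norm (f x) \<le> B"
  shows "f \<in> L2 \<Omega>"
  by (rule L2_bound[where c = B, OF L2_const[of "1::real"]])
    (use assms in \<open>auto intro!: borel_imp_lebesgue_on borel_measurable_continuous_onI\<close>)

lemma test_functions_L2: "\<eta> \<in> tests \<Longrightarrow> \<eta> \<in> L2 \<Omega>"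
  by (metis test_functionsD test_functions_continuous continuous_compact_support_bounded L2_continuous_bounded)

lemma classical_grad_L2:
  assumes "\<eta> \<in> tests"
  shows "classical_grad \<eta> \<in> L2 \<Omega>"
proof -
  obtain K where K: "compact K" "\<And>x v. x \<notin> K \<Longrightarrow> frechet_derivative \<eta> (at x) v = 0"
    using test_functionsD[OF assms] by metis
  have c: "continuous_on UNIV (classical_grad \<eta>)"
    unfolding classical_grad_def
    by (intro continuous_on_vec_lambda test_functions_continuous_derivative[OF assms])
  have "classical_grad \<eta> x = 0" if "x \<notin> K" for x
    using K(2)[OF that] by (simp add: classical_grad_def vec_eq_iff)
  then show ?thesis
    using continuous_compact_support_bounded[OF c K(1)] L2_continuous_bounded[OF c] by metis
qed

lemma L2_fundamental:
  assumes "d \<in> L2 \<Omega>" "\<And>\<eta>. \<eta> \<in> tests \<Longrightarrow> sp d \<eta> = 0"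
  shows "aeq d (\<lambda>x. 0)"
proof -
  obtain g where g: "g \<in> borel_measurable borel" "\<And>x. x \<notin> \<Omega> \<Longrightarrow> g x = 0" "aeq g d" "g \<in> L2 \<Omega>"
    using L2_borel_rep[OF borel_dom assms(1)] by blast
  have "AE x in lborel. x \<in> \<Omega> \<longrightarrow> g x = 0"
  proof (rule fundamental_lemma[OF _ open_dom])
    show "integrable lborel g"
      using L2_integrable[OF g(4)] integrable_lebesgue_on_iff[OF borel_dom g(1,2)] by simp
    fix \<eta> assume \<eta>: "\<eta> \<in> tests"
    have [measurable]: "\<eta> \<in> borel_measurable borel"
      by (intro borel_measurable_continuous_onI test_functions_continuous[OF \<eta>])
    have "(LINT x|lborel. g x * \<eta> x) = sp g \<eta>"
      unfolding spair_def using g(1,2)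
      by (intro integral_lebesgue_on_eq[symmetric]) auto
    also have "\<dots> = sp d \<eta>"
      using g assms(1) test_functions_L2[OF \<eta>] by (intro spair_cong_ae) (auto simp: ae_eq_def)
    finally show "(LINT x|lborel. g x * \<eta> x) = 0"
      using assms(2)[OF \<eta>] by simp
  qed
  then have "AE x in lebesgue_on \<Omega>. g x = 0"
    by (simp add: AE_lebesgue_on_iff[OF borel_dom])
  with g(3) show ?thesis
    unfolding ae_eq_def by eventually_elim simp
qed

lemma spair_diff_left:
  "f \<in> L2 \<Omega> \<Longrightarrow> g \<in> L2 \<Omega> \<Longrightarrow> h \<in> L2 \<Omega> \<Longrightarrow> sp (\<lambda>x. f x - g x) h = sp f h - sp g h"
  by (simp add: spair_def left_diff_distrib integrable_L2_mult)

text \<open>Two candidates agree when tested, coordinate by coordinate. This makes the choice inside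
  \<open>wgrad\<close> immaterial up to a null set.\<close>

lemma has_weak_grad_unique:
  assumes "wg f G" "wg f G'"
  shows "aeq G G'"
proof -
  have "aeq (\<lambda>x. G x $ i - G' x $ i) (\<lambda>x. 0)" for i
  proof (rule L2_fundamental)
    have L: "(\<lambda>x. G x $ i) \<in> L2 \<Omega>" "(\<lambda>x. G' x $ i) \<in> L2 \<Omega>"
      using assms by (auto simp: has_weak_grad_def intro: L2_nth)
    then show "(\<lambda>x. G x $ i - G' x $ i) \<in> L2 \<Omega>" by (rule L2_diff)
    fix \<eta> assume \<eta>: "\<eta> \<in> tests"
    then have "- sp (\<lambda>x. G x $ i) \<eta> = - sp (\<lambda>x. G' x $ i) \<eta>"
      using assms unfolding has_weak_grad_def by metis
    then show "sp (\<lambda>x. G x $ i - G' x $ i) \<eta> = 0"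
      using L test_functions_L2[OF \<eta>] by (simp add: spair_diff_left)
  qed
  then have "AE x in lebesgue_on \<Omega>. \<forall>i\<in>UNIV. G x $ i - G' x $ i = 0"
    by (intro AE_finite_allI) (auto simp: ae_eq_def)
  then show ?thesis
    unfolding ae_eq_def by eventually_elim (simp add: vec_eq_iff)
qed

lemma H1I: "wg f G \<Longrightarrow> f \<in> H1 \<Omega>"
  by (auto simp: H1_def has_weak_grad_def)

lemma has_weak_grad_wgrad: "f \<in> H1 \<Omega> \<Longrightarrow> wg f (grad f)"
  using someI_ex[of "wg f"] by (auto simp: wgrad_def H1_def)

lemma wgrad_ae_eq: "wg f G \<Longrightarrow> aeq (grad f) G"
  using has_weak_grad_unique has_weak_grad_wgrad H1I by blast

lemma wgrad_L2: "f \<in> H1 \<Omega> \<Longrightarrow> grad f \<in> L2 \<Omega>"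
  using has_weak_grad_wgrad by (auto simp: has_weak_grad_def)

lemma H1_L2: "f \<in> H1 \<Omega> \<Longrightarrow> f \<in> L2 \<Omega>"
  by (simp add: H1_def)

lemma ae_eq_refl: "aeq f f"
  by (simp add: ae_eq_def)

lemma ae_eq_sym: "aeq f g \<Longrightarrow> aeq g f"
  by (simp add: ae_eq_def eq_commute)

lemma ae_eq_trans: "aeq f g \<Longrightarrow> aeq g h \<Longrightarrow> aeq f h"
  unfolding ae_eq_def by (elim AE_mp) auto

lemma has_weak_grad_cong:
  assumes "wg f G" "f' \<in> L2 \<Omega>" "G' \<in> L2 \<Omega>" "aeq f' f" "aeq G' G"
  shows "wg f' G'"
  unfolding has_weak_grad_def
proof (intro conjI ballI allI assms(2,3))
  fix \<eta> i assume \<eta>: "\<eta> \<in> tests"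
  have fG: "f \<in> L2 \<Omega>" "G \<in> L2 \<Omega>"
    using assms(1) by (auto simp: has_weak_grad_def)
  have "sp f' (\<lambda>x. classical_grad \<eta> x $ i) = sp f (\<lambda>x. classical_grad \<eta> x $ i)"
    using assms fG L2_nth[OF classical_grad_L2[OF \<eta>]] by (intro spair_cong_ae ae_eq_refl)
  moreover have "aeq (\<lambda>x. G' x $ i) (\<lambda>x. G x $ i)"
    using assms(5) unfolding ae_eq_def by eventually_elim simp
  then have "sp (\<lambda>x. G' x $ i) \<eta> = sp (\<lambda>x. G x $ i) \<eta>"
    using assms fG L2_nth test_functions_L2[OF \<eta>] by (intro spair_cong_ae ae_eq_refl) auto
  ultimately show "sp f' (\<lambda>x. classical_grad \<eta> x $ i) = - sp (\<lambda>x. G' x $ i) \<eta>"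
    using assms(1) \<eta> unfolding has_weak_grad_def by metis
qed

text \<open>Integration by parts: \<open>f x * \<eta> x\<close> has compact support in the domain,
  so its derivative integrates to zero. No compact support is asked of \<open>f\<close> itself, so
  that constants are covered as well as test functions.\<close>

lemma has_weak_grad_C1:
  assumes "Ck (Suc 0) f" "f \<in> L2 \<Omega>" "classical_grad f \<in> L2 \<Omega>"
  shows "wg f (classical_grad f)"
  unfolding has_weak_grad_def
proof (intro conjI ballI allI assms(2,3))
  fix \<eta> i assume \<eta>: "\<eta> \<in> tests"
  obtain K where K: "compact K" "K \<subseteq> \<Omega>" "\<And>x. x \<notin> K \<Longrightarrow> \<eta> x = 0"
    "\<And>x v. x \<notin> K \<Longrightarrow> frechet_derivative \<eta> (at x) v = 0"
    using test_functionsD[OF \<eta>] by metis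
  let ?e = "axis i 1 :: real^'d"
  let ?f' = "\<lambda>x. frechet_derivative f (at x)" and ?\<eta>' = "\<lambda>x. frechet_derivative \<eta> (at x)"
  have c: "continuous_on UNIV (\<lambda>x. ?f' x ?e)" "continuous_on UNIV f"
    "continuous_on UNIV (\<lambda>x. ?\<eta>' x ?e)" "continuous_on UNIV \<eta>"
    using assms(1) Ck_SucD[OF assms(1)] test_functions_continuous[OF \<eta>] test_functions_continuous_derivative[OF \<eta>] by auto
  have z: "x \<notin> \<Omega> \<Longrightarrow> \<eta> x = 0" "x \<notin> \<Omega> \<Longrightarrow> ?\<eta>' x ?e = 0" for x
    using K by blast+
  have b: "(\<lambda>x. f x * ?\<eta>' x ?e) \<in> borel_measurable borel" "(\<lambda>x. ?f' x ?e * \<eta> x) \<in> borel_measurable borel"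
    by (intro borel_measurable_continuous_onI continuous_intros c)+
  have int: "integrable lborel (\<lambda>x. f x * ?\<eta>' x ?e)" "integrable lborel (\<lambda>x. ?f' x ?e * \<eta> x)"
    by (rule integrable_continuous_compact_support[OF _ K(1)]; use K c in \<open>auto intro: continuous_intros\<close>)+
  have "(LINT x|lborel. f x * ?\<eta>' x ?e + ?f' x ?e * \<eta> x) = 0"
    by (rule integral_derivative_compact_support[OF has_derivative_mult[OF Ck_has_derivative[OF assms(1)] test_functions_has_derivative[OF \<eta>]] _ K(1)])
      (use K c in \<open>auto intro: continuous_intros\<close>)
  then have "(LINT x|lborel. f x * ?\<eta>' x ?e) = - (LINT x|lborel. ?f' x ?e * \<eta> x)"
    using int by (simp add: add_eq_0_iff2)
  moreover have "(LINT x|lebesgue_on \<Omega>. f x * ?\<eta>' x ?e) = (LINT x|lborel. f x * ?\<eta>' x ?e)"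
    "(LINT x|lebesgue_on \<Omega>. ?f' x ?e * \<eta> x) = (LINT x|lborel. ?f' x ?e * \<eta> x)"
    by (intro integral_lebesgue_on_eq borel_dom b; simp add: z)+
  ultimately show "sp f (\<lambda>x. classical_grad \<eta> x $ i) = - sp (\<lambda>x. classical_grad f x $ i) \<eta>"
    by (simp add: spair_def classical_grad_def)
qed

lemma has_weak_grad_test:
  "\<eta> \<in> tests \<Longrightarrow> wg \<eta> (classical_grad \<eta>)"
  by (intro has_weak_grad_C1 test_functions_L2 classical_grad_L2 test_functions_Ck)

lemma has_weak_grad_const: "wg (\<lambda>x. c) (\<lambda>x. 0)"
proof -
  have "classical_grad (\<lambda>x. c) = (\<lambda>x. 0 :: complex^'d)"
    by (simp add: classical_grad_def vec_eq_iff fun_eq_iff)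
  then show ?thesis
    using has_weak_grad_C1[OF Ck_const[of _ c]] L2_const L2_zero by metis
qed

lemma has_weak_grad_add:
  assumes "wg f F" "wg g G"
  shows "wg (\<lambda>x. f x + g x) (\<lambda>x. F x + G x)"
  unfolding has_weak_grad_def
proof (intro conjI ballI allI)
  have L: "f \<in> L2 \<Omega>" "g \<in> L2 \<Omega>" "F \<in> L2 \<Omega>" "G \<in> L2 \<Omega>"
    using assms by (auto simp: has_weak_grad_def)
  then show "(\<lambda>x. f x + g x) \<in> L2 \<Omega>" "(\<lambda>x. F x + G x) \<in> L2 \<Omega>"
    by (auto intro: L2_add)
  fix \<eta> i assume \<eta>: "\<eta> \<in> tests"
  then have "sp f (\<lambda>x. classical_grad \<eta> x $ i) = - sp (\<lambda>x. F x $ i) \<eta>"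
    "sp g (\<lambda>x. classical_grad \<eta> x $ i) = - sp (\<lambda>x. G x $ i) \<eta>"
    using assms unfolding has_weak_grad_def by metis+
  then show "sp (\<lambda>x. f x + g x) (\<lambda>x. classical_grad \<eta> x $ i) = - sp (\<lambda>x. (F x + G x) $ i) \<eta>"
    using L L2_nth[OF classical_grad_L2[OF \<eta>]] test_functions_L2[OF \<eta>]
    by (simp add: spair_def distrib_right integrable_L2_mult L2_nth)
qed

lemma has_weak_grad_cmult:
  assumes "wg f F"
  shows "wg (\<lambda>x. c * f x) (\<lambda>x. c *s F x)"
  unfolding has_weak_grad_def
proof (intro conjI ballI allI)
  show "(\<lambda>x. c * f x) \<in> L2 \<Omega>" "(\<lambda>x. c *s F x) \<in> L2 \<Omega>"
    using assms by (auto simp: has_weak_grad_def intro: L2_cmult L2_smult)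
  fix \<eta> i assume \<eta>: "\<eta> \<in> tests"
  then have "sp f (\<lambda>x. classical_grad \<eta> x $ i) = - sp (\<lambda>x. F x $ i) \<eta>"
    using assms unfolding has_weak_grad_def by metis
  then show "sp (\<lambda>x. c * f x) (\<lambda>x. classical_grad \<eta> x $ i) = - sp (\<lambda>x. (c *s F x) $ i) \<eta>"
    by (simp add: spair_def mult.assoc)
qed

lemma has_weak_grad_diff:
  assumes "wg f F" "wg g G"
  shows "wg (\<lambda>x. f x - g x) (\<lambda>x. F x - G x)"
proof -
  have *: "(\<lambda>x. F x + (- 1) *s G x) = (\<lambda>x. F x - G x)"
    by (simp add: fun_eq_iff vec_eq_iff)
  show ?thesis
    using has_weak_grad_add[OF assms(1) has_weak_grad_cmult[OF assms(2), of "- 1"]] unfolding * by simp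
qed

lemma Ck_cnj: "Ck k f \<Longrightarrow> Ck k (\<lambda>x. cnj (f x))"
proof (induction k arbitrary: f)
  case 0
  then show ?case by (simp add: continuous_on_cnj)
next
  case (Suc k)
  show ?case
    by (rule Ck_SucI[OF bounded_linear.has_derivative[OF bounded_linear_cnj Ck_has_derivative[OF Suc.prems]]])
      (use Suc in auto)
qed

lemma test_functions_cnj: "\<eta> \<in> test_functions U \<Longrightarrow> (\<lambda>x. cnj (\<eta> x)) \<in> test_functions U"
  unfolding test_functions_def by (auto intro: Ck_cnj)

text \<open>The defining identity is tested with \<open>cnj (\<eta> x)\<close> and then conjugated;
  test functions are stable under conjugation.\<close>

lemma has_weak_grad_cnj:
  assumes "wg f F"
  shows "wg (\<lambda>x. cnj (f x)) (\<lambda>x. vcnj (F x))"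
  unfolding has_weak_grad_def
proof (intro conjI ballI allI)
  show "(\<lambda>x. cnj (f x)) \<in> L2 \<Omega>" "(\<lambda>x. vcnj (F x)) \<in> L2 \<Omega>"
    using assms by (auto simp: has_weak_grad_def intro: L2_cnj L2_vcnj)
  fix \<eta> i assume \<eta>: "\<eta> \<in> tests"
  let ?\<eta> = "\<lambda>x. cnj (\<eta> x)"
  have "sp f (\<lambda>x. classical_grad ?\<eta> x $ i) = - sp (\<lambda>x. F x $ i) ?\<eta>"
    using assms test_functions_cnj[OF \<eta>] unfolding has_weak_grad_def by metis
  moreover have "classical_grad ?\<eta> x $ i = cnj (classical_grad \<eta> x $ i)" for x
    using frechet_derivative_at[OF bounded_linear.has_derivative[OF bounded_linear_cnj test_functions_has_derivative[OF \<eta>, of x]]]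
    by (simp add: classical_grad_def) metis
  ultimately have "cnj (sp f (\<lambda>x. cnj (classical_grad \<eta> x $ i))) = cnj (- sp (\<lambda>x. F x $ i) ?\<eta>)"
    by simp
  then show "sp (\<lambda>x. cnj (f x)) (\<lambda>x. classical_grad \<eta> x $ i) = - sp (\<lambda>x. vcnj (F x) $ i) \<eta>"
    by (simp add: spair_def vcnj_def del: Bochner_Integration.integral_cnj flip: Bochner_Integration.integral_cnj)
qed

section \<open>Divergences, vanishing normal traces and the space \<open>H10\<close>\<close>

lemma has_weak_div_unique:
  assumes "has_weak_div \<Omega> \<tau> g" "has_weak_div \<Omega> \<tau> g'"
  shows "aeq g g'"
proof -
  have L: "g \<in> L2 \<Omega>" "g' \<in> L2 \<Omega>"
    using assms by (auto simp: has_weak_div_def)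
  have "aeq (\<lambda>x. g x - g' x) (\<lambda>x. 0)"
  proof (rule L2_fundamental)
    show "(\<lambda>x. g x - g' x) \<in> L2 \<Omega>" using L by (rule L2_diff)
    fix \<eta> assume \<eta>: "\<eta> \<in> tests"
    then have "- sp g \<eta> = - sp g' \<eta>"
      using assms unfolding has_weak_div_def by metis
    then show "sp (\<lambda>x. g x - g' x) \<eta> = 0"
      using L test_functions_L2[OF \<eta>] by (simp add: spair_diff_left)
  qed
  then show ?thesis
    unfolding ae_eq_def by eventually_elim simp
qed

lemma has_weak_div_wdiv: "\<tau> \<in> Hdiv \<Omega> \<Longrightarrow> has_weak_div \<Omega> \<tau> (wd \<tau>)"
  using someI_ex[of "has_weak_div \<Omega> \<tau>"] by (auto simp: wdiv_def Hdiv_def)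

lemma wdiv_L2: "\<tau> \<in> Hdiv \<Omega> \<Longrightarrow> wd \<tau> \<in> L2 \<Omega>"
  using has_weak_div_wdiv by (auto simp: has_weak_div_def)

text \<open>Any weak gradient of \<open>s\<close> is allowed, not only the representative chosen by
  \<open>wgrad\<close>.\<close>

lemma H0div_green:
  assumes "\<tau> \<in> H0div \<Omega>" "wg s G"
  shows "vp \<tau> G = - sp (wd \<tau>) s"
proof -
  have s: "s \<in> H1 \<Omega>" using assms(2) by (rule H1I)
  have \<tau>: "\<tau> \<in> L2 \<Omega>" "\<tau> \<in> Hdiv \<Omega>" using assms(1) by (auto simp: H0div_def Hdiv_def)
  have "vp \<tau> (grad s) + sp (wd \<tau>) s = 0"
    using assms(1) s by (auto simp: H0div_def normal_trace_def)
  moreover have "vp \<tau> (grad s) = vp \<tau> G"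
    using \<tau> wgrad_L2[OF s] assms(2) wgrad_ae_eq[OF assms(2)]
    by (intro vpair_cong_ae ae_eq_refl) (auto simp: has_weak_grad_def)
  ultimately show ?thesis by (simp add: add_eq_0_iff2)
qed

text \<open>Test functions are among the \<open>s\<close>, so the identity first identifies
  \<open>g\<close> as the divergence; for the remaining \<open>s\<close> it then says that the
  normal trace vanishes.\<close>

lemma H0divI:
  assumes "\<tau> \<in> L2 \<Omega>" "g \<in> L2 \<Omega>"
    and "\<And>s G. wg s G \<Longrightarrow> vp \<tau> G = - sp g s"
  shows "\<tau> \<in> H0div \<Omega>" "aeq (wd \<tau>) g"
proof -
  have d: "has_weak_div \<Omega> \<tau> g"
    using assms has_weak_grad_test by (auto simp: has_weak_div_def)
  then have \<tau>: "\<tau> \<in> Hdiv \<Omega>"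
    by (auto simp: Hdiv_def has_weak_div_def)
  from has_weak_div_unique[OF has_weak_div_wdiv[OF this] d]
  show ae: "aeq (wd \<tau>) g" .
  have "normal_trace \<Omega> \<tau> s = 0" if "s \<in> H1 \<Omega>" for s
  proof -
    have "sp (wd \<tau>) s = sp g s"
      using wdiv_L2[OF \<tau>] assms(2) H1_L2[OF that] ae by (intro spair_cong_ae ae_eq_refl)
    then show ?thesis
      using assms(3)[OF has_weak_grad_wgrad[OF that]] by (simp add: normal_trace_def)
  qed
  then show "\<tau> \<in> H0div \<Omega>"
    using \<tau> by (simp add: H0div_def)
qed

lemma H1_norm_eq:
  assumes "wg f G"
  shows "H1_norm \<Omega> f = sqrt (sqint \<Omega> f + sqint \<Omega> G)"
proof -
  have "sqint \<Omega> (grad f) = sqint \<Omega> G"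
    using assms wgrad_L2[OF H1I[OF assms]] wgrad_ae_eq[OF assms]
    by (intro sqint_cong_ae) (auto simp: has_weak_grad_def)
  then show ?thesis by (simp add: H1_norm_def)
qed

lemma H10_H1: "f \<in> H10 \<Omega> \<Longrightarrow> f \<in> H1 \<Omega>"
  by (simp add: H10_def)

text \<open>A divergence is usually known only up to a null set, while \<open>H10div\<close> asks
  for the representative chosen by \<open>wdiv\<close>; this moves membership from one to the
  other.\<close>

lemma H10_cong:
  assumes "f \<in> H10 \<Omega>" "f' \<in> L2 \<Omega>" "aeq f' f"
  shows "f' \<in> H10 \<Omega>"
  unfolding H10_def
proof (intro CollectI conjI allI impI)
  have f: "wg f (grad f)"
    using assms(1) by (auto simp: H10_def intro: has_weak_grad_wgrad)
  then have f': "wg f' (grad f)"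
    using assms by (intro has_weak_grad_cong[OF f] ae_eq_refl) (auto simp: has_weak_grad_def)
  then show "f' \<in> H1 \<Omega>" by (rule H1I)
  fix \<epsilon> :: real assume "\<epsilon> > 0"
  then obtain \<eta> where \<eta>: "\<eta> \<in> tests" "H1_norm \<Omega> (\<lambda>x. f x - \<eta> x) < \<epsilon>"
    using assms(1) by (auto simp: H10_def)
  have "aeq (\<lambda>x. f' x - \<eta> x) (\<lambda>x. f x - \<eta> x)"
    using assms(3) unfolding ae_eq_def by eventually_elim simp
  then have "sqint \<Omega> (\<lambda>x. f' x - \<eta> x) = sqint \<Omega> (\<lambda>x. f x - \<eta> x)"
    using assms(2) f test_functions_L2[OF \<eta>(1)]
    by (intro sqint_cong_ae L2_diff) (auto simp: has_weak_grad_def)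
  then have "H1_norm \<Omega> (\<lambda>x. f' x - \<eta> x) = H1_norm \<Omega> (\<lambda>x. f x - \<eta> x)"
    using H1_norm_eq[OF has_weak_grad_diff[OF f has_weak_grad_test[OF \<eta>(1)]]]
      H1_norm_eq[OF has_weak_grad_diff[OF f' has_weak_grad_test[OF \<eta>(1)]]] by simp
  then show "\<exists>\<eta>\<in>tests. H1_norm \<Omega> (\<lambda>x. f' x - \<eta> x) < \<epsilon>"
    using \<eta> by (intro bexI[of _ \<eta>]) simp_all
qed

lemma zero_in_H10: "(\<lambda>x. 0) \<in> H10 \<Omega>"
  unfolding H10_def
proof (intro CollectI conjI allI impI)
  show "(\<lambda>x. 0) \<in> H1 \<Omega>" using has_weak_grad_const by (rule H1I)
  fix \<epsilon> :: real assume "\<epsilon> > 0"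
  have "(\<lambda>x. 0) \<in> tests"
    by (simp add: test_functions_def Ck_const)
  moreover have "H1_norm \<Omega> (\<lambda>x. 0 - 0) < \<epsilon>"
    using H1_norm_eq[OF has_weak_grad_const[of 0]] \<open>\<epsilon> > 0\<close> by simp
  ultimately show "\<exists>\<eta>\<in>tests. H1_norm \<Omega> (\<lambda>x. 0 - \<eta> x) < \<epsilon>"
    by (intro bexI[of _ "\<lambda>x. 0"]) simp_all
qed

end

section \<open>Differences along segments\<close>

text \<open>Values in the extended nonnegative reals spare integrability conditions when integrals
  are exchanged.\<close>

abbreviation energy :: "('a::euclidean_space \<Rightarrow> 'b::real_normed_vector) \<Rightarrow> ennreal" where
  "energy f \<equiv> (\<integral>\<^sup>+x. ennreal ((norm (f x))\<^sup>2) \<partial>lborel)"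

abbreviation sqdist :: "'a::real_normed_vector \<Rightarrow> 'a \<Rightarrow> ennreal" where
  "sqdist a b \<equiv> ennreal ((norm (a - b))\<^sup>2)"

lemma norm_vdot_le: "norm (vdot a b) \<le> norm a * norm b"
proof -
  have "norm (vdot a b) \<le> (\<Sum>i\<in>UNIV. \<bar>norm (a $ i)\<bar> * \<bar>norm (b $ i)\<bar>)"
    unfolding vdot_def by (rule order_trans[OF norm_sum]) (simp add: norm_mult)
  also have "\<dots> \<le> norm a * norm b"
    unfolding norm_vec_def by (rule L2_set_mult_ineq)
  finally show ?thesis .
qed

definition cvec :: "real^'n \<Rightarrow> complex^'n" where
  "cvec h = (\<chi> i. complex_of_real (h $ i))"

lemma norm_cvec: "norm (cvec h) = norm h"
  by (simp add: norm_vec_def cvec_def)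

text \<open>Cauchy-Schwarz against the indicator of an interval of length one. If the integrand is
  not integrable, the left side is zero by the default value of the integral.\<close>

lemma norm_integral_unit_interval_sq:
  fixes k :: "real \<Rightarrow> complex"
  assumes [measurable]: "k \<in> borel_measurable borel"
  shows "ennreal ((norm (int01 (\<lambda>t. k t)))\<^sup>2)
    \<le> (\<integral>\<^sup>+t. indicator {0..1} t * ennreal ((norm (k t))\<^sup>2) \<partial>lborel)"
proof (cases "integrable lborel (\<lambda>t. indicator {0..1} t *\<^sub>R k t)")
  case True
  have "ennreal (norm (int01 (\<lambda>t. k t))) \<le> (\<integral>\<^sup>+t. norm (indicator {0..1} t *\<^sub>R k t) \<partial>lborel)"
    using True by (rule integral_norm_bound_ennreal)
  also have "\<dots> = (\<integral>\<^sup>+t. ennreal (norm (indicator {0..1} t *\<^sub>R k t)) * indicator {0..1} t \<partial>lborel)"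
    by (intro nn_integral_cong) (auto simp: indicator_def)
  finally have "(ennreal (norm (int01 (\<lambda>t. k t))))\<^sup>2 \<le>
    (\<integral>\<^sup>+t. ennreal (norm (indicator {0..1} t *\<^sub>R k t)) * indicator {0..1} t \<partial>lborel)\<^sup>2"
    by (rule power_mono) simp
  also have "\<dots> \<le> (\<integral>\<^sup>+t. (ennreal (norm (indicator {0..1} t *\<^sub>R k t)))\<^sup>2 \<partial>lborel) * (\<integral>\<^sup>+t. (indicator {0..1::real} t)\<^sup>2 \<partial>lborel)"
    by (rule Cauchy_Schwarz_nn_integral) measurable
  also have "(\<integral>\<^sup>+t. (indicator {0..1::real} t)\<^sup>2 \<partial>lborel) = (\<integral>\<^sup>+t. indicator {0..1::real} t \<partial>lborel)"
    by (intro nn_integral_cong) (auto simp: indicator_def)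
  also have "\<dots> = 1" by simp
  also have "(\<integral>\<^sup>+t. (ennreal (norm (indicator {0..1} t *\<^sub>R k t)))\<^sup>2 \<partial>lborel) = (\<integral>\<^sup>+t. indicator {0..1} t * ennreal ((norm (k t))\<^sup>2) \<partial>lborel)"
    by (intro nn_integral_cong) (auto simp: indicator_def ennreal_power)
  finally show ?thesis by (simp add: ennreal_power)
qed (simp add: not_integrable_integral_eq)

context bounded_domain begin

lemma has_weak_grad_directional:
  assumes "wg s G" "\<eta> \<in> tests"
  shows "sp s (\<lambda>x. frechet_derivative \<eta> (at x) h) = - sp (\<lambda>x. vdot (cvec h) (G x)) \<eta>"
proof -
  have L: "s \<in> L2 \<Omega>" "G \<in> L2 \<Omega>"
    using assms(1) by (auto simp: has_weak_grad_def)
  have "sp s (\<lambda>x. frechet_derivative \<eta> (at x) h) =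
    (LINT x|lebesgue_on \<Omega>. (\<Sum>i\<in>UNIV. complex_of_real (h $ i) * (s x * classical_grad \<eta> x $ i)))"
    by (simp add: spair_def frechet_derivative_classical_grad[OF assms(2)] sum_distrib_left mult.left_commute)
  also have "\<dots> = (\<Sum>i\<in>UNIV. complex_of_real (h $ i) * sp s (\<lambda>x. classical_grad \<eta> x $ i))"
    unfolding spair_def using integrable_L2_mult[OF L(1) L2_nth[OF classical_grad_L2[OF assms(2)]]]
    by (subst Bochner_Integration.integral_sum) auto
  also have "\<dots> = - (\<Sum>i\<in>UNIV. complex_of_real (h $ i) * sp (\<lambda>x. G x $ i) \<eta>)"
    using assms by (simp add: has_weak_grad_def sum_negf)
  also have "(\<Sum>i\<in>UNIV. complex_of_real (h $ i) * sp (\<lambda>x. G x $ i) \<eta>) =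
    (LINT x|lebesgue_on \<Omega>. (\<Sum>i\<in>UNIV. complex_of_real (h $ i) * (G x $ i * \<eta> x)))"
    unfolding spair_def using integrable_L2_mult[OF L2_nth[OF L(2)] test_functions_L2[OF assms(2)]]
    by (subst Bochner_Integration.integral_sum) auto
  also have "\<dots> = sp (\<lambda>x. vdot (cvec h) (G x)) \<eta>"
    by (simp add: spair_def vdot_def cvec_def sum_distrib_right mult.assoc)
  finally show ?thesis .
qed

text \<open>Convention under which products with translates can be integrated over the whole space;
  by \<open>borel_grad_exists\<close> every weak gradient has such a representative.\<close>

definition borel_grad :: "(real^'d \<Rightarrow> complex) \<Rightarrow> (real^'d \<Rightarrow> complex^'d) \<Rightarrow> bool" where
  "borel_grad s G \<longleftrightarrow> wg s G \<and> s \<in> borel_measurable borel \<and> G \<in> borel_measurable borel \<and>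
     (\<forall>x. x \<notin> \<Omega> \<longrightarrow> s x = 0 \<and> G x = 0)"

lemma borel_gradD:
  assumes "borel_grad s G"
  shows "wg s G" "s \<in> borel_measurable borel" "G \<in> borel_measurable borel"
    "\<And>x. x \<notin> \<Omega> \<Longrightarrow> s x = 0" "\<And>x. x \<notin> \<Omega> \<Longrightarrow> G x = 0" "integrable lborel s" "integrable lborel G"
proof -
  show *: "wg s G" "s \<in> borel_measurable borel" "G \<in> borel_measurable borel"
    "\<And>x. x \<notin> \<Omega> \<Longrightarrow> s x = 0" "\<And>x. x \<notin> \<Omega> \<Longrightarrow> G x = 0"
    using assms by (auto simp: borel_grad_def)
  then have "s \<in> L2 \<Omega>" "G \<in> L2 \<Omega>" by (auto simp: has_weak_grad_def)
  then show "integrable lborel s" "integrable lborel G"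
    using L2_integrable integrable_lebesgue_on_iff[OF borel_dom *(2,4)] integrable_lebesgue_on_iff[OF borel_dom *(3,5)]
    by blast+
qed

lemma borel_grad_exists:
  assumes "wg s G"
  obtains s' G' where "borel_grad s' G'" "aeq s' s" "aeq G' G"
proof -
  have L: "s \<in> L2 \<Omega>" "G \<in> L2 \<Omega>" using assms by (auto simp: has_weak_grad_def)
  obtain s' where s': "s' \<in> borel_measurable borel" "\<And>x. x \<notin> \<Omega> \<Longrightarrow> s' x = 0" "aeq s' s" "s' \<in> L2 \<Omega>"
    using L2_borel_rep[OF borel_dom L(1)] by blast
  obtain G' where G': "G' \<in> borel_measurable borel" "\<And>x. x \<notin> \<Omega> \<Longrightarrow> G' x = 0" "aeq G' G" "G' \<in> L2 \<Omega>"
    using L2_borel_rep[OF borel_dom L(2)] by blast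
  have "borel_grad s' G'"
    using s' G' has_weak_grad_cong[OF assms s'(4) G'(4) s'(3) G'(3)] by (auto simp: borel_grad_def)
  with that s' G' show ?thesis by blast
qed

text \<open>The defect between the two sides is tested with \<eta> supported where both
  \<open>x\<close> and \<open>x + h\<close> lie in \<open>C\<close>. Moving the translations onto
  \<eta> produces derivatives of translated test functions, to which the definition of the weak
  gradient applies.\<close>

lemma weak_ftc:
  assumes "borel_grad s G" "convex C" "open C" "C \<subseteq> \<Omega>"
  shows "AE x in lborel. x \<in> C \<and> x + h \<in> C \<longrightarrow>
    s (x + h) - s x = (int01 (\<lambda>t. vdot (cvec h) (G (x + t *\<^sub>R h))))"
proof -
  note sG = borel_gradD[OF assms(1)]
  note [measurable] = sG(2,3)
  define g where "g x = vdot (cvec h) (G x)" for x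
  have g_bl: "bounded_linear (vdot (cvec h))"
    by (rule bounded_bilinear.bounded_linear_right[OF bounded_bilinear_vdot])
  have g: "integrable lborel g" "\<And>x. x \<notin> \<Omega> \<Longrightarrow> g x = 0"
    unfolding g_def using integrable_bounded_linear[OF g_bl sG(7)] sG(5)
    by (auto simp: vdot_simps)
  then have [measurable]: "g \<in> borel_measurable borel" by auto
  define E where "E = {x. x \<in> C \<and> x + h \<in> C}"
  have "E = C \<inter> (\<lambda>x. x + h) -` C" by (auto simp: E_def)
  then have "open E"
    using assms(3) by (auto intro!: open_Int open_vimage continuous_intros)
  \<comment> \<open>Convexity enters here: a point of \<open>E\<close> moved by
    \<open>t *\<^sub>R h\<close> stays on a segment with both ends in \<open>C\<close>, so the
    translated test functions are supported in \<Omega>.\<close>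
  have seg: "x \<in> \<Omega>" if "x + t *\<^sub>R (- h) \<in> E" "t \<in> {0..1}" for x t
  proof -
    have "(1 - t) *\<^sub>R (x + t *\<^sub>R (- h)) + t *\<^sub>R (x + t *\<^sub>R (- h) + h) \<in> C"
      using that assms(2) by (intro convexD) (auto simp: E_def)
    moreover have "(1 - t) *\<^sub>R (x + t *\<^sub>R (- h)) + t *\<^sub>R (x + t *\<^sub>R (- h) + h) = x"
      by (simp add: algebra_simps)
    ultimately show ?thesis using assms(4) by auto
  qed
  define I where "I x = (int01 (\<lambda>t. g (x + t *\<^sub>R h)))" for x
  define q where "q x = s (x + h) - s x - I x" for x
  have I: "integrable lborel I"
    using shift_product_fubini(2)[of "\<lambda>x. 1" g 1 h] g(1) by (simp add: I_def[abs_def])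
  then have [measurable]: "I \<in> borel_measurable borel" by auto
  have "AE x in lborel. x \<in> E \<longrightarrow> q x = 0"
  proof (rule fundamental_lemma[OF _ \<open>open E\<close>])
    show "integrable lborel q"
      unfolding q_def using I sG(6) lborel_shift_integrable by (intro Bochner_Integration.integrable_diff)
    fix \<eta> assume \<eta>: "\<eta> \<in> test_functions E"
    let ?\<eta>' = "\<lambda>x. frechet_derivative \<eta> (at x) (- h)"
    obtain K where K: "compact K" "K \<subseteq> E" "\<And>x. x \<notin> K \<Longrightarrow> \<eta> x = 0"
      "\<And>x v. x \<notin> K \<Longrightarrow> frechet_derivative \<eta> (at x) v = 0"
      using test_functionsD[OF \<eta>] by metis
    obtain B where B: "B \<ge> 0" "\<And>x. norm (\<eta> x) \<le> B"
      using continuous_compact_support_bounded[OF test_functions_continuous[OF \<eta>] K(1,3)] by blast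
    obtain B' where B': "B' \<ge> 0" "\<And>x. norm (?\<eta>' x) \<le> B'"
      using continuous_compact_support_bounded[OF test_functions_continuous_derivative[OF \<eta>] K(1,4)] by blast
    have [measurable]: "\<eta> \<in> borel_measurable borel" "?\<eta>' \<in> borel_measurable borel"
      by (intro borel_measurable_continuous_onI test_functions_continuous[OF \<eta>] test_functions_continuous_derivative[OF \<eta>])+
    have bnd: "integrable lborel (\<lambda>x. f x * \<eta> (x + a))" if "integrable lborel f" for f a
    proof (rule Bochner_Integration.integrable_bound[where f = "\<lambda>x. B * norm (f x)"])
      show "AE x in lborel. norm (f x * \<eta> (x + a)) \<le> norm (B * norm (f x))"
      proof (rule AE_I2)
        fix x
        have "norm (f x) * norm (\<eta> (x + a)) \<le> norm (f x) * B"
          using B(2) by (rule mult_left_mono) simp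
        then show "norm (f x * \<eta> (x + a)) \<le> norm (B * norm (f x))"
          using B(1) by (simp add: norm_mult mult.commute)
      qed
    qed (use that in auto)
    \<comment> \<open>The direction is \<open>- h\<close> because \<eta> is translated backwards;
      its sign cancels the minus in the definition of the weak gradient.\<close>
    have t_term: "(LINT x|lborel. s x * ?\<eta>' (x + t *\<^sub>R (- h))) = (LINT x|lborel. \<eta> x * g (x + t *\<^sub>R h))"
      if t: "t \<in> {0..1}" for t :: real
    proof -
      let ?\<eta>t = "\<lambda>x. \<eta> (x + t *\<^sub>R (- h))"
      have \<eta>t: "?\<eta>t \<in> tests"
        using seg t by (intro test_functions_translate[OF \<eta>]) auto
      then have z: "?\<eta>t x = 0" "frechet_derivative ?\<eta>t (at x) (- h) = 0" if "x \<notin> \<Omega>" for x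
        using that by (meson test_functionsD subsetD)+
      have fd: "frechet_derivative ?\<eta>t (at x) (- h) = ?\<eta>' (x + t *\<^sub>R (- h))" for x
        using frechet_derivative_translate[OF \<eta>] by metis
      have "(LINT x|lborel. s x * ?\<eta>' (x + t *\<^sub>R (- h))) = sp s (\<lambda>x. frechet_derivative ?\<eta>t (at x) (- h))"
        unfolding spair_def fd using sG(4) by (intro integral_lebesgue_on_eq[symmetric]) auto
      also have "\<dots> = - sp (\<lambda>x. vdot (cvec (- h)) (G x)) ?\<eta>t"
        by (rule has_weak_grad_directional[OF sG(1) \<eta>t])
      also have "(\<lambda>x. vdot (cvec (- h)) (G x)) = (\<lambda>x. - g x)"
        by (simp add: fun_eq_iff g_def cvec_def vdot_def sum_negf)
      also have "- sp (\<lambda>x. - g x) ?\<eta>t = (LINT x|lebesgue_on \<Omega>. g x * ?\<eta>t x)"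
        by (simp add: spair_def)
      also have "\<dots> = (LINT x|lborel. g x * ?\<eta>t x)"
        using g(2) by (intro integral_lebesgue_on_eq) auto
      also have "\<dots> = (LINT x|lborel. g (x + t *\<^sub>R h) * \<eta> x)"
        using lborel_shift[of "\<lambda>x. g x * ?\<eta>t x" "t *\<^sub>R h"] by (simp add: algebra_simps)
      finally show ?thesis by (simp add: mult.commute)
    qed
    \<comment> \<open>The shift is moved to \<eta>, the difference of \<eta> becomes an integral
      along a segment, and after two exchanges of integrals the segment integral falls on
      \<open>g\<close>.\<close>
    have "(LINT x|lborel. s (x + h) * \<eta> x) - (LINT x|lborel. s x * \<eta> x) =
      (LINT x|lborel. s x * \<eta> (x + (- h))) - (LINT x|lborel. s x * \<eta> x)"
      using lborel_shift[of "\<lambda>x. s x * \<eta> (x + (- h))" h] by simp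
    also have "\<dots> = (LINT x|lborel. s x * (\<eta> (x + (- h)) - \<eta> x))"
      using bnd[OF sG(6), of 0] bnd[OF sG(6), of "- h"] by (simp add: right_diff_distrib)
    also have "\<dots> = (LINT x|lborel. s x * (int01 (\<lambda>t. ?\<eta>' (x + t *\<^sub>R (- h)))))"
      by (subst ftc_segment[OF test_functions_has_derivative[OF \<eta>] test_functions_continuous_derivative[OF \<eta>]]) simp
    also have "\<dots> = (int01 (\<lambda>t. (LINT x|lborel. s x * ?\<eta>' (x + t *\<^sub>R (- h)))))"
      by (rule shift_product_fubini(1)[where B = B']) (use sG(6) B' in auto)
    also have "\<dots> = (int01 (\<lambda>t. (LINT x|lborel. \<eta> x * g (x + t *\<^sub>R h))))"
      using t_term by (intro Bochner_Integration.integral_cong) (auto simp: indicator_def)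
    also have "\<dots> = (LINT x|lborel. \<eta> x * I x)"
      unfolding I_def by (rule shift_product_fubini(1)[where B = B, symmetric]) (use g(1) B in auto)
    finally have "(LINT x|lborel. s (x + h) * \<eta> x) - (LINT x|lborel. s x * \<eta> x) - (LINT x|lborel. I x * \<eta> x) = 0"
      by (simp add: mult.commute)
    moreover have "(LINT x|lborel. q x * \<eta> x) =
      (LINT x|lborel. s (x + h) * \<eta> x) - (LINT x|lborel. s x * \<eta> x) - (LINT x|lborel. I x * \<eta> x)"
      unfolding q_def using bnd[OF sG(6), of 0] bnd[OF lborel_shift_integrable[OF sG(6), of h], of 0] bnd[OF I, of 0]
      by (simp add: left_diff_distrib)
    ultimately show "(LINT x|lborel. q x * \<eta> x) = 0" by simp
  qed
  then show ?thesis
    by (rule AE_mp) (auto simp: E_def q_def I_def g_def intro!: AE_I2)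
qed

text \<open>Cauchy-Schwarz in \<open>t\<close> and an exchange of integrals. By translation
  invariance the integral over \<open>x\<close> is the same for every \<open>t\<close>, and the
  directional derivative contributes the factor \<open>(norm h)\<^sup>2\<close>.\<close>

lemma shift_estimate:
  assumes "borel_grad s G" "convex C" "open C" "C \<subseteq> \<Omega>"
  shows "(\<integral>\<^sup>+x. indicator C x * indicator C (x + h) * sqdist (s x) (s (x + h)) \<partial>lborel)
    \<le> ennreal ((norm h)\<^sup>2) * energy G"
proof -
  note sG = borel_gradD[OF assms(1)]
  note [measurable] = sG(2,3)
  define g where "g x = vdot (cvec h) (G x)" for x
  have "integrable lborel g"
    unfolding g_def
    by (rule integrable_bounded_linear[OF bounded_bilinear.bounded_linear_right[OF bounded_bilinear_vdot] sG(7)])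
  then have [measurable]: "g \<in> borel_measurable borel" by auto
  have "(\<integral>\<^sup>+x. indicator C x * indicator C (x + h) * sqdist (s x) (s (x + h)) \<partial>lborel)
    \<le> (\<integral>\<^sup>+x. (\<integral>\<^sup>+t. indicator {0..1} t * ennreal ((norm (g (x + t *\<^sub>R h)))\<^sup>2) \<partial>lborel) \<partial>lborel)"
  proof (rule nn_integral_mono_AE)
    show "AE x in lborel. indicator C x * indicator C (x + h) * sqdist (s x) (s (x + h))
      \<le> (\<integral>\<^sup>+t. indicator {0..1} t * ennreal ((norm (g (x + t *\<^sub>R h)))\<^sup>2) \<partial>lborel)"
      using weak_ftc[OF assms, of h]
    proof eventually_elim
      case (elim x)
      show ?case
      proof (cases "x \<in> C \<and> x + h \<in> C")
        case True
        then have "norm (s x - s (x + h)) = norm (int01 (\<lambda>t. g (x + t *\<^sub>R h)))"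
          using elim by (subst norm_minus_commute) (simp add: g_def)
        with True norm_integral_unit_interval_sq[of "\<lambda>t. g (x + t *\<^sub>R h)"] show ?thesis by simp
      qed (auto simp: indicator_def)
    qed
  qed
  also have "\<dots> = (\<integral>\<^sup>+t. (\<integral>\<^sup>+x. indicator {0..1} t * ennreal ((norm (g (x + t *\<^sub>R h)))\<^sup>2) \<partial>lborel) \<partial>lborel)"
    by (rule lborel_pair.Fubini') measurable
  also have "\<dots> = (\<integral>\<^sup>+t. indicator {0..1::real} t * energy g \<partial>lborel)"
    using lborel_shift_nn[of "\<lambda>x. ennreal ((norm (g x))\<^sup>2)"]
    by (simp add: nn_integral_cmult)
  also have "\<dots> = energy g"
    by (simp add: nn_integral_multc)
  also have "\<dots> \<le> (\<integral>\<^sup>+x. ennreal ((norm h)\<^sup>2) * ennreal ((norm (G x))\<^sup>2) \<partial>lborel)"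
  proof (rule nn_integral_mono)
    fix x
    have "(norm (g x))\<^sup>2 \<le> (norm h * norm (G x))\<^sup>2"
      using norm_vdot_le[of "cvec h" "G x"] by (intro power_mono) (auto simp: g_def norm_cvec)
    then show "ennreal ((norm (g x))\<^sup>2) \<le> ennreal ((norm h)\<^sup>2) * ennreal ((norm (G x))\<^sup>2)"
      by (simp add: power_mult_distrib flip: ennreal_mult)
  qed
  also have "\<dots> = ennreal ((norm h)\<^sup>2) * energy G"
    by (simp add: nn_integral_cmult)
  finally show ?thesis .
qed

end

section \<open>The Poincare inequality\<close>

context bounded_domain begin

definition pair_diff :: "(real^'d \<Rightarrow> complex) \<Rightarrow> (real^'d) set \<Rightarrow> (real^'d) set \<Rightarrow> ennreal" where
  "pair_diff s X Y = (\<integral>\<^sup>+x. \<integral>\<^sup>+y. indicator X x * indicator Y y * sqdist (s x) (s y) \<partial>lborel \<partial>lborel)"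

text \<open>The constant is chosen before \<open>s\<close>, hence depends on the two sets only.
  Finite measure is part of the relation because the measures enter the constant of
  \<open>comparable_trans\<close>.\<close>

definition comparable :: "(real^'d) set \<Rightarrow> (real^'d) set \<Rightarrow> bool" where
  "comparable X Y \<longleftrightarrow> X \<in> sets borel \<and> Y \<in> sets borel \<and> emeasure lborel X < \<infinity> \<and> emeasure lborel Y < \<infinity> \<and>
     (\<exists>K<\<infinity>. \<forall>s G. borel_grad s G \<longrightarrow> pair_diff s X Y \<le> K * energy G)"

lemma comparableE:
  assumes "comparable X Y"
  obtains K where "K < \<infinity>" "\<And>s G. borel_grad s G \<Longrightarrow> pair_diff s X Y \<le> K * energy G"
  using assms unfolding comparable_def by blast

lemma comparable_convex:
  assumes "convex C" "open C" "C \<subseteq> \<Omega>"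
  shows "comparable C C"
proof -
  have C: "bounded C" using assms(3) bounded_dom bounded_subset by blast
  then obtain D where D: "\<And>x y. x \<in> C \<Longrightarrow> y \<in> C \<Longrightarrow> dist x y \<le> D" "D \<ge> 0"
    using diameter_bounded_bound diameter_ge_0 by metis
  have [measurable]: "C \<in> sets borel" using assms(2) by simp
  have [measurable]: "cball (0 :: real^'d) D \<in> sets borel"
    by (intro borel_closed closed_cball)
  \<comment> \<open>Only shifts \<open>h\<close> in the ball of radius \<open>D\<close> connect two
    points of \<open>C\<close>, and each costs at most \<open>D\<^sup>2\<close> times the energy;
    the volume of the ball accounts for the integration over \<open>h\<close>.\<close>
  define K where "K = ennreal (D\<^sup>2) * emeasure lborel (cball 0 D :: (real^'d) set)"
  have "pair_diff s C C \<le> K * energy G" if sG: "borel_grad s G" for s G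
  proof -
    note [measurable] = borel_gradD(2,3)[OF sG]
    let ?G = "energy G"
    have "pair_diff s C C = (\<integral>\<^sup>+x. \<integral>\<^sup>+h. indicator C x * indicator C (x + h) * sqdist (s x) (s (x + h)) \<partial>lborel \<partial>lborel)"
      unfolding pair_diff_def
    proof (rule nn_integral_cong)
      fix x
      show "(\<integral>\<^sup>+y. indicator C x * indicator C y * sqdist (s x) (s y) \<partial>lborel) =
        (\<integral>\<^sup>+h. indicator C x * indicator C (x + h) * sqdist (s x) (s (x + h)) \<partial>lborel)"
        using lborel_shift_nn[of "\<lambda>y. indicator C x * indicator C y * sqdist (s x) (s y)" x]
        by (simp add: add.commute)
    qed
    also have "\<dots> = (\<integral>\<^sup>+h. \<integral>\<^sup>+x. indicator C x * indicator C (x + h) * sqdist (s x) (s (x + h)) \<partial>lborel \<partial>lborel)"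
      by (rule lborel_pair.Fubini'[symmetric]) measurable
    also have "\<dots> \<le> (\<integral>\<^sup>+h. ennreal (D\<^sup>2) * indicator (cball 0 D) (h :: real^'d) * ?G \<partial>lborel)"
    proof (rule nn_integral_mono)
      fix h :: "real^'d"
      show "(\<integral>\<^sup>+x. indicator C x * indicator C (x + h) * sqdist (s x) (s (x + h)) \<partial>lborel)
        \<le> ennreal (D\<^sup>2) * indicator (cball 0 D) h * ?G"
      proof (cases "h \<in> cball 0 D")
        case True
        have "(\<integral>\<^sup>+x. indicator C x * indicator C (x + h) * sqdist (s x) (s (x + h)) \<partial>lborel) \<le> ennreal ((norm h)\<^sup>2) * ?G"
          by (rule shift_estimate[OF sG assms])
        also have "\<dots> \<le> ennreal (D\<^sup>2) * ?G"
          using True by (intro mult_right_mono ennreal_leI power_mono) auto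
        finally show ?thesis using True by simp
      next
        case False
        have z: "indicator C x * indicator C (x + h) * sqdist (s x) (s (x + h)) = 0" for x
          using False D(1)[of x "x + h"] by (auto simp: indicator_def dist_norm)
        show ?thesis unfolding z by simp
      qed
    qed
    also have "\<dots> = (\<integral>\<^sup>+h. ennreal (D\<^sup>2) * indicator (cball 0 D) (h :: real^'d) \<partial>lborel) * ?G"
      by (rule nn_integral_multc) measurable
    also have "\<dots> = K * ?G"
      by (subst nn_integral_cmult) (auto simp: K_def)
    finally show ?thesis .
  qed
  moreover have "K < \<infinity>"
    unfolding K_def using emeasure_bounded_finite[of "cball (0::real^'d) D"]
    by (simp add: ennreal_mult_less_top)
  ultimately show ?thesis
    unfolding comparable_def using emeasure_bounded_finite[OF C] by auto
qed

lemma comparable_subset: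
  assumes "comparable X Y" "X' \<subseteq> X" "Y' \<subseteq> Y" "X' \<in> sets borel" "Y' \<in> sets borel"
  shows "comparable X' Y'"
proof -
  have "pair_diff s X' Y' \<le> pair_diff s X Y" for s
    unfolding pair_diff_def using assms(2,3)
    by (intro nn_integral_mono mult_right_mono mult_mono) (auto simp: indicator_def)
  moreover have "emeasure lborel X' \<le> emeasure lborel X" "emeasure lborel Y' \<le> emeasure lborel Y"
    using assms by (auto intro!: emeasure_mono simp: comparable_def)
  ultimately show ?thesis
    using assms unfolding comparable_def by (meson le_less_trans order_trans)
qed

lemma comparable_sym:
  assumes "comparable X Y"
  shows "comparable Y X"
proof -
  have [measurable]: "X \<in> sets borel" "Y \<in> sets borel" using assms by (auto simp: comparable_def)
  have "pair_diff s Y X = pair_diff s X Y" if "borel_grad s G" for s G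
  proof -
    note [measurable] = borel_gradD(2)[OF that]
    have "pair_diff s X Y = (\<integral>\<^sup>+y. \<integral>\<^sup>+x. indicator X x * indicator Y y * sqdist (s x) (s y) \<partial>lborel \<partial>lborel)"
      unfolding pair_diff_def by (rule lborel_pair.Fubini'[symmetric]) measurable
    then show ?thesis
      by (simp add: pair_diff_def norm_minus_commute mult.commute)
  qed
  then show ?thesis
    using assms unfolding comparable_def by metis
qed

text \<open>The triangle inequality through an intermediate point \<open>z\<close> bounds a square
  by twice the sum of two squares. Averaging over \<open>z\<close> in \<open>Z\<close> divides by
  the measure of \<open>Z\<close>, which therefore has to be positive.\<close>

lemma comparable_trans:
  assumes "comparable X Z" "comparable Y Z" "emeasure lborel Z > 0"
  shows "comparable X Y"
proof -
  have [measurable]: "X \<in> sets borel" "Y \<in> sets borel" "Z \<in> sets borel"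
    using assms by (auto simp: comparable_def)
  have fin: "emeasure lborel X < \<infinity>" "emeasure lborel Y < \<infinity>" "emeasure lborel Z < \<infinity>"
    using assms by (auto simp: comparable_def)
  obtain K1 where K1: "K1 < \<infinity>" "\<And>s G. borel_grad s G \<Longrightarrow> pair_diff s X Z \<le> K1 * energy G"
    using comparableE[OF assms(1)] by blast
  obtain K2 where K2: "K2 < \<infinity>" "\<And>s G. borel_grad s G \<Longrightarrow> pair_diff s Y Z \<le> K2 * energy G"
    using comparableE[OF assms(2)] by blast
  \<comment> \<open>The variable absent from a summand contributes the measure of its set:
    \<open>Y\<close> for differences between \<open>X\<close> and \<open>Z\<close>, and
    \<open>X\<close> for those between \<open>Y\<close> and \<open>Z\<close>.\<close>
  define K where "K = (2 * emeasure lborel Y * K1 + 2 * emeasure lborel X * K2) / emeasure lborel Z"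
  have "K < \<infinity>"
    unfolding K_def using fin K1(1) K2(1) assms(3)
    by (simp add: ennreal_divide_eq_top_iff ennreal_mult_less_top less_top[symmetric] ennreal_mult_eq_top_iff
        zero_less_iff_neq_zero)
  moreover have "pair_diff s X Y \<le> K * energy G" if sG: "borel_grad s G" for s G
  proof -
    note [measurable] = borel_gradD(2)[OF sG]
    let ?G = "energy G"
    define a where "a x = (\<integral>\<^sup>+z. indicator Z z * sqdist (s x) (s z) \<partial>lborel)" for x
    have [measurable]: "a \<in> borel_measurable borel"
      unfolding a_def by measurable
    have pd: "pair_diff s W Z = (\<integral>\<^sup>+x. indicator W x * a x \<partial>lborel)" if [measurable]: "W \<in> sets borel" for W
      unfolding pair_diff_def a_def by (simp add: mult.assoc nn_integral_cmult)
    have pt: "sqdist (s x) (s y) * emeasure lborel Z \<le> 2 * a x + 2 * a y" for x y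
    proof -
      have "sqdist (s x) (s y) * emeasure lborel Z = (\<integral>\<^sup>+z. sqdist (s x) (s y) * indicator Z z \<partial>lborel)"
        by (simp add: nn_integral_cmult)
      also have "\<dots> \<le> (\<integral>\<^sup>+z. 2 * (indicator Z z * sqdist (s x) (s z)) + 2 * (indicator Z z * sqdist (s y) (s z)) \<partial>lborel)"
      proof (rule nn_integral_mono)
        fix z
        have "(norm (s x - s y))\<^sup>2 \<le> (norm (s x - s z) + norm (s y - s z))\<^sup>2"
          using norm_triangle_ineq4[of "s x - s z" "s y - s z"] by (intro power_mono) auto
        also have "\<dots> \<le> 2 * (norm (s x - s z))\<^sup>2 + 2 * (norm (s y - s z))\<^sup>2"
          using sum_squares_bound[of "norm (s x - s z)" "norm (s y - s z)"] by (simp add: power2_sum)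
        finally have "sqdist (s x) (s y) \<le> ennreal (2 * (norm (s x - s z))\<^sup>2 + 2 * (norm (s y - s z))\<^sup>2)"
          by (rule ennreal_leI)
        also have "\<dots> = 2 * sqdist (s x) (s z) + 2 * sqdist (s y) (s z)"
          by (simp add: ennreal_plus ennreal_mult')
        finally show "sqdist (s x) (s y) * indicator Z z \<le> 2 * (indicator Z z * sqdist (s x) (s z)) + 2 * (indicator Z z * sqdist (s y) (s z))"
          by (simp add: indicator_def)
      qed
      also have "\<dots> = 2 * a x + 2 * a y"
        unfolding a_def by (simp add: nn_integral_add nn_integral_cmult)
      finally show ?thesis .
    qed
    have "pair_diff s X Y * emeasure lborel Z =
      (\<integral>\<^sup>+x. \<integral>\<^sup>+y. indicator X x * indicator Y y * (sqdist (s x) (s y) * emeasure lborel Z) \<partial>lborel \<partial>lborel)"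
      unfolding pair_diff_def by (simp add: nn_integral_multc mult.assoc flip: nn_integral_multc)
    also have "\<dots> \<le> (\<integral>\<^sup>+x. \<integral>\<^sup>+y. indicator X x * indicator Y y * (2 * a x + 2 * a y) \<partial>lborel \<partial>lborel)"
      by (intro nn_integral_mono mult_left_mono pt) auto
    also have "\<dots> = (\<integral>\<^sup>+x. 2 * emeasure lborel Y * (indicator X x * a x) + indicator X x * (2 * pair_diff s Y Z) \<partial>lborel)"
    proof (rule nn_integral_cong)
      fix x
      have "(\<integral>\<^sup>+y. indicator X x * indicator Y y * (2 * a x + 2 * a y) \<partial>lborel) =
        (\<integral>\<^sup>+y. (2 * (indicator X x * a x)) * indicator Y y + (indicator X x * 2) * (indicator Y y * a y) \<partial>lborel)"
        by (intro nn_integral_cong) (simp add: algebra_simps)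
      also have "\<dots> = 2 * emeasure lborel Y * (indicator X x * a x) + indicator X x * (2 * pair_diff s Y Z)"
        by (simp add: nn_integral_add nn_integral_cmult pd mult.assoc) (simp add: mult.left_commute mult.commute)
      finally show "(\<integral>\<^sup>+y. indicator X x * indicator Y y * (2 * a x + 2 * a y) \<partial>lborel) =
        2 * emeasure lborel Y * (indicator X x * a x) + indicator X x * (2 * pair_diff s Y Z)" .
    qed
    also have "\<dots> = 2 * emeasure lborel Y * pair_diff s X Z + emeasure lborel X * (2 * pair_diff s Y Z)"
      by (simp add: nn_integral_add nn_integral_cmult nn_integral_multc pd)
    also have "\<dots> \<le> 2 * emeasure lborel Y * (K1 * ?G) + emeasure lborel X * (2 * (K2 * ?G))"
      using K1(2)[OF sG] K2(2)[OF sG] by (intro add_mono mult_left_mono) auto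
    also have "\<dots> = (2 * emeasure lborel Y * K1 + 2 * emeasure lborel X * K2) * ?G"
      by (simp add: algebra_simps)
    finally have *: "pair_diff s X Y * emeasure lborel Z \<le> (2 * emeasure lborel Y * K1 + 2 * emeasure lborel X * K2) * ?G" .
    have "pair_diff s X Y = pair_diff s X Y * emeasure lborel Z / emeasure lborel Z"
      using fin(3) assms(3) by (simp add: ennreal_mult_divide_eq)
    also have "\<dots> \<le> ((2 * emeasure lborel Y * K1 + 2 * emeasure lborel X * K2) * ?G) / emeasure lborel Z"
      using * by (rule divide_right_mono_ennreal)
    also have "\<dots> = K * ?G"
      by (simp add: K_def divide_ennreal_def mult.commute mult.left_commute)
    finally show ?thesis .
  qed
  ultimately show ?thesis
    using assms unfolding comparable_def by blast
qed

lemma comparable_Un: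
  assumes "comparable X Y" "comparable X' Y"
  shows "comparable (X \<union> X') Y"
proof -
  have [measurable]: "X \<in> sets borel" "X' \<in> sets borel" "Y \<in> sets borel"
    using assms by (auto simp: comparable_def)
  obtain K1 where K1: "K1 < \<infinity>" "\<And>s G. borel_grad s G \<Longrightarrow> pair_diff s X Y \<le> K1 * energy G"
    using comparableE[OF assms(1)] by blast
  obtain K2 where K2: "K2 < \<infinity>" "\<And>s G. borel_grad s G \<Longrightarrow> pair_diff s X' Y \<le> K2 * energy G"
    using comparableE[OF assms(2)] by blast
  have "pair_diff s (X \<union> X') Y \<le> (K1 + K2) * energy G" if sG: "borel_grad s G" for s G
  proof -
    note [measurable] = borel_gradD(2)[OF sG]
    have "pair_diff s (X \<union> X') Y \<le> (\<integral>\<^sup>+x. \<integral>\<^sup>+y. indicator X x * indicator Y y * sqdist (s x) (s y) +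
      indicator X' x * indicator Y y * sqdist (s x) (s y) \<partial>lborel \<partial>lborel)"
      unfolding pair_diff_def by (intro nn_integral_mono) (auto simp: indicator_def)
    also have "\<dots> = pair_diff s X Y + pair_diff s X' Y"
      unfolding pair_diff_def by (simp add: nn_integral_add)
    also have "\<dots> \<le> (K1 + K2) * energy G"
      using K1(2)[OF sG] K2(2)[OF sG] by (simp add: distrib_right add_mono)
    finally show ?thesis .
  qed
  moreover have "K1 + K2 < \<infinity>" using K1(1) K2(1) by simp
  moreover have "emeasure lborel (X \<union> X') < \<infinity>"
    using assms emeasure_subadditive[of X lborel X'] by (auto simp: comparable_def intro: le_less_trans)
  ultimately show ?thesis
    using assms unfolding comparable_def by blast
qed

text \<open>Serves to add the part of the domain that lies on the frontiers of the pieces.\<close>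

lemma comparable_null:
  assumes "N \<in> null_sets lborel" "Y \<in> sets borel" "emeasure lborel Y < \<infinity>"
  shows "comparable N Y"
proof -
  have N: "emeasure lborel N = 0" "N \<in> sets borel" using assms(1) by auto
  have "pair_diff s N Y = 0" for s
  proof -
    have "pair_diff s N Y = (\<integral>\<^sup>+x. 0 \<partial>(lborel :: (real^'d) measure))"
      unfolding pair_diff_def
    proof (rule nn_integral_cong_AE)
      show "AE x in lborel. (\<integral>\<^sup>+y. indicator N x * indicator Y y * sqdist (s x) (s y) \<partial>lborel) = 0"
        using AE_not_in[OF assms(1)] by eventually_elim simp
    qed
    then show ?thesis by simp
  qed
  then show ?thesis
    unfolding comparable_def using N assms by (auto intro!: exI[of _ 0])
qed

lemma comparable_Union:
  assumes "finite F" "\<And>X. X \<in> F \<Longrightarrow> comparable X Y" "Y \<in> sets borel" "emeasure lborel Y < \<infinity>"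
  shows "comparable (\<Union>F) Y"
  using assms(1,2)
proof (induction F rule: finite_induct)
  case empty
  show ?case using comparable_null[OF _ assms(3,4), of "{}"] by simp
next
  case (insert X F)
  then show ?case using comparable_Un[of X Y "\<Union>F"] by simp
qed

end

section \<open>Chaining convex pieces across the domain\<close>

context bounded_domain begin

lemma emeasure_open_pos:
  assumes "open (U :: (real^'d) set)" "U \<noteq> {}"
  shows "emeasure lborel U > 0"
proof -
  have "U \<notin> null_sets lborel"
    using open_not_negligible[OF assms] assms(1)
    by (metis negligible_iff_null_sets null_sets_completionI)
  then show ?thesis
    using assms(1) by (simp add: null_sets_def zero_less_iff_neq_zero)
qed

text \<open>The chain runs through \<open>C\<close>, \<open>B \<inter> C\<close>,
  \<open>B \<inter> D\<close> and \<open>D\<close>. Neighbours lie in a common convex set, and the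
  two intersections are open and nonempty, hence of positive measure.\<close>

lemma comparable_overlapping_convex:
  assumes "convex C" "open C" "C \<subseteq> \<Omega>" "convex D" "open D" "D \<subseteq> \<Omega>"
    and "convex B" "open B" "B \<subseteq> \<Omega>" "B \<inter> C \<noteq> {}" "B \<inter> D \<noteq> {}"
  shows "comparable C D"
proof -
  have "comparable C (B \<inter> C)" "comparable D (B \<inter> D)" "comparable (B \<inter> D) (B \<inter> C)"
    using assms comparable_convex by (blast intro: comparable_subset borel_open open_Int)+
  moreover have "emeasure lborel (B \<inter> C) > 0" "emeasure lborel (B \<inter> D) > 0"
    using assms by (auto intro!: emeasure_open_pos open_Int)
  ultimately show ?thesis
    using comparable_trans by blast
qed

end

lemma polyhedral_domain_bounded_domain:
  assumes "polyhedral_domain \<Omega>"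
  shows "bounded_domain \<Omega>"
proof
  obtain K where K: "finite K" "\<forall>S\<in>K. polytope S" "\<Omega> = interior (\<Union>K)"
    using assms by (auto simp: polyhedral_domain_def)
  then show "open \<Omega>" by simp
  have "bounded (\<Union>K)" using K(1,2) polytope_imp_bounded by (intro bounded_Union) auto
  then show "bounded \<Omega>" using K(3) interior_subset bounded_subset by blast
qed

text \<open>The index set of the pieces cannot split into two classes not linked by a ball: the balls
  meeting one class and the balls meeting the other would disconnect the domain.\<close>

lemma polyhedral_domain_comparable:
  fixes \<Omega> :: "(real^'d) set"
  assumes "polyhedral_domain \<Omega>"
  shows "bounded_domain.comparable \<Omega> \<Omega> \<Omega>"
proof -
  interpret bounded_domain \<Omega>
    using assms by (rule polyhedral_domain_bounded_domain)
  obtain K where K: "finite K" "\<And>S. S \<in> K \<Longrightarrow> polytope S" "\<Omega> = interior (\<Union>K)"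
    using assms by (auto simp: polyhedral_domain_def)
  \<comment> \<open>Polytopes without interior are contained in their frontiers and end up in a null
    set. The remaining pieces have positive measure, as transitivity requires.\<close>
  define J where "J = {S \<in> K. interior S \<noteq> {}}"
  have piece: "convex (interior S)" "open (interior S)" "interior S \<subseteq> \<Omega>" if "S \<in> K" for S
    using K(2)[OF that] that by (auto simp: K(3) polytope_imp_convex intro: interior_mono[THEN subsetD])
  define N where "N = \<Omega> - \<Union>(interior ` J)"
  have "N \<subseteq> \<Union>(frontier ` K)"
  proof
    fix x assume x: "x \<in> N"
    then have "x \<in> \<Union>K" using interior_subset[of "\<Union>K"] unfolding N_def K(3) by blast
    then obtain S where S: "S \<in> K" "x \<in> S" by blast
    then have "x \<notin> interior S" using x by (auto simp: N_def J_def)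
    then show "x \<in> \<Union>(frontier ` K)"
      using S closure_subset by (auto simp: frontier_def)
  qed
  moreover have "negligible (\<Union>(frontier ` K))"
    using K(1,2) by (intro negligible_Union) (auto intro: negligible_convex_frontier polytope_imp_convex)
  ultimately have "negligible N" by (rule negligible_subset[rotated])
  moreover have "N \<in> sets borel" unfolding N_def using K(1) borel_dom
    by (intro sets.Diff) (auto simp: J_def)
  ultimately have N: "N \<in> null_sets lborel"
    by (simp add: negligible_iff_null_sets null_sets_completion_iff)
  \<comment> \<open>A nonempty open set is not negligible, so it cannot hide in \<open>N\<close>.
    This supplies a piece wherever two balls overlap.\<close>
  have meets: "\<exists>S\<in>J. U \<inter> interior S \<noteq> {}" if "open U" "U \<noteq> {}" "U \<subseteq> \<Omega>" for U
  proof (rule ccontr)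
    assume "\<not> ?thesis"
    then have "U \<subseteq> N" using that(3) by (auto simp: N_def)
    then have "negligible U" using \<open>negligible N\<close> negligible_subset by blast
    then show False using open_not_negligible that by blast
  qed
  have fin: "emeasure lborel \<Omega> < \<infinity>"
    using emeasure_bounded_finite[OF bounded_dom] by simp
  \<comment> \<open>The ball bridges pieces that meet only along a common face; it has to lie in
    \<Omega>, where the weak gradient is defined.\<close>
  have link: "comparable (interior S) (interior T)"
    if "S \<in> J" "T \<in> J" "ball x e \<subseteq> \<Omega>" "ball x e \<inter> interior S \<noteq> {}" "ball x e \<inter> interior T \<noteq> {}" for S T x e
    using that piece by (intro comparable_overlapping_convex[of _ _ "ball x e"]) (auto simp: J_def)
  have "\<Omega> \<noteq> {}" using assms by (simp add: polyhedral_domain_def)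
  then obtain S0 where S0: "S0 \<in> J"
    using meets[OF open_dom] by auto
  define I where "I = {S \<in> J. comparable (interior S) (interior S0)}"
  define cover where "cover F = \<Union>{ball x e |x e. ball x e \<subseteq> \<Omega> \<and> (\<exists>S\<in>F. ball x e \<inter> interior S \<noteq> {})}" for F
  have open_cover: "open (cover F)" for F
    unfolding cover_def by (rule open_Union) auto
  have coverI: "x \<in> cover F" if "x \<in> ball y e" "ball y e \<subseteq> \<Omega>" "S \<in> F" "ball y e \<inter> interior S \<noteq> {}" for x y e S F
    unfolding cover_def by (rule UnionI[OF _ that(1)]) (use that(2-4) in blast)
  have cover_interior: "interior S \<subseteq> cover F" if "S \<in> F" "S \<in> K" for F S
  proof
    fix x assume x: "x \<in> interior S"
    then obtain e where "e > 0" "ball x e \<subseteq> interior S"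
      using open_interior open_contains_ball by meson
    moreover have "x \<in> ball x e" using \<open>e > 0\<close> by simp
    ultimately show "x \<in> cover F"
      using coverI[of x x e S F] that(1) piece(3)[OF that(2)] x by blast
  qed
  have "cover I \<inter> cover (J - I) = {}"
  proof (rule ccontr)
    assume "cover I \<inter> cover (J - I) \<noteq> {}"
    then obtain x1 e1 x2 e2 S T where *: "ball x1 e1 \<subseteq> \<Omega>" "ball x2 e2 \<subseteq> \<Omega>" "ball x1 e1 \<inter> ball x2 e2 \<noteq> {}"
      "S \<in> I" "ball x1 e1 \<inter> interior S \<noteq> {}" "T \<in> J - I" "ball x2 e2 \<inter> interior T \<noteq> {}"
      unfolding cover_def by blast
    \<comment> \<open>Two overlapping balls share a nonempty open set, which meets some piece
      \<open>R\<close>; this piece is linked to both sides.\<close>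
    then obtain R where R: "R \<in> J" "(ball x1 e1 \<inter> ball x2 e2) \<inter> interior R \<noteq> {}"
      using meets[of "ball x1 e1 \<inter> ball x2 e2"] by auto
    have "comparable (interior T) (interior R)" "comparable (interior R) (interior S)"
      using link[of T R x2 e2] link[of R S x1 e1] * R by (auto simp: I_def)
    then have "comparable (interior T) (interior S)"
      using comparable_trans[of "interior T" "interior R" "interior S"] comparable_sym emeasure_open_pos[of "interior R"] R(1)
      by (auto simp: J_def)
    moreover have "comparable (interior S) (interior S0)" using *(4) by (simp add: I_def)
    ultimately have "comparable (interior T) (interior S0)"
      using comparable_trans[of "interior T" "interior S" "interior S0"] comparable_sym emeasure_open_pos[of "interior S"] *(4)
      by (auto simp: J_def I_def)
    then show False using *(6) by (auto simp: I_def)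
  qed
  moreover have "\<Omega> \<subseteq> cover I \<union> cover (J - I)"
  proof
    fix x assume "x \<in> \<Omega>"
    then obtain e where e: "e > 0" "ball x e \<subseteq> \<Omega>"
      using open_dom open_contains_ball by meson
    then obtain S where "S \<in> J" "ball x e \<inter> interior S \<noteq> {}"
      using meets[of "ball x e"] by auto
    then have "S \<in> I \<or> S \<in> J - I" by auto
    moreover have "x \<in> ball x e" using e(1) by simp
    ultimately show "x \<in> cover I \<union> cover (J - I)"
      using coverI[of x x e S] e \<open>ball x e \<inter> interior S \<noteq> {}\<close> by (metis UnI1 UnI2)
  qed
  moreover have "connected \<Omega>" using assms by (simp add: polyhedral_domain_def)
  ultimately have "cover I \<inter> \<Omega> = {} \<or> cover (J - I) \<inter> \<Omega> = {}"
    using open_cover unfolding connected_def by blast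
  moreover have "S0 \<in> I"
    using S0 piece[of S0] comparable_convex by (auto simp: I_def J_def)
  then have "interior S0 \<subseteq> cover I" using S0 cover_interior by (auto simp: J_def)
  then have "cover I \<inter> \<Omega> \<noteq> {}"
    using S0 piece(3)[of S0] by (auto simp: J_def)
  ultimately have "cover (J - I) \<inter> \<Omega> = {}" by blast
  then have "S \<in> I" if "S \<in> J" for S
    using cover_interior[of S "J - I"] piece(3)[of S] that by (auto simp: J_def)
  then have J0: "comparable (interior S) (interior S0)" if "S \<in> J" for S
    using that by (auto simp: I_def)
  have fin0: "interior S0 \<in> sets borel" "emeasure lborel (interior S0) < \<infinity>"
    using J0[OF S0] by (auto simp: comparable_def)
  have "comparable (\<Union>(interior ` J)) (interior S0)"
    using K(1) J0 fin0 by (intro comparable_Union) (auto simp: J_def)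
  then have "comparable (\<Union>(interior ` J) \<union> N) (interior S0)"
    using comparable_Un comparable_null[OF N fin0] by blast
  moreover have "\<Union>(interior ` J) \<union> N = \<Omega>"
    using piece(3) by (auto simp: N_def J_def)
  ultimately have "comparable \<Omega> (interior S0)" by simp
  moreover have "emeasure lborel (interior S0) > 0"
    using S0 by (auto simp: J_def intro: emeasure_open_pos)
  ultimately show ?thesis
    using comparable_trans by blast
qed

context bounded_domain begin

text \<open>For mean zero the cross term in the expansion of
  \<open>(norm (s x - s y))\<^sup>2\<close> integrates to zero over \<open>y\<close>, so the double
  integral dominates the measure of the domain times the squared norm of \<open>s\<close>.\<close>

lemma comparable_imp_poincare:
  assumes "comparable \<Omega> \<Omega>" "\<Omega> \<noteq> {}"
  obtains K where "K \<ge> 0" "\<And>s G. wg s G \<Longrightarrow> sp s (\<lambda>x. 1) = 0 \<Longrightarrow>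
    sqint \<Omega> s \<le> K * sqint \<Omega> G"
proof -
  obtain K where K: "K < \<infinity>" "\<And>s G. borel_grad s G \<Longrightarrow> pair_diff s \<Omega> \<Omega> \<le> K * energy G"
    using assms(1) unfolding comparable_def by blast
  have mpos: "emeasure lborel \<Omega> > 0" "emeasure lborel \<Omega> < \<infinity>"
    using emeasure_open_pos[OF open_dom assms(2)] assms(1) by (auto simp: comparable_def)
  define m where "m = measure lborel \<Omega>"
  have m1: "emeasure lborel \<Omega> = ennreal m"
    unfolding m_def using mpos(2) by (intro emeasure_eq_ennreal_measure) simp
  moreover have "m > 0" using mpos(1) unfolding m1 by simp
  ultimately have m: "emeasure lborel \<Omega> = ennreal m" "m > 0" .
  show ?thesis
  proof (rule that[of "enn2real K / m"])
    show "0 \<le> enn2real K / m" using m(2) by simp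
    fix s G assume sG: "wg s G" and mean: "sp s (\<lambda>x. 1) = 0"
    obtain s' G' where b: "borel_grad s' G'" "aeq s' s" "aeq G' G"
      using borel_grad_exists[OF sG] by blast
    note bD = borel_gradD[OF b(1)]
    note [measurable] = bD(2,3)
    have L: "s \<in> L2 \<Omega>" "G \<in> L2 \<Omega>" "s' \<in> L2 \<Omega>" "G' \<in> L2 \<Omega>"
      using sG bD(1) by (auto simp: has_weak_grad_def)
    have "integrable (lebesgue_on \<Omega>) (\<lambda>x. (norm (s' x))\<^sup>2) \<longleftrightarrow> integrable lborel (\<lambda>x. (norm (s' x))\<^sup>2)"
      using bD(4) by (intro integrable_lebesgue_on_iff borel_dom) auto
    moreover have "integrable (lebesgue_on \<Omega>) (\<lambda>x. (norm (G' x))\<^sup>2) \<longleftrightarrow> integrable lborel (\<lambda>x. (norm (G' x))\<^sup>2)"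
      using bD(5) by (intro integrable_lebesgue_on_iff borel_dom) auto
    ultimately have int: "integrable lborel (\<lambda>x. (norm (s' x))\<^sup>2)" "integrable lborel (\<lambda>x. (norm (G' x))\<^sup>2)"
      using L2_integrable_norm_sq[OF L(3)] L2_integrable_norm_sq[OF L(4)] by blast+
    define S where "S = (LINT x|lborel. (norm (s' x))\<^sup>2)"
    have S: "S = sqint \<Omega> s"
      unfolding S_def sqint_cong_ae[OF L(3,1) b(2), symmetric]
      using bD(4) by (intro integral_lebesgue_on_eq[symmetric]) auto
    have G: "(LINT x|lborel. (norm (G' x))\<^sup>2) = sqint \<Omega> G"
      unfolding sqint_cong_ae[OF L(4,2) b(3), symmetric]
      using bD(5) by (intro integral_lebesgue_on_eq[symmetric]) auto
    have mean': "(LINT x|lborel. s' x) = 0"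
    proof -
      have "(LINT x|lborel. s' x) = (LINT x|lebesgue_on \<Omega>. s' x)"
        using bD(4) by (intro integral_lebesgue_on_eq[symmetric]) auto
      also have "\<dots> = sp s' (\<lambda>x. 1)" by (simp add: spair_def)
      also have "\<dots> = sp s (\<lambda>x. 1)"
        using L L2_const b(2) by (intro spair_cong_ae ae_eq_refl)
      finally show ?thesis using mean by simp
    qed
    \<comment> \<open>The integral equals \<open>(norm (s' x))\<^sup>2 * m + S\<close>. Keeping only
      \<open>S\<close> costs a factor 2 in the final constant.\<close>
    have inner_int: "ennreal S \<le> (\<integral>\<^sup>+y. indicator \<Omega> y * sqdist (s' x) (s' y) \<partial>lborel)" for x
    proof -
      have eq: "indicator \<Omega> y * (norm (s' x - s' y))\<^sup>2 =
        (norm (s' x))\<^sup>2 * indicator \<Omega> y - 2 * inner (s' x) (s' y) + (norm (s' y))\<^sup>2" for y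
        using bD(4)[of y]
        by (auto simp: indicator_def power2_norm_eq_inner inner_diff inner_commute)
      have i0: "integrable lborel (\<lambda>y. inner (s' x) (s' y))"
        using integrable_bounded_linear[OF bounded_linear_inner_right bD(6)] .
      have i1: "integrable lborel (\<lambda>y. (norm (s' x))\<^sup>2 * indicator \<Omega> y)"
        using mpos by (intro integrable_mult_right integrable_real_indicator) auto
      have "(LINT y|lborel. indicator \<Omega> y * (norm (s' x - s' y))\<^sup>2) = (norm (s' x))\<^sup>2 * m + S"
        unfolding eq using i0 i1 int(1) integral_bounded_linear[OF bounded_linear_inner_right[of "s' x"] bD(6)]
        by (simp add: S_def mean' m_def)
      then have "S \<le> (LINT y|lborel. indicator \<Omega> y * (norm (s' x - s' y))\<^sup>2)"
        using m(2) by simp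
      then have "ennreal S \<le> ennreal (LINT y|lborel. indicator \<Omega> y * (norm (s' x - s' y))\<^sup>2)"
        by (rule ennreal_leI)
      also have "\<dots> = (\<integral>\<^sup>+y. ennreal (indicator \<Omega> y * (norm (s' x - s' y))\<^sup>2) \<partial>lborel)"
      proof (rule nn_integral_eq_integral[symmetric])
        show "integrable lborel (\<lambda>y. indicator \<Omega> y * (norm (s' x - s' y))\<^sup>2)"
          unfolding eq using i0 i1 int(1)
          by (intro Bochner_Integration.integrable_add Bochner_Integration.integrable_diff integrable_mult_right) auto
      qed simp
      also have "\<dots> = (\<integral>\<^sup>+y. indicator \<Omega> y * sqdist (s' x) (s' y) \<partial>lborel)"
        by (intro nn_integral_cong) (auto simp: indicator_def)
      finally show ?thesis .
    qed
    have "ennreal (m * S) = (\<integral>\<^sup>+x. indicator \<Omega> x * ennreal S \<partial>lborel)"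
      using m by (simp add: nn_integral_multc ennreal_mult')
    also have "\<dots> \<le> (\<integral>\<^sup>+x. indicator \<Omega> x * (\<integral>\<^sup>+y. indicator \<Omega> y * sqdist (s' x) (s' y) \<partial>lborel) \<partial>lborel)"
      by (intro nn_integral_mono mult_left_mono inner_int) auto
    also have "\<dots> = pair_diff s' \<Omega> \<Omega>"
      unfolding pair_diff_def by (simp add: mult.assoc nn_integral_cmult)
    also have "\<dots> \<le> K * energy G'"
      by (rule K(2)[OF b(1)])
    also have "\<dots> = K * ennreal (sqint \<Omega> G)"
      using int(2) by (simp add: nn_integral_eq_integral G)
    also have "\<dots> = ennreal (enn2real K * sqint \<Omega> G)"
      using K(1) by (simp add: ennreal_mult integral_nonneg_AE)
    finally have "m * S \<le> enn2real K * sqint \<Omega> G"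
      by (subst (asm) ennreal_le_iff) (auto intro!: mult_nonneg_nonneg integral_nonneg_AE)
    then show "sqint \<Omega> s \<le> enn2real K / m * sqint \<Omega> G"
      using m(2) unfolding S[symmetric] by (simp add: field_simps)
  qed
qed

end

lemma poincare_polyhedral:
  fixes \<Omega> :: "(real^'d) set"
  assumes "polyhedral_domain \<Omega>"
  obtains K where "K \<ge> 0" "\<And>s G. has_weak_grad \<Omega> s G \<Longrightarrow> spair \<Omega> s (\<lambda>x. 1) = 0 \<Longrightarrow>
    sqint \<Omega> s \<le> K * sqint \<Omega> G"
proof -
  have "\<Omega> \<noteq> {}" using assms by (simp add: polyhedral_domain_def)
  from bounded_domain.comparable_imp_poincare[OF polyhedral_domain_bounded_domain[OF assms] polyhedral_domain_comparable[OF assms] this]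
  show ?thesis using that by blast
qed

section \<open>Completeness and the Neumann problem\<close>

text \<open>Cauchy-Schwarz with the bound of \<open>B\<close>, in squared form to match
  \<open>sqint\<close>. The constant precedes \<open>f\<close> and \<open>g\<close> so that it is
  uniform along a sequence.\<close>

lemma L2_bilinear_bound:
  fixes B :: "'b::euclidean_space \<Rightarrow> 'c::euclidean_space \<Rightarrow> 'e::euclidean_space"
    and \<Omega> :: "'a::euclidean_space set"
  assumes "bounded_bilinear B"
  shows "\<exists>K. \<forall>f\<in>L2 \<Omega>. \<forall>g\<in>L2 \<Omega>. (norm (LINT x|lebesgue_on \<Omega>. B (f x) (g x)))\<^sup>2 \<le>
      K * (sqint \<Omega> f * sqint \<Omega> g)"
proof -
  interpret bounded_bilinear B by fact
  obtain K where K: "\<And>a b. norm (B a b) \<le> norm a * norm b * K" "K > 0"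
    using pos_bounded by blast
  show ?thesis
  proof (intro exI[of _ "K\<^sup>2"] ballI)
    fix f :: "'a \<Rightarrow> 'b" and g :: "'a \<Rightarrow> 'c"
    assume L: "f \<in> L2 \<Omega>" "g \<in> L2 \<Omega>"
    note [measurable] = L[THEN L2_measurable]
    let ?M = "lebesgue_on \<Omega>"
    let ?F = "LINT x|?M. (norm (f x))\<^sup>2" and ?G = "LINT x|?M. (norm (g x))\<^sup>2"
    have nn: "(\<integral>\<^sup>+x. (ennreal (norm (f x)))\<^sup>2 \<partial>?M) = ennreal ?F" "(\<integral>\<^sup>+x. (ennreal (norm (g x)))\<^sup>2 \<partial>?M) = ennreal ?G"
      using L[THEN L2_integrable_norm_sq] by (auto simp: ennreal_power nn_integral_eq_integral)
    have "ennreal (norm (LINT x|?M. B (f x) (g x))) \<le> (\<integral>\<^sup>+x. norm (B (f x) (g x)) \<partial>?M)"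
      by (rule integral_norm_bound_ennreal[OF L2_bilinear_integrable[OF assms L]])
    also have "\<dots> \<le> (\<integral>\<^sup>+x. ennreal K * (ennreal (norm (f x)) * ennreal (norm (g x))) \<partial>?M)"
      using K by (intro nn_integral_mono) (simp add: mult.commute flip: ennreal_mult)
    also have "\<dots> = ennreal K * (\<integral>\<^sup>+x. ennreal (norm (f x)) * ennreal (norm (g x)) \<partial>?M)"
      by (rule nn_integral_cmult) measurable
    finally have "(ennreal (norm (LINT x|?M. B (f x) (g x))))\<^sup>2 \<le> (ennreal K * (\<integral>\<^sup>+x. ennreal (norm (f x)) * ennreal (norm (g x)) \<partial>?M))\<^sup>2"
      by (rule power_mono) simp
    also have "\<dots> \<le> (ennreal K)\<^sup>2 * ((\<integral>\<^sup>+x. (ennreal (norm (f x)))\<^sup>2 \<partial>?M) * (\<integral>\<^sup>+x. (ennreal (norm (g x)))\<^sup>2 \<partial>?M))"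
      unfolding power_mult_distrib by (intro mult_left_mono Cauchy_Schwarz_nn_integral) auto
    also have "\<dots> = ennreal (K\<^sup>2 * (?F * ?G))"
      unfolding nn using K(2) by (simp add: ennreal_power ennreal_mult integral_nonneg_AE)
    finally show "(norm (LINT x|?M. B (f x) (g x)))\<^sup>2 \<le> K\<^sup>2 * (?F * ?G)"
      by (simp add: ennreal_power integral_nonneg_AE mult_nonneg_nonneg)
  qed
qed

definition L2_tendsto ::
  "'a::euclidean_space set \<Rightarrow> (nat \<Rightarrow> 'a \<Rightarrow> 'b::euclidean_space) \<Rightarrow> ('a \<Rightarrow> 'b) \<Rightarrow> bool" where
  "L2_tendsto \<Omega> f g \<longleftrightarrow> (\<lambda>n. LINT x|lebesgue_on \<Omega>. (norm (f n x - g x))\<^sup>2) \<longlonglongrightarrow> 0"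

text \<open>Lets weak gradients, mean values and real inner products pass to the limit along a
  minimising sequence.\<close>

lemma L2_tendsto_bilinear:
  fixes B :: "'b::euclidean_space \<Rightarrow> 'c::euclidean_space \<Rightarrow> 'e::euclidean_space"
  assumes "bounded_bilinear B" "\<And>n. f n \<in> L2 \<Omega>" "g \<in> L2 \<Omega>" "h \<in> L2 \<Omega>" "L2_tendsto \<Omega> f g"
  shows "(\<lambda>n. LINT x|lebesgue_on \<Omega>. B (f n x) (h x)) \<longlonglongrightarrow> (LINT x|lebesgue_on \<Omega>. B (g x) (h x))"
proof -
  interpret bounded_bilinear B by fact
  let ?M = "lebesgue_on \<Omega>"
  obtain K where K: "\<forall>f\<in>L2 \<Omega>. \<forall>g\<in>L2 \<Omega>. (norm (LINT x|?M. B (f x) (g x)))\<^sup>2 \<le>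
      K * (sqint \<Omega> f * sqint \<Omega> g)"
    using L2_bilinear_bound[OF assms(1), of \<Omega>] ..
  let ?e = "\<lambda>n. (LINT x|?M. B (f n x) (h x)) - (LINT x|?M. B (g x) (h x))"
  have "(\<lambda>n. K * (sqint \<Omega> (\<lambda>x. f n x - g x) * sqint \<Omega> h)) \<longlonglongrightarrow> K * (0 * sqint \<Omega> h)"
    using assms(5) unfolding L2_tendsto_def by (intro tendsto_intros)
  moreover have "(norm (?e n))\<^sup>2 \<le> K * (sqint \<Omega> (\<lambda>x. f n x - g x) * sqint \<Omega> h)" for n
    using bspec[OF bspec[OF K L2_diff[OF assms(2)[of n] assms(3)]] assms(4)]
      L2_bilinear_integrable[OF assms(1) assms(2)[of n] assms(4)] L2_bilinear_integrable[OF assms(1) assms(3,4)]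
    by (simp add: diff_left)
  ultimately have "(\<lambda>n. (norm (?e n))\<^sup>2) \<longlonglongrightarrow> 0"
    by (intro real_tendsto_sandwich[where f = "\<lambda>n. 0" and g = "\<lambda>n. (norm (?e n))\<^sup>2"]) (auto intro!: always_eventually)
  then have "(\<lambda>n. sqrt ((norm (?e n))\<^sup>2)) \<longlonglongrightarrow> sqrt 0"
    by (rule tendsto_real_sqrt)
  then show ?thesis
    by (simp add: LIM_zero_iff tendsto_norm_zero_iff)
qed

text \<open>Riesz-Fischer for functions rather than classes: a fast subsequence converges almost
  everywhere, and Fatou's lemma turns the Cauchy bounds into bounds for the distance to the
  pointwise limit.\<close>

lemma L2_complete:
  fixes f :: "nat \<Rightarrow> 'a::euclidean_space \<Rightarrow> 'b::euclidean_space"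
  assumes f: "\<And>n. f n \<in> L2 \<Omega>"
    and cauchy: "\<And>e. e > 0 \<Longrightarrow> \<exists>N. \<forall>m\<ge>N. \<forall>n\<ge>N. sqint \<Omega> (\<lambda>x. f m x - f n x) < e"
  obtains g where "g \<in> L2 \<Omega>" "L2_tendsto \<Omega> f g"
proof -
  let ?M = "lebesgue_on \<Omega>"
  note [measurable] = L2_measurable[OF f]
  have nn: "(\<integral>\<^sup>+x. ennreal ((norm (f m x - f n x))\<^sup>2) \<partial>?M) = ennreal (sqint \<Omega> (\<lambda>x. f m x - f n x))" for m n
    using L2_integrable_norm_sq[OF L2_diff[OF f[of m] f[of n]]] by (simp add: nn_integral_eq_integral)
  \<comment> \<open>The rate \<open>(1/4)^k\<close> survives multiplication by the weight
    \<open>2^k\<close> in \<open>d_int\<close> as the summable \<open>(1/2)^k\<close>.\<close>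
  define Q where "Q k N \<longleftrightarrow> (\<forall>m\<ge>N. \<forall>n\<ge>N. sqint \<Omega> (\<lambda>x. f m x - f n x) < (1/4)^k)" for k N
  have "\<exists>r. \<forall>k. Q k (r k) \<and> r k < r (Suc k)"
  proof (rule dependent_nat_choice)
    show "\<exists>N. Q 0 N" using cauchy[of 1] by (simp add: Q_def)
    fix N k
    obtain N' where "Q (Suc k) N'" using cauchy[of "(1/4)^Suc k"] unfolding Q_def by auto
    then show "\<exists>N'. Q (Suc k) N' \<and> N < N'"
      by (intro exI[of _ "max N' (Suc N)"]) (auto simp: Q_def)
  qed
  then obtain r where r: "\<And>k. Q k (r k)" "\<And>k. r k < r (Suc k)" by blast
  define d where "d k x = f (r (Suc k)) x - f (r k) x" for k x
  have d_int: "(\<integral>\<^sup>+x. ennreal (2^k * (norm (d k x))\<^sup>2) \<partial>?M) \<le> ennreal ((1/2)^k)" for k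
  proof -
    have "sqint \<Omega> (\<lambda>x. d k x) \<le> (1/4)^k"
      using r(1)[of k] r(2)[of k] unfolding Q_def d_def by (meson less_imp_le order_refl)
    then have "ennreal (2^k * sqint \<Omega> (\<lambda>x. d k x)) \<le> ennreal (2^k * (1/4)^k)"
      by (intro ennreal_leI mult_left_mono) auto
    also have "2^k * (1/4)^k = (1/2::real)^k"
      by (simp flip: power_mult_distrib)
    finally show ?thesis
      using nn[of "r (Suc k)" "r k"] by (simp add: d_def ennreal_mult' nn_integral_cmult)
  qed
  have "(\<integral>\<^sup>+x. (\<Sum>k. ennreal (2^k * (norm (d k x))\<^sup>2)) \<partial>?M) = (\<Sum>k. \<integral>\<^sup>+x. ennreal (2^k * (norm (d k x))\<^sup>2) \<partial>?M)"
    unfolding d_def by (rule nn_integral_suminf) measurable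
  also have "\<dots> \<le> (\<Sum>k. ennreal ((1/2)^k))"
    by (intro suminf_le d_int) auto
  also have "\<dots> = ennreal (\<Sum>k. (1/2)^k)"
    by (intro suminf_ennreal2) (auto intro: summable_geometric)
  finally have "(\<integral>\<^sup>+x. (\<Sum>k. ennreal (2^k * (norm (d k x))\<^sup>2)) \<partial>?M) \<noteq> \<infinity>"
    by (metis ennreal_less_top infinity_ennreal_def leD)
  then have "AE x in ?M. (\<Sum>k. ennreal (2^k * (norm (d k x))\<^sup>2)) \<noteq> \<infinity>"
    by (intro nn_integral_noteq_infinite) (auto simp: d_def)
  then have conv: "AE x in ?M. convergent (\<lambda>k. f (r k) x)"
  proof eventually_elim
    case (elim x)
    then have "summable (\<lambda>k. 2^k * (norm (d k x))\<^sup>2)"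
      by (intro summable_suminf_not_top) auto
    then have sm: "summable (\<lambda>k. (1/2)^k + 2^k * (norm (d k x))\<^sup>2)"
      by (intro summable_add summable_geometric) auto
    have "summable (\<lambda>k. d k x)"
    proof (rule summable_comparison_test'[OF sm])
      fix k
      \<comment> \<open>A norm above \<open>(1/2)^k\<close> is at most \<open>2^k\<close> times its
        square, so absolute convergence follows from convergence of the weighted squares.\<close>
      show "norm (d k x) \<le> (1/2)^k + 2^k * (norm (d k x))\<^sup>2"
      proof (cases "norm (d k x) \<le> (1/2)^k")
        case False
        then have "1 \<le> 2^k * norm (d k x)" by (simp add: power_one_over field_simps)
        then have "norm (d k x) \<le> 2^k * norm (d k x) * norm (d k x)"
          using mult_right_mono[of 1 "2^k * norm (d k x)" "norm (d k x)"] by simp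
        then show ?thesis by (simp add: power2_eq_square mult.assoc add_increasing)
      qed (simp add: add_increasing2)
    qed
    then have "convergent (\<lambda>n. \<Sum>k<n. d k x)"
      by (simp add: summable_iff_convergent)
    then have "convergent (\<lambda>n. f (r 0) x + (\<Sum>k<n. d k x))"
      by (intro convergent_add convergent_const)
    moreover have "f (r 0) x + (\<Sum>k<n. d k x) = f (r n) x" for n
      by (simp add: d_def sum_lessThan_telescope[of "\<lambda>k. f (r k) x"])
    ultimately show ?case by simp
  qed
  \<comment> \<open>Where the subsequence diverges, \<open>lim\<close> is an unspecified value;
    those points form a null set, and \<open>g\<close> is measurable regardless.\<close>
  define g where "g x = lim (\<lambda>k. f (r k) x)" for x
  have [measurable]: "g \<in> borel_measurable ?M"
    unfolding g_def by (rule borel_measurable_lim_metric) simp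
  have gbound: "(\<integral>\<^sup>+x. ennreal ((norm (f n x - g x))\<^sup>2) \<partial>?M) \<le> ennreal e"
    if N: "\<forall>m\<ge>N. \<forall>n\<ge>N. sqint \<Omega> (\<lambda>x. f m x - f n x) < e" and n: "n \<ge> N" for n N e
  proof -
    have rk: "r k \<ge> k" for k
      by (induction k) (use r(2) in \<open>auto intro: le_less_trans Suc_leI\<close>)
    have "(\<integral>\<^sup>+x. ennreal ((norm (f n x - g x))\<^sup>2) \<partial>?M) = (\<integral>\<^sup>+x. liminf (\<lambda>k. ennreal ((norm (f n x - f (r k) x))\<^sup>2)) \<partial>?M)"
    proof (rule nn_integral_cong_AE)
      show "AE x in ?M. ennreal ((norm (f n x - g x))\<^sup>2) = liminf (\<lambda>k. ennreal ((norm (f n x - f (r k) x))\<^sup>2))"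
        using conv
      proof eventually_elim
        case (elim x)
        then have "(\<lambda>k. f (r k) x) \<longlonglongrightarrow> g x"
          by (simp add: g_def convergent_LIMSEQ_iff)
        then have "(\<lambda>k. ennreal ((norm (f n x - f (r k) x))\<^sup>2)) \<longlonglongrightarrow> ennreal ((norm (f n x - g x))\<^sup>2)"
          by (intro tendsto_ennrealI tendsto_intros)
        then show ?case by (intro lim_imp_Liminf[symmetric]) auto
      qed
    qed
    also have "\<dots> \<le> liminf (\<lambda>k. \<integral>\<^sup>+x. ennreal ((norm (f n x - f (r k) x))\<^sup>2) \<partial>?M)"
      by (rule nn_integral_liminf) measurable
    also have "\<dots> \<le> liminf (\<lambda>k. ennreal e)"
    proof (rule Liminf_mono)
      show "\<forall>\<^sub>F k in sequentially. (\<integral>\<^sup>+x. ennreal ((norm (f n x - f (r k) x))\<^sup>2) \<partial>?M) \<le> ennreal e"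
        unfolding nn using eventually_ge_at_top[of N]
      proof eventually_elim
        case (elim k)
        then have "r k \<ge> N" using rk[of k] by simp
        then show ?case using N n by (intro ennreal_leI less_imp_le) blast
      qed
    qed
    also have "\<dots> = ennreal e" by (simp add: Liminf_const)
    finally show ?thesis .
  qed
  have gL: "(\<lambda>x. f n x - g x) \<in> L2 \<Omega>" if "(\<integral>\<^sup>+x. ennreal ((norm (f n x - g x))\<^sup>2) \<partial>?M) \<le> ennreal e" for n e
    unfolding L2_def using that by (auto simp: integrable_iff_bounded intro: le_less_trans)
  obtain N1 where N1: "\<forall>m\<ge>N1. \<forall>n\<ge>N1. sqint \<Omega> (\<lambda>x. f m x - f n x) < 1"
    using cauchy[of 1] by auto
  have "(\<lambda>x. f N1 x - (f N1 x - g x)) \<in> L2 \<Omega>"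
    by (rule L2_diff[OF f gL[OF gbound[OF N1 order_refl]]])
  then have g: "g \<in> L2 \<Omega>" by simp
  have "L2_tendsto \<Omega> f g"
    unfolding L2_tendsto_def
  proof (rule LIMSEQ_I)
    fix e :: real assume "e > 0"
    then obtain N where N: "\<forall>m\<ge>N. \<forall>n\<ge>N. sqint \<Omega> (\<lambda>x. f m x - f n x) < e/2"
      using cauchy[of "e/2"] by auto
    have "norm (sqint \<Omega> (\<lambda>x. f n x - g x) - 0) < e" if "n \<ge> N" for n
    proof -
      have "ennreal (sqint \<Omega> (\<lambda>x. f n x - g x)) \<le> ennreal (e/2)"
        using gbound[OF N that] L2_integrable_norm_sq[OF L2_diff[OF f[of n] g]]
        by (simp add: nn_integral_eq_integral)
      then have "sqint \<Omega> (\<lambda>x. f n x - g x) \<le> e/2"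
        using \<open>e > 0\<close> by (simp add: ennreal_le_iff)
      moreover have "sqint \<Omega> (\<lambda>x. f n x - g x) \<ge> 0"
        by (intro integral_nonneg_AE) auto
      ultimately show ?thesis using \<open>e > 0\<close> by simp
    qed
    then show "\<exists>N. \<forall>n\<ge>N. norm (sqint \<Omega> (\<lambda>x. f n x - g x) - 0) < e" by blast
  qed
  with g show ?thesis using that by blast
qed

text \<open>Isolates what the Neumann problem takes from the geometry of the domain, namely the
  Poincare inequality with a fixed constant.\<close>

locale poincare_domain = bounded_domain \<Omega> for \<Omega> :: "(real^'d) set" +
  fixes K :: real
  assumes nonempty_dom: "\<Omega> \<noteq> {}" and K_nonneg: "K \<ge> 0"
    and poincare: "\<And>s G. has_weak_grad \<Omega> s G \<Longrightarrow> spair \<Omega> s (\<lambda>x. 1) = 0 \<Longrightarrow>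
      sqint \<Omega> s \<le> K * sqint \<Omega> G"
begin

text \<open>A real inner product also for complex-valued functions, where it is the real part of the
  Hermitian one. Minimisation is carried out for a real quadratic functional.\<close>

definition ip :: "(real^'d \<Rightarrow> 'b::euclidean_space) \<Rightarrow> (real^'d \<Rightarrow> 'b) \<Rightarrow> real" where
  "ip f g = (LINT x|lebesgue_on \<Omega>. inner (f x) (g x))"

lemma ip_self: "ip f f = sqint \<Omega> f"
  by (simp add: ip_def power2_norm_eq_inner)

lemma ip_self_nonneg: "ip f f \<ge> 0"
  unfolding ip_self by (intro integral_nonneg_AE) auto

lemma ip_commute: "ip f g = ip g f"
  by (simp add: ip_def inner_commute)

lemma ip_add_left: "f \<in> L2 \<Omega> \<Longrightarrow> g \<in> L2 \<Omega> \<Longrightarrow> h \<in> L2 \<Omega> \<Longrightarrow> ip (\<lambda>x. f x + g x) h = ip f h + ip g h"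
  by (simp add: ip_def inner_add_left integrable_L2_inner)

lemma ip_scaleR_left: "ip (\<lambda>x. c *\<^sub>R f x) h = c * ip f h"
  by (simp add: ip_def)

lemma ip_add_right: "f \<in> L2 \<Omega> \<Longrightarrow> g \<in> L2 \<Omega> \<Longrightarrow> h \<in> L2 \<Omega> \<Longrightarrow> ip h (\<lambda>x. f x + g x) = ip h f + ip h g"
  by (simp add: ip_def inner_add_right integrable_L2_inner)

lemma ip_scaleR_right: "ip h (\<lambda>x. c *\<^sub>R f x) = c * ip h f"
  by (simp add: ip_def)

lemmas ip_simps = ip_add_left ip_add_right ip_scaleR_left ip_scaleR_right L2_add L2_scaleR

lemma ip_young:
  assumes "f \<in> L2 \<Omega>" "h \<in> L2 \<Omega>" "c > 0"
  shows "2 * ip f h \<le> c * ip f f + ip h h / c"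
proof -
  have "0 \<le> ip (\<lambda>x. c *\<^sub>R f x + (- 1) *\<^sub>R h x) (\<lambda>x. c *\<^sub>R f x + (- 1) *\<^sub>R h x)"
    by (rule ip_self_nonneg)
  also have "\<dots> = c * c * ip f f - 2 * c * ip f h + ip h h"
    using assms(1,2) by (simp only: ip_simps ip_commute[of h f]) (simp add: algebra_simps)
  finally have "2 * c * ip f h \<le> c * c * ip f f + ip h h" by simp
  then have "(2 * c * ip f h) / c \<le> (c * c * ip f f + ip h h) / c"
    using assms(3) by (intro divide_right_mono) auto
  then show ?thesis using assms(3) by (simp add: add_divide_distrib)
qed

text \<open>Mean zero removes the nonzero constants, which have no energy. Function and gradient are
  carried as a pair so that sums and limits do not involve the representative chosen by
  \<open>wgrad\<close>.\<close>

definition mean0_grad :: "(real^'d \<Rightarrow> complex) \<Rightarrow> (real^'d \<Rightarrow> complex^'d) \<Rightarrow> bool" where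
  "mean0_grad s G \<longleftrightarrow> wg s G \<and> sp s (\<lambda>x. 1) = 0"

lemma mean0_grad_L2: "mean0_grad s G \<Longrightarrow> s \<in> L2 \<Omega>" "mean0_grad s G \<Longrightarrow> G \<in> L2 \<Omega>"
  by (auto simp: mean0_grad_def has_weak_grad_def)

lemma mean0_grad_add:
  assumes "mean0_grad s S" "mean0_grad r R"
  shows "mean0_grad (\<lambda>x. s x + r x) (\<lambda>x. S x + R x)"
proof -
  have "sp (\<lambda>x. s x + r x) (\<lambda>x. 1) = sp s (\<lambda>x. 1) + sp r (\<lambda>x. 1)"
    using mean0_grad_L2(1)[OF assms(1)] mean0_grad_L2(1)[OF assms(2)] by (simp add: spair_def L2_integrable)
  then show ?thesis
    using assms by (simp add: mean0_grad_def has_weak_grad_add)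
qed

lemma mean0_grad_scaleR:
  assumes "mean0_grad s S"
  shows "mean0_grad (\<lambda>x. c *\<^sub>R s x) (\<lambda>x. c *\<^sub>R S x)"
proof -
  have "wg (\<lambda>x. complex_of_real c * s x) (\<lambda>x. complex_of_real c *s S x)"
    using assms by (intro has_weak_grad_cmult) (simp add: mean0_grad_def)
  moreover have "(\<lambda>x. complex_of_real c * s x) = (\<lambda>x. c *\<^sub>R s x)"
    by (simp add: scaleR_conv_of_real)
  moreover have "complex_of_real c *s v = c *\<^sub>R v" for v :: "complex^'d"
    by (simp add: vec_eq_iff) (simp add: scaleR_conv_of_real)
  ultimately have "wg (\<lambda>x. c *\<^sub>R s x) (\<lambda>x. c *\<^sub>R S x)" by simp
  then show ?thesis
    using assms by (simp add: mean0_grad_def spair_def)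
qed

text \<open>For a fixed test function both sides of the defining identity are continuous in the
  mean-square sense.\<close>

lemma has_weak_grad_limit:
  assumes "\<And>n. wg (s n) (S n)" "p \<in> L2 \<Omega>" "P \<in> L2 \<Omega>" "L2_tendsto \<Omega> s p" "L2_tendsto \<Omega> S P"
  shows "wg p P"
  unfolding has_weak_grad_def
proof (intro conjI ballI allI assms(2,3))
  fix \<eta> i assume \<eta>: "\<eta> \<in> tests"
  have L: "s n \<in> L2 \<Omega>" "S n \<in> L2 \<Omega>" for n
    using assms(1)[of n] by (auto simp: has_weak_grad_def)
  have "(\<lambda>n. sp (s n) (\<lambda>x. classical_grad \<eta> x $ i)) \<longlonglongrightarrow> sp p (\<lambda>x. classical_grad \<eta> x $ i)"
    unfolding spair_def
    by (rule L2_tendsto_bilinear[OF bounded_bilinear_mult L(1) assms(2) L2_nth[OF classical_grad_L2[OF \<eta>]] assms(4)])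
  moreover have "(\<lambda>n. - sp (\<lambda>x. S n x $ i) \<eta>) \<longlonglongrightarrow> - sp (\<lambda>x. P x $ i) \<eta>"
    unfolding spair_def
    by (intro tendsto_minus L2_tendsto_bilinear[OF bounded_bilinear.comp1[OF bounded_bilinear_mult bounded_linear_vec_nth]
          L(2) assms(3) test_functions_L2[OF \<eta>] assms(5)])
  moreover have "sp (s n) (\<lambda>x. classical_grad \<eta> x $ i) = - sp (\<lambda>x. S n x $ i) \<eta>" for n
    using assms(1) \<eta> by (simp add: has_weak_grad_def)
  ultimately show "sp p (\<lambda>x. classical_grad \<eta> x $ i) = - sp (\<lambda>x. P x $ i) \<eta>"
    using LIMSEQ_unique by force
qed

text \<open>The direct method for \<open>J\<close>: a lower bound from the Poincare inequality, a
  minimising sequence that is Cauchy by the parallelogram identity, and the Euler equation of its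
  limit. The identity controls the gradients only; the Poincare inequality carries the functions
  along.\<close>

lemma dirichlet_minimiser:
  assumes F: "F \<in> L2 \<Omega>" and g: "g \<in> L2 \<Omega>"
  obtains p P where "mean0_grad p P" "\<And>s S. mean0_grad s S \<Longrightarrow> ip P S = ip F S + ip g s"
proof -
  define J where "J s S = ip S S - 2 * (ip F S + ip g s)" for s S
  \<comment> \<open>Chosen so that \<open>K / c\<close> is at most 1/4: the two linear terms then
    absorb at most half of \<open>ip S S\<close>. The summand 1 keeps \<open>c\<close> positive when
    \<open>K = 0\<close>.\<close>
  define c where "c = 4 * K + 1"
  have c: "c > 0" using K_nonneg by (simp add: c_def)
  have J_lower: "- (4 * ip F F + c * ip g g) \<le> J s S" if "mean0_grad s S" for s S
  proof -
    have "2 * ip F S \<le> 4 * ip F F + ip S S / 4"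
      using ip_young[OF F mean0_grad_L2(2)[OF that], of 4] by simp
    moreover have "2 * ip g s \<le> c * ip g g + ip s s / c"
      by (rule ip_young[OF g mean0_grad_L2(1)[OF that] c])
    moreover have "ip s s \<le> K * ip S S"
      using that poincare unfolding ip_self mean0_grad_def by blast
    then have "ip s s / c \<le> K * ip S S / c"
      using c by (intro divide_right_mono) auto
    moreover have "K * ip S S / c \<le> ip S S / 4"
      using c K_nonneg ip_self_nonneg[of S] by (simp add: field_simps c_def)
    moreover have "0 \<le> ip S S" by (rule ip_self_nonneg)
    ultimately have "2 * ip F S + 2 * ip g s \<le> 4 * ip F F + c * ip g g + ip S S" by linarith
    then show ?thesis unfolding J_def by (simp add: distrib_left)
  qed
  define V where "V = {J s S |s S. mean0_grad s S}"
  have "mean0_grad (\<lambda>x. 0) (\<lambda>x. 0)"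
    using has_weak_grad_const[of 0] by (simp add: mean0_grad_def spair_def)
  then have V: "V \<noteq> {}" "bdd_below V"
    using J_lower by (auto simp: V_def intro!: bdd_belowI)
  define m where "m = Inf V"
  have m_le: "m \<le> J s S" if "mean0_grad s S" for s S
    unfolding m_def using V(2) that by (intro cInf_lower) (auto simp: V_def)
  have "\<exists>sS. mean0_grad (fst sS) (snd sS) \<and> J (fst sS) (snd sS) < m + 1 / real (Suc n)" for n
  proof -
    have "Inf V < m + 1 / real (Suc n)" by (simp add: m_def)
    then obtain v where "v \<in> V" "v < m + 1 / real (Suc n)"
      using cInf_lessD[OF V(1)] by blast
    then show ?thesis unfolding V_def by auto
  qed
  then obtain sS where sS: "\<And>n. mean0_grad (fst (sS n)) (snd (sS n))"
    "\<And>n. J (fst (sS n)) (snd (sS n)) < m + 1 / real (Suc n)"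
    by metis
  define s where "s n = fst (sS n)" for n
  define S where "S n = snd (sS n)" for n
  have sS: "mean0_grad (s n) (S n)" "J (s n) (S n) < m + 1 / real (Suc n)" for n
    using sS by (auto simp: s_def S_def)
  note L = mean0_grad_L2[OF sS(1)]
  have lim0: "(\<lambda>n. 1 / real (Suc n)) \<longlonglongrightarrow> 0"
    using LIMSEQ_Suc[OF lim_1_over_n] by simp
  have dist_S: "sqint \<Omega> (\<lambda>x. S k x - S n x) \<le> 2 * (1 / real (Suc k) + 1 / real (Suc n))" for k n
  proof -
    \<comment> \<open>The midpoint of two members of the sequence competes with the infimum; the
      parallelogram identity turns this into a bound on the distance of their gradients.\<close>
    have "m \<le> J (\<lambda>x. (1/2) *\<^sub>R (s k x + s n x)) (\<lambda>x. (1/2) *\<^sub>R (S k x + S n x))"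
      by (intro m_le mean0_grad_scaleR mean0_grad_add sS(1))
    also have "\<dots> = (ip (S k) (S k) + 2 * ip (S k) (S n) + ip (S n) (S n)) / 4 - (ip F (S k) + ip g (s k) + ip F (S n) + ip g (s n))"
      unfolding J_def using L F g by (simp add: ip_simps ip_commute[of "S n" "S k"] field_simps)
    finally have "2 * m \<le> J (s k) (S k) + J (s n) (S n) - (ip (S k) (S k) - 2 * ip (S k) (S n) + ip (S n) (S n)) / 2"
      unfolding J_def by (simp add: field_simps)
    moreover have "ip (\<lambda>x. S k x - S n x) (\<lambda>x. S k x - S n x) = ip (S k) (S k) - 2 * ip (S k) (S n) + ip (S n) (S n)"
    proof -
      have "ip (\<lambda>x. S k x + (- 1) *\<^sub>R S n x) (\<lambda>x. S k x + (- 1) *\<^sub>R S n x) = ip (S k) (S k) - 2 * ip (S k) (S n) + ip (S n) (S n)"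
        using L by (simp only: ip_simps ip_commute[of "S n" "S k"]) simp
      then show ?thesis by simp
    qed
    ultimately have "2 * m \<le> J (s k) (S k) + J (s n) (S n) - sqint \<Omega> (\<lambda>x. S k x - S n x) / 2"
      unfolding ip_self by simp
    moreover have "d \<le> 2 * (x + y)" if "2 * m \<le> a + b - d / 2" "a < m + x" "b < m + y" for a b d x y
      using that by argo
    ultimately show ?thesis using sS(2) by blast
  qed
  have dist_s: "sqint \<Omega> (\<lambda>x. s k x - s n x) \<le> K * sqint \<Omega> (\<lambda>x. S k x - S n x)" for k n
  proof (rule poincare)
    have "mean0_grad (\<lambda>x. s k x + (- 1) *\<^sub>R s n x) (\<lambda>x. S k x + (- 1) *\<^sub>R S n x)"
      by (intro mean0_grad_add mean0_grad_scaleR sS(1))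
    then show "wg (\<lambda>x. s k x - s n x) (\<lambda>x. S k x - S n x)" "sp (\<lambda>x. s k x - s n x) (\<lambda>x. 1) = 0"
      by (auto simp: mean0_grad_def)
  qed
  have small: "\<exists>N. \<forall>k\<ge>N. \<forall>n\<ge>N. C * (2 * (1 / real (Suc k) + 1 / real (Suc n))) < e" if "e > 0" "C \<ge> 0" for e C :: real
  proof -
    obtain N where N: "real N > 4 * C / e" using reals_Archimedean2 by blast
    have le: "1 / real (Suc k) \<le> 1 / real (Suc N)" if "k \<ge> N" for k
      using that by (intro divide_left_mono) auto
    have "C * (2 * (1 / real (Suc k) + 1 / real (Suc n))) < e" if "k \<ge> N" "n \<ge> N" for k n
    proof -
      have "C * (2 * (1 / real (Suc k) + 1 / real (Suc n))) \<le> C * (2 * (1 / real (Suc N) + 1 / real (Suc N)))"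
        using le[OF that(1)] le[OF that(2)] \<open>C \<ge> 0\<close> by (intro mult_left_mono) auto
      also have "\<dots> = 4 * C / real (Suc N)" by simp
      also have "\<dots> < e"
      proof -
        have "4 * C < e * real N" using N \<open>e > 0\<close> by (simp add: field_simps)
        also have "\<dots> \<le> e * real (Suc N)" using \<open>e > 0\<close> by simp
        finally show ?thesis by (simp add: field_simps)
      qed
      finally show ?thesis .
    qed
    then show ?thesis by blast
  qed
  have cS: "\<exists>N. \<forall>k\<ge>N. \<forall>n\<ge>N. sqint \<Omega> (\<lambda>x. S k x - S n x) < e" if "e > 0" for e
    using small[OF that, of 1] dist_S unfolding mult_1 by (meson le_less_trans zero_le_one)
  have cs: "\<exists>N. \<forall>k\<ge>N. \<forall>n\<ge>N. sqint \<Omega> (\<lambda>x. s k x - s n x) < e" if "e > 0" for e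
  proof -
    have "sqint \<Omega> (\<lambda>x. s k x - s n x) \<le> K * (2 * (1 / real (Suc k) + 1 / real (Suc n)))" for k n
      using dist_s[of k n] mult_left_mono[OF dist_S[of k n] K_nonneg] by linarith
    then show ?thesis using small[OF that K_nonneg] by (meson le_less_trans)
  qed
  obtain p where p: "p \<in> L2 \<Omega>" "L2_tendsto \<Omega> s p"
    using L2_complete[of s \<Omega>] L(1) cs by blast
  obtain P where P: "P \<in> L2 \<Omega>" "L2_tendsto \<Omega> S P"
    using L2_complete[of S \<Omega>] L(2) cS by blast
  have "wg p P"
    by (rule has_weak_grad_limit[OF _ p(1) P(1) p(2) P(2)]) (use sS(1) mean0_grad_def in blast)
  moreover have "sp p (\<lambda>x. 1) = 0"
  proof -
    have "(\<lambda>n. sp (s n) (\<lambda>x. 1)) \<longlonglongrightarrow> sp p (\<lambda>x. 1)"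
      unfolding spair_def by (rule L2_tendsto_bilinear[OF bounded_bilinear_mult L(1) p(1) L2_const p(2)])
    moreover have "sp (s n) (\<lambda>x. 1) = 0" for n
      using sS(1)[of n] by (simp add: mean0_grad_def)
    ultimately have "(\<lambda>n::nat. 0) \<longlonglongrightarrow> sp p (\<lambda>x. 1)" by simp
    then show ?thesis by (simp add: LIMSEQ_const_iff)
  qed
  ultimately have "mean0_grad p P" by (simp add: mean0_grad_def)
  moreover have "ip P T = ip F T + ip g t" if tT: "mean0_grad t T" for t T
  proof -
    note LT = mean0_grad_L2[OF tT]
    define e where "e = ip P T - (ip F T + ip g t)"
    define a where "a = ip T T"
    have ip_lim: "(\<lambda>n. ip (S n) T) \<longlonglongrightarrow> ip P T"
      unfolding ip_def by (rule L2_tendsto_bilinear[OF bounded_bilinear_inner L(2) P(1) LT(2) P(2)])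
    \<comment> \<open>The members of the minimising sequence are perturbed in the direction
      \<open>t\<close> and the limit is taken afterwards, so that \<open>J\<close> is never
      evaluated at \<open>p\<close>.\<close>
    have "0 \<le> 2 * \<tau> * e + \<tau> * \<tau> * a" for \<tau> :: real
    proof (rule LIMSEQ_le_const)
      show "(\<lambda>n. 1 / real (Suc n) + 2 * \<tau> * (ip (S n) T - (ip F T + ip g t)) + \<tau> * \<tau> * a) \<longlonglongrightarrow> 2 * \<tau> * e + \<tau> * \<tau> * a"
        unfolding e_def using tendsto_add[OF tendsto_add[OF lim0 tendsto_mult_left[OF tendsto_diff[OF ip_lim tendsto_const]]] tendsto_const]
        by simp
      have "0 \<le> 1 / real (Suc n) + 2 * \<tau> * (ip (S n) T - (ip F T + ip g t)) + \<tau> * \<tau> * a" for n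
      proof -
        have "m \<le> J (\<lambda>x. s n x + \<tau> *\<^sub>R t x) (\<lambda>x. S n x + \<tau> *\<^sub>R T x)"
          by (intro m_le mean0_grad_add mean0_grad_scaleR sS(1) tT)
        also have "\<dots> = J (s n) (S n) + 2 * \<tau> * (ip (S n) T - (ip F T + ip g t)) + \<tau> * \<tau> * a"
          unfolding J_def a_def using L LT F g by (simp only: ip_simps ip_commute[of T "S n"]) (simp add: algebra_simps)
        finally show ?thesis using sS(2)[of n] by linarith
      qed
      then show "\<exists>N. \<forall>n\<ge>N. 0 \<le> 1 / real (Suc n) + 2 * \<tau> * (ip (S n) T - (ip F T + ip g t)) + \<tau> * \<tau> * a"
        by blast
    qed
    \<comment> \<open>For positive \<open>a\<close> the polynomial is smallest at
      \<open>- e / a\<close>. The denominator \<open>a + 1\<close> avoids a division by zero and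
      still gives the value \<open>- (e * e * (a + 2)) / ((a + 1) * (a + 1))\<close>, which is
      negative unless \<open>e = 0\<close>.\<close>
    from this[of "- e / (a + 1)"] have "0 \<le> 2 * (- e / (a + 1)) * e + (- e / (a + 1)) * (- e / (a + 1)) * a" .
    moreover have a: "a \<ge> 0" unfolding a_def by (rule ip_self_nonneg)
    moreover have "2 * (- e / (a + 1)) * e + (- e / (a + 1)) * (- e / (a + 1)) * a = - (e * e * (a + 2)) / ((a + 1) * (a + 1))"
      using a by (simp add: divide_simps) (simp add: algebra_simps)
    ultimately have "0 \<le> - (e * e * (a + 2)) / ((a + 1) * (a + 1))" by simp
    moreover have "(a + 1) * (a + 1) > 0" using a by simp
    ultimately have "e * e * (a + 2) \<le> 0"
      by (simp only: zero_le_divide_iff) argo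
    then have "e * e * (a + 2) \<le> 0 * (a + 2)" by simp
    then have "e * e \<le> 0"
      by (rule mult_right_le_imp_le) (use a in simp)
    then have "e = 0"
      by (metis mult_eq_0_iff order_antisym zero_le_square)
    then show ?thesis by (simp add: e_def)
  qed
  ultimately show ?thesis using that by blast
qed

lemma measure_dom_pos: "measure (lebesgue_on \<Omega>) \<Omega> > 0"
proof -
  have "emeasure lborel \<Omega> > 0" "emeasure lborel \<Omega> < \<infinity>"
    using emeasure_open_pos[OF open_dom nonempty_dom] emeasure_bounded_finite[OF bounded_dom] by auto
  then have "measure lborel \<Omega> > 0"
    by (simp add: measure_def enn2real_positive_iff)
  then show ?thesis
    by (simp add: measure_restrict_space measure_completion)
qed

lemma has_weak_grad_mean0:
  assumes "wg s S"
  obtains c where "mean0_grad (\<lambda>x. s x - c) S"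
proof -
  let ?m = "measure (lebesgue_on \<Omega>) \<Omega>"
  define c where "c = sp s (\<lambda>x. 1) / of_real ?m"
  have s: "s \<in> L2 \<Omega>" using assms by (simp add: has_weak_grad_def)
  have "sp (\<lambda>x. c) (\<lambda>x. 1) = of_real ?m * c"
    by (simp add: spair_def scaleR_conv_of_real)
  also have "\<dots> = sp s (\<lambda>x. 1)"
    using measure_dom_pos by (simp add: c_def)
  finally have "sp (\<lambda>x. s x - c) (\<lambda>x. 1) = 0"
    using spair_diff_left[OF s L2_const L2_const] by simp
  moreover have "wg (\<lambda>x. s x - c) S"
    using has_weak_grad_diff[OF assms has_weak_grad_const[of c]] by simp
  ultimately show ?thesis using that by (simp add: mean0_grad_def)
qed

lemma ip_vcnj: "f \<in> L2 \<Omega> \<Longrightarrow> h \<in> L2 \<Omega> \<Longrightarrow> ip f (\<lambda>x. vcnj (h x)) = Re (vp f h)"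
  using integral_Re[OF integrable_vdot[of f \<Omega> h]] by (simp add: ip_def inner_vcnj vpair_vdot)

lemma ip_cnj: "f \<in> L2 \<Omega> \<Longrightarrow> h \<in> L2 \<Omega> \<Longrightarrow> ip f (\<lambda>x. cnj (h x)) = Re (sp f h)"
  using integral_Re[OF integrable_L2_mult[of f \<Omega> h]] by (simp add: ip_def inner_cnj spair_def)

text \<open>The mean value condition on \<open>g\<close> is the compatibility condition: it makes
  the right side insensitive to constants, so that the Euler equation extends from mean-zero
  \<open>s\<close> to all \<open>s\<close>. The boundary condition is implicit in testing with
  functions that need not vanish at the boundary.\<close>

lemma neumann_solution:
  assumes F: "F \<in> L2 \<Omega>" and g: "g \<in> L2 \<Omega>" "sp g (\<lambda>x. 1) = 0"
  obtains p P where "wg p P" "sp p (\<lambda>x. 1) = 0"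
    "\<And>s S. wg s S \<Longrightarrow> vp P S = vp F S + sp g s"
proof -
  obtain p P where p: "mean0_grad p P" and eq0: "\<And>s S. mean0_grad s S \<Longrightarrow> ip P S = ip F S + ip g s"
    using dirichlet_minimiser[OF F g(1)] by blast
  have LP: "P \<in> L2 \<Omega>" using mean0_grad_L2(2)[OF p] .
  have eq: "ip P S = ip F S + ip g s" if sS: "wg s S" for s S
  proof -
    obtain c where c: "mean0_grad (\<lambda>x. s x - c) S"
      using has_weak_grad_mean0[OF sS] by blast
    have s: "s \<in> L2 \<Omega>" using sS by (simp add: has_weak_grad_def)
    have "ip g (\<lambda>x. s x + (- 1) *\<^sub>R c) = ip g s + (- 1) * ip g (\<lambda>x. c)"
      using ip_add_right[OF s L2_scaleR[OF L2_const] g(1), of "- 1" c] by (simp add: ip_scaleR_right[of g "- 1" "\<lambda>x. c", simplified])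
    moreover have "ip g (\<lambda>x. c) = inner (sp g (\<lambda>x. 1)) c"
      using integral_bounded_linear[OF bounded_linear_inner_left L2_integrable[OF g(1)], of c] by (simp add: ip_def spair_def)
    ultimately show ?thesis using eq0[OF c] g(2) by simp
  qed
  \<comment> \<open>Testing with the conjugate turns the real inner product into the real part of
    the bilinear pairing.\<close>
  have Re_eq: "Re (vp P S) = Re (vp F S + sp g s)" if sS: "wg s S" for s S
  proof -
    have "s \<in> L2 \<Omega>" "S \<in> L2 \<Omega>" using sS by (auto simp: has_weak_grad_def)
    then show ?thesis
      using eq[OF has_weak_grad_cnj[OF sS]] LP F g(1) by (simp add: ip_vcnj ip_cnj)
  qed
  have "vp P S = vp F S + sp g s" if sS: "wg s S" for s S
  proof (rule complex_eqI)
    show "Re (vp P S) = Re (vp F S + sp g s)" by (rule Re_eq[OF sS])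
    \<comment> \<open>The real part for the multiple of \<open>s\<close> by the imaginary unit is
      minus the imaginary part for \<open>s\<close>.\<close>
    have "vp f (\<lambda>x. \<i> *s S x) = \<i> * vp f S" for f
      by (simp add: vpair_vdot vdot_smult)
    moreover have "sp g (\<lambda>x. \<i> * s x) = \<i> * sp g s"
      by (simp add: spair_def mult.left_commute)
    ultimately show "Im (vp P S) = Im (vp F S + sp g s)"
      using Re_eq[OF has_weak_grad_cmult[OF sS, of \<i>]] by simp
  qed
  with that p show ?thesis by (auto simp: mean0_grad_def)
qed

lemma mean0_grad_zero:
  assumes "mean0_grad s S" "aeq S (\<lambda>x. 0)"
  shows "aeq s (\<lambda>x. 0)"
proof -
  have L: "s \<in> L2 \<Omega>" using mean0_grad_L2(1)[OF assms(1)] .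
  have "sqint \<Omega> S = 0"
    by (rule integral_eq_zero_AE) (use assms(2) in \<open>auto simp: ae_eq_def\<close>)
  then have "sqint \<Omega> s \<le> 0"
    using assms(1) poincare[of s S] by (simp add: mean0_grad_def)
  then have "sqint \<Omega> s = 0"
    by (intro antisym integral_nonneg_AE) auto
  then show ?thesis
    using integral_nonneg_eq_0_iff_AE[OF L2_integrable_norm_sq[OF L]] by (simp add: ae_eq_def)
qed

end

section \<open>Matrix fields\<close>

lemma matrix_inv_eqI:
  fixes X Y :: "real^'n^'n"
  assumes "X ** Y = mat 1"
  shows "matrix_inv X = Y"
proof -
  have YX: "Y ** X = mat 1" using assms matrix_left_right_inverse by blast
  then have "X ** matrix_inv X = mat 1 \<and> matrix_inv X ** X = mat 1"
    unfolding matrix_inv_def using assms by (intro someI[of "\<lambda>Z. X ** Z = mat 1 \<and> Z ** X = mat 1"]) simp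
  moreover have "matrix_inv X = (Y ** X) ** matrix_inv X" by (simp add: YX)
  ultimately show ?thesis by (simp flip: matrix_mul_assoc)
qed

text \<open>A positive quadratic form forces a trivial kernel; for a square matrix the resulting
  left inverse is two-sided.\<close>

lemma coercive_matrix_inv:
  fixes N :: "real^'n^'n"
  assumes "\<And>\<xi>. \<xi> \<noteq> 0 \<Longrightarrow> \<xi> \<bullet> (N *v \<xi>) > 0"
  shows "N ** matrix_inv N = mat 1" "matrix_inv N ** N = mat 1"
proof -
  have "N *v x = 0 \<longrightarrow> x = 0" for x
    using assms[of x] by (metis inner_zero_right less_irrefl)
  then obtain B where "B ** N = mat 1"
    using matrix_left_invertible_ker[of N] by blast
  then have *: "N ** B = mat 1" using matrix_left_right_inverse by blast
  then have "matrix_inv N = B" by (rule matrix_inv_eqI)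
  then show "N ** matrix_inv N = mat 1" "matrix_inv N ** N = mat 1"
    using * \<open>B ** N = mat 1\<close> by auto
qed

lemma cmv_nth: "(M *c w) $ i = (\<Sum>j\<in>UNIV. complex_of_real (M $ i $ j) * w $ j)"
  by (simp add: cmv_def matrix_vector_mult_def)

lemma cmv_cmv: "X *c (Y *c w) = (X ** Y) *c w"
proof -
  have "(\<chi> i j. complex_of_real ((X ** Y) $ i $ j)) =
    (\<chi> i j. complex_of_real (X $ i $ j)) ** (\<chi> i j. complex_of_real (Y $ i $ j))"
    by (simp add: vec_eq_iff matrix_matrix_mult_def)
  then show ?thesis by (simp add: cmv_def matrix_vector_mul_assoc)
qed

lemma cmv_add_left: "(X + Y) *c w = X *c w + Y *c w"
  by (simp add: vec_eq_iff cmv_nth distrib_right sum.distrib)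

lemma cmv_minus_left: "(- X) *c w = - (X *c w)"
  by (simp add: vec_eq_iff cmv_nth sum_negf)

lemma cmv_mat_1:
  fixes w :: "complex^'n"
  shows "mat 1 *c w = w"
proof -
  have "complex_of_real ((mat 1 :: real^'n^'n) $ i $ j) * w $ j = (if i = j then w $ j else 0)" for i j
    by (simp add: mat_def)
  then show ?thesis by (simp add: vec_eq_iff cmv_nth)
qed

lemma cmv_add_right: "X *c (v + w) = X *c v + X *c w"
  by (simp add: vec_eq_iff cmv_nth distrib_left sum.distrib)

lemma vdot_cmv: "vdot (X *c a) b = vdot a (transpose X *c b)"
  by (simp add: vdot_def cmv_nth transpose_def sum_distrib_left sum_distrib_right mult_ac)
    (rule sum.swap)

lemma norm_cmv_le:
  fixes M :: "real^'n^'n"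
  assumes "\<And>i j. \<bar>M $ i $ j\<bar> \<le> C"
  shows "norm (M *c w) \<le> real CARD('n) * (real CARD('n) * C) * norm w"
proof -
  have C: "C \<ge> 0" using assms abs_ge_zero order_trans by blast
  have "norm ((M *c w) $ i) \<le> real CARD('n) * C * norm w" for i
  proof -
    have "norm ((M *c w) $ i) \<le> (\<Sum>j\<in>(UNIV::'n set). \<bar>M $ i $ j\<bar> * norm (w $ j))"
      unfolding cmv_nth by (rule order_trans[OF norm_sum]) (simp add: norm_mult)
    also have "\<dots> \<le> (\<Sum>j\<in>(UNIV::'n set). C * norm w)"
      by (intro sum_mono mult_mono assms Finite_Cartesian_Product.norm_nth_le C) auto
    finally show ?thesis by simp
  qed
  then have "(\<Sum>i\<in>UNIV. norm ((M *c w) $ i)) \<le> (\<Sum>i\<in>(UNIV::'n set). real CARD('n) * C * norm w)"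
    by (intro sum_mono)
  moreover have "norm (M *c w) \<le> (\<Sum>i\<in>UNIV. norm ((M *c w) $ i))"
    unfolding norm_vec_def by (rule L2_set_le_sum) simp
  ultimately show ?thesis by (simp add: mult.assoc)
qed

text \<open>A column \<eta> of the inverse is mapped to a unit vector by \<open>N\<close>, so
  coercivity and Cauchy-Schwarz give \<open>\<delta> * norm \<eta> \<le> 1\<close>.\<close>

lemma coercive_matrix_inv_entry_le:
  fixes N :: "real^'n^'n"
  assumes "\<delta> > 0" "\<And>\<xi>. \<xi> \<bullet> (N *v \<xi>) \<ge> \<delta> * (norm \<xi>)\<^sup>2"
  shows "\<bar>matrix_inv N $ i $ j\<bar> \<le> 1 / \<delta>"
proof -
  have pos: "\<xi> \<bullet> (N *v \<xi>) > 0" if "\<xi> \<noteq> 0" for \<xi>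
    using assms that by (intro less_le_trans[OF _ assms(2)]) simp
  define \<eta> where "\<eta> = matrix_inv N *v axis j 1"
  have N\<eta>: "N *v \<eta> = axis j 1"
    unfolding \<eta>_def using coercive_matrix_inv(1)[OF pos] by (simp add: matrix_vector_mul_assoc)
  have "\<delta> * (norm \<eta>)\<^sup>2 \<le> norm \<eta> * norm (N *v \<eta>)"
    using assms(2)[of \<eta>] norm_cauchy_schwarz[of \<eta> "N *v \<eta>"] by (rule order_trans)
  then have "\<delta> * norm \<eta> * norm \<eta> \<le> 1 * norm \<eta>"
    by (simp add: N\<eta> norm_axis_1 power2_eq_square mult.assoc)
  then have "\<delta> * norm \<eta> \<le> 1"
    by (cases "norm \<eta> = 0") (auto simp: mult_le_cancel_right)
  moreover have "\<bar>matrix_inv N $ i $ j\<bar> \<le> norm \<eta>"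
    using component_le_norm_cart[of \<eta> i] by (simp add: \<eta>_def matrix_vector_mult_basis column_def)
  ultimately show ?thesis
    using assms(1) by (simp add: field_simps) (metis mult.commute mult_left_mono less_imp_le order_trans)
qed

lemma borel_measurable_det:
  fixes f :: "'a \<Rightarrow> real^'n^'n"
  assumes "\<And>i j. (\<lambda>x. f x $ i $ j) \<in> borel_measurable M"
  shows "(\<lambda>x. det (f x)) \<in> borel_measurable M"
  unfolding det_def using assms by measurable

lemma borel_measurable_vec_nth:
  fixes f :: "'a \<Rightarrow> ('b::euclidean_space)^'n"
  assumes "f \<in> borel_measurable M"
  shows "(\<lambda>x. f x $ i) \<in> borel_measurable M"
  by (rule measurable_compose[OF assms]) (intro borel_measurable_continuous_onI continuous_intros)

lemma borel_measurable_vecI: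
  fixes f :: "'a \<Rightarrow> ('b::euclidean_space)^'n"
  assumes "\<And>i. (\<lambda>x. f x $ i) \<in> borel_measurable M"
  shows "f \<in> borel_measurable M"
proof -
  have "(\<lambda>x. f x \<bullet> b) \<in> borel_measurable M" if b: "b \<in> Basis" for b
  proof -
    obtain i c where "b = axis i c" using b unfolding Basis_vec_def by blast
    then show ?thesis using assms[of i] by (simp add: inner_axis)
  qed
  then show ?thesis by (subst borel_measurable_euclidean_space) blast
qed

text \<open>Cramer's rule writes each entry as a quotient of determinants, which are polynomials in
  the entries of \<open>f x\<close> and constants.\<close>

lemma borel_measurable_matrix_inv_nth:
  fixes f :: "'a \<Rightarrow> real^'n^'n"
  assumes "\<And>i j. (\<lambda>x. f x $ i $ j) \<in> borel_measurable M"
    and "\<And>x. x \<in> space M \<Longrightarrow> f x ** matrix_inv (f x) = mat 1"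
  shows "(\<lambda>x. matrix_inv (f x) $ i $ j) \<in> borel_measurable M"
proof -
  let ?g = "\<lambda>x. det (\<chi> k l. if l = i then (axis j 1 :: real^'n) $ k else f x $ k $ l) / det (f x)"
  have "matrix_inv (f x) $ i $ j = ?g x" if "x \<in> space M" for x
  proof -
    have "det (f x) \<noteq> 0"
      using assms(2)[OF that] by (metis det_I det_mul mult_zero_left zero_neq_one)
    moreover have "f x *v (matrix_inv (f x) *v axis j 1) = axis j 1"
      using assms(2)[OF that] by (simp add: matrix_vector_mul_assoc)
    ultimately have "matrix_inv (f x) *v axis j 1 = (\<chi> i. det (\<chi> k l. if l = i then (axis j 1 :: real^'n) $ k else f x $ k $ l) / det (f x))"
      using cramer by blast
    moreover have "matrix_inv (f x) $ i $ j = (matrix_inv (f x) *v axis j 1) $ i"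
      by (simp add: matrix_vector_mult_basis column_def)
    ultimately show ?thesis by simp
  qed
  moreover have "?g \<in> borel_measurable M"
    by (intro borel_measurable_divide borel_measurable_det) (use assms(1) in \<open>auto simp: if_distrib\<close>)
  ultimately show ?thesis
    by (subst measurable_cong) auto
qed

lemma L2_cmv:
  fixes X :: "real^'n \<Rightarrow> real^'n^'n"
  assumes "f \<in> L2 \<Omega>" "\<And>i j. (\<lambda>x. X x $ i $ j) \<in> borel_measurable (lebesgue_on \<Omega>)"
    and "\<And>x i j. x \<in> \<Omega> \<Longrightarrow> \<bar>X x $ i $ j\<bar> \<le> C"
  shows "(\<lambda>x. X x *c f x) \<in> L2 \<Omega>"
proof (rule L2_bound[OF assms(1)])
  note [measurable] = assms(2) borel_measurable_vec_nth[OF L2_measurable[OF assms(1)]]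
  show "(\<lambda>x. X x *c f x) \<in> borel_measurable (lebesgue_on \<Omega>)"
    unfolding cmv_def matrix_vector_mult_def
    by (rule borel_measurable_vecI) simp
  show "AE x in lebesgue_on \<Omega>. norm (X x *c f x) \<le> real CARD('n) * (real CARD('n) * C) * norm (f x)"
    by (intro AE_I2 norm_cmv_le assms(3)) (simp add: space_restrict_space)
qed

text \<open>From \<open>(M - mat 1) ** Q = mat 1\<close> follows \<open>M ** Q = mat 1 + Q\<close>.
  Applying the inverse of \<open>M\<close> gives the second claim; subtracting
  \<open>mat 1 + Q\<close> from it gives the first up to sign. Symmetry of the inverse is uniqueness
  of inverses applied to the transpose.\<close>

lemma spd_shift:
  fixes M :: "real^'n^'n"
  assumes "spd M" "\<And>\<xi>. \<xi> \<noteq> 0 \<Longrightarrow> \<xi> \<bullet> ((M - mat 1) *v \<xi>) > 0"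
  defines "Q \<equiv> matrix_inv (M - mat 1)"
  shows "matrix_inv (matrix_inv M - mat 1) = - (mat 1 + Q)"
    and "matrix_inv M ** (mat 1 + Q) = Q"
    and "transpose (matrix_inv M) = matrix_inv M"
proof -
  have M: "M ** matrix_inv M = mat 1" "matrix_inv M ** M = mat 1"
    using assms(1) by (auto simp: spd_def intro: coercive_matrix_inv)
  have "(M - mat 1) ** Q = mat 1"
    unfolding Q_def by (rule coercive_matrix_inv(1)[OF assms(2)])
  then have "(M - mat 1) *v (Q *v x) = x" for x
    by (simp add: matrix_vector_mul_assoc)
  then have MQ: "M *v (Q *v x) = x + Q *v x" for x
    by (simp add: matrix_vector_mult_diff_rdistrib diff_eq_eq)
  have M': "matrix_inv M *v (M *v x) = x" for x
    using M(2) by (simp add: matrix_vector_mul_assoc)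
  have inv_MQ: "matrix_inv M *v (x + Q *v x) = Q *v x" for x
    unfolding MQ[symmetric] by (rule M')
  show Q: "matrix_inv M ** (mat 1 + Q) = Q"
    by (simp add: matrix_eq matrix_vector_mult_add_rdistrib inv_MQ flip: matrix_vector_mul_assoc)
  have neg: "(- (mat 1 + Q)) *v x = - (x + Q *v x)" for x
    using matrix_vector_mult_diff_rdistrib[of 0 "mat 1 + Q" x] by (simp add: matrix_vector_mult_add_rdistrib)
  have "(matrix_inv M - mat 1) *v (- (x + Q *v x)) = x" for x
  proof -
    have "(matrix_inv M - mat 1) *v (x + Q *v x) = Q *v x - (x + Q *v x)"
      using inv_MQ by (simp add: matrix_vector_mult_diff_rdistrib)
    moreover have "(matrix_inv M - mat 1) *v (- (x + Q *v x)) = - ((matrix_inv M - mat 1) *v (x + Q *v x))"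
      using matrix_vector_mult_diff_distrib[of "matrix_inv M - mat 1" 0 "x + Q *v x"] by simp
    ultimately show ?thesis by simp
  qed
  then have "(matrix_inv M - mat 1) ** (- (mat 1 + Q)) = mat 1"
    unfolding matrix_eq by (simp only: neg matrix_vector_mul_lid flip: matrix_vector_mul_assoc) simp
  then show "matrix_inv (matrix_inv M - mat 1) = - (mat 1 + Q)"
    by (rule matrix_inv_eqI)
  have "transpose M = M" using assms(1) by (simp add: spd_def)
  then have "M ** transpose (matrix_inv M) = mat 1"
    using M(2) by (metis matrix_transpose_mul transpose_mat)
  then show "transpose (matrix_inv M) = matrix_inv M"
    using matrix_inv_eqI by metis
qed

text \<open>The symmetric inverse of \<open>A x\<close> is moved to the other factor, where it meets
  \<open>P_field A x\<close> and turns it into \<open>- Q_field A x\<close>.\<close>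

lemma vdot_P_field:
  fixes A :: "real^'n \<Rightarrow> real^'n^'n"
  assumes "spd (A x)" "\<And>\<xi>. \<xi> \<noteq> 0 \<Longrightarrow> \<xi> \<bullet> ((A x - mat 1) *v \<xi>) > 0"
  shows "vdot (P_field A x *c a) (w + lam *s (matrix_inv (A x) *c v)) =
    - (vdot ((mat 1 + Q_field A x) *c a) w + lam * vdot (Q_field A x *c a) v)"
proof -
  have P: "P_field A x = - (mat 1 + Q_field A x)"
    unfolding P_field_def Q_field_def by (rule spd_shift(1)[OF assms])
  have AQ: "matrix_inv (A x) ** (mat 1 + Q_field A x) = Q_field A x"
    unfolding Q_field_def by (rule spd_shift(2)[OF assms])
  have "vdot (P_field A x *c a) (w + lam *s (matrix_inv (A x) *c v)) =
    - (vdot ((mat 1 + Q_field A x) *c a) w + lam * vdot ((mat 1 + Q_field A x) *c a) (matrix_inv (A x) *c v))"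
    unfolding P cmv_minus_left by (simp add: vdot_simps vdot_smult)
  also have "vdot ((mat 1 + Q_field A x) *c a) (matrix_inv (A x) *c v) = vdot (matrix_inv (A x) *c ((mat 1 + Q_field A x) *c a)) v"
    by (simp add: vdot_cmv[of "matrix_inv (A x)"] spd_shift(3)[OF assms])
  also have "matrix_inv (A x) *c ((mat 1 + Q_field A x) *c a) = Q_field A x *c a"
    by (simp add: cmv_cmv AQ)
  finally show ?thesis .
qed

lemma kappa_lower_coercive:
  assumes "1 < kappa_lower \<Omega> A"
  obtains \<delta> where "\<delta> > 0" "\<And>x \<xi>. x \<in> \<Omega> \<Longrightarrow> \<xi> \<bullet> ((A x - mat 1) *v \<xi>) \<ge> \<delta> * (norm \<xi>)\<^sup>2"
proof -
  \<comment> \<open>A real number strictly between 1 and the extended-real bound serves even when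
    that bound is infinite; the coercivity constant is \<open>k - 1\<close>.\<close>
  obtain k where k: "1 < ereal k" "ereal k < kappa_lower \<Omega> A"
    using ereal_dense2[OF assms] by blast
  show ?thesis
  proof (rule that[of "k - 1"])
    show "k - 1 > 0" using k(1) by simp
    fix x \<xi> assume x: "x \<in> \<Omega>"
    have unit: "k \<le> \<zeta> \<bullet> (A x *v \<zeta>)" if "norm \<zeta> = 1" for \<zeta>
    proof -
      have "kappa_lower \<Omega> A \<le> ereal (\<zeta> \<bullet> (A x *v \<zeta>))"
        unfolding kappa_lower_def using x that by (intro INF_lower2[OF x] INF_lower) simp
      from less_le_trans[OF k(2) this] show ?thesis by simp
    qed
    show "\<xi> \<bullet> ((A x - mat 1) *v \<xi>) \<ge> (k - 1) * (norm \<xi>)\<^sup>2"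
    proof (cases "\<xi> = 0")
      case False
      define \<zeta> where "\<zeta> = (1 / norm \<xi>) *\<^sub>R \<xi>"
      have \<xi>: "\<xi> = norm \<xi> *\<^sub>R \<zeta>" "norm \<zeta> = 1" using False by (auto simp: \<zeta>_def)
      have "\<xi> \<bullet> (A x *v \<xi>) = (norm \<xi>)\<^sup>2 * (\<zeta> \<bullet> (A x *v \<zeta>))"
        by (subst (1 2) \<xi>(1)) (simp add: matrix_vector_mult_scaleR power2_eq_square)
      moreover have "(norm \<xi>)\<^sup>2 * k \<le> (norm \<xi>)\<^sup>2 * (\<zeta> \<bullet> (A x *v \<zeta>))"
        using unit[OF \<xi>(2)] by (intro mult_left_mono) auto
      ultimately have "(norm \<xi>)\<^sup>2 * k \<le> \<xi> \<bullet> (A x *v \<xi>)" by simp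
      then show ?thesis
        by (simp add: matrix_vector_mult_diff_rdistrib inner_diff_right power2_norm_eq_inner algebra_simps)
    qed simp
  qed
qed

section \<open>Equivalence of the two eigenvalue problems\<close>

locale coefficient_domain = poincare_domain \<Omega> K for \<Omega> :: "(real^'d) set" and K :: real +
  fixes A :: "real^'d \<Rightarrow> real^'d^'d" and \<delta> :: real
  assumes A_measurable: "A \<in> borel_measurable (lebesgue_on \<Omega>)"
    and A_spd: "\<And>x. x \<in> \<Omega> \<Longrightarrow> spd (A x)"
    and \<delta>_pos: "\<delta> > 0"
    and A_coercive: "\<And>x \<xi>. x \<in> \<Omega> \<Longrightarrow> \<xi> \<bullet> ((A x - mat 1) *v \<xi>) \<ge> \<delta> * (norm \<xi>)\<^sup>2"
begin

abbreviation Q :: "real^'d \<Rightarrow> real^'d^'d" where "Q \<equiv> Q_field A"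

lemma A_shift_pos: "x \<in> \<Omega> \<Longrightarrow> \<xi> \<noteq> 0 \<Longrightarrow> \<xi> \<bullet> ((A x - mat 1) *v \<xi>) > 0"
  using \<delta>_pos by (intro less_le_trans[OF _ A_coercive]) simp_all

text \<open>Coercivity of \<open>A x - mat 1\<close> bounds the entries of its inverse uniformly in
  \<open>x\<close>, and Cramer's rule supplies measurability.\<close>

lemma L2_Q:
  assumes "f \<in> L2 \<Omega>"
  shows "(\<lambda>x. Q x *c f x) \<in> L2 \<Omega>"
proof (rule L2_cmv[OF assms])
  fix i j
  have "(\<lambda>x. (A x - mat 1) $ k $ l) \<in> borel_measurable (lebesgue_on \<Omega>)" for k l
    using borel_measurable_vec_nth[OF borel_measurable_vec_nth[OF A_measurable]] by simp
  then show "(\<lambda>x. Q x $ i $ j) \<in> borel_measurable (lebesgue_on \<Omega>)"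
    unfolding Q_field_def
    by (rule borel_measurable_matrix_inv_nth)
      (auto simp: space_restrict_space intro!: coercive_matrix_inv A_shift_pos)
  show "x \<in> \<Omega> \<Longrightarrow> \<bar>Q x $ i $ j\<bar> \<le> 1 / \<delta>" for x
    unfolding Q_field_def by (rule coercive_matrix_inv_entry_le[OF \<delta>_pos A_coercive])
qed

lemma cmv_mat_1_plus: "(mat 1 + Q x) *c w = w + Q x *c w"
  by (simp add: cmv_add_left cmv_mat_1)

lemma vpair_add_left: "f \<in> L2 \<Omega> \<Longrightarrow> g \<in> L2 \<Omega> \<Longrightarrow> h \<in> L2 \<Omega> \<Longrightarrow> vp (\<lambda>x. f x + g x) h = vp f h + vp g h"
  by (simp add: vpair_vdot vdot_simps integrable_vdot)

lemma vpair_diff_left: "f \<in> L2 \<Omega> \<Longrightarrow> g \<in> L2 \<Omega> \<Longrightarrow> h \<in> L2 \<Omega> \<Longrightarrow> vp (\<lambda>x. f x - g x) h = vp f h - vp g h"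
  by (simp add: vpair_vdot vdot_simps integrable_vdot)

lemma vpair_smult_left: "vp (\<lambda>x. c *s f x) h = c * vp f h"
  by (simp add: vpair_vdot vdot_smult)

lemma vpair_commute: "vp f g = vp g f"
  by (simp add: vpair_vdot vdot_commute)

lemma spair_commute: "sp f g = sp g f"
  by (simp add: spair_def mult.commute)

lemma vpair_zero: "vp (\<lambda>x. 0) f = 0" "vp f (\<lambda>x. 0) = 0"
  by (simp_all add: vpair_vdot vdot_simps)

lemma spair_zero: "sp (\<lambda>x. 0) f = 0" "sp f (\<lambda>x. 0) = 0"
  by (simp_all add: spair_def)

lemma vpair_vcnj_self_eq_0:
  assumes "d \<in> L2 \<Omega>" "vp d (\<lambda>x. vcnj (d x)) = 0"
  shows "aeq d (\<lambda>x. 0)"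
proof -
  have "complex_of_real (sqint \<Omega> d) = 0"
    using assms(2) by (simp add: vpair_vdot vdot_vcnj_self del: of_real_power)
  then have "sqint \<Omega> d = 0" by simp
  then show ?thesis
    using integral_nonneg_eq_0_iff_AE[OF L2_integrable_norm_sq[OF assms(1)]] by (simp add: ae_eq_def)
qed

lemma H10divD:
  assumes "v \<in> H10div \<Omega>"
  shows "v \<in> L2 \<Omega>" "v \<in> H0div \<Omega>" "wd v \<in> H10 \<Omega>" "wg (wd v) (grad (wd v))"
    "wd v \<in> L2 \<Omega>" "grad (wd v) \<in> L2 \<Omega>" "wd v \<in> L2_mean0 \<Omega>"
proof -
  show v: "v \<in> L2 \<Omega>" "v \<in> H0div \<Omega>" "wd v \<in> H10 \<Omega>"
    using assms by (auto simp: H10div_def H0div_def Hdiv_def)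
  show *: "wg (wd v) (grad (wd v))"
    by (rule has_weak_grad_wgrad[OF H10_H1[OF v(3)]])
  then show "wd v \<in> L2 \<Omega>" "grad (wd v) \<in> L2 \<Omega>"
    by (auto simp: has_weak_grad_def)
  \<comment> \<open>Green's formula against the constant 1. This makes the divergence of an
    admissible field a legitimate first component in \<open>V_space\<close>.\<close>
  then show "wd v \<in> L2_mean0 \<Omega>"
    using H0div_green[OF v(2) has_weak_grad_const[of 1]] by (simp add: L2_mean0_def vpair_zero)
qed

text \<open>Admissible fields arise below through their action on gradients. The divergence and its
  gradient are identified up to null sets because \<open>wdiv\<close> and \<open>wgrad\<close> pick
  representatives; \<open>H10_cong\<close> transfers membership to the chosen divergence.\<close>

lemma H10divI:
  assumes "v \<in> L2 \<Omega>" "\<psi> \<in> H10 \<Omega>" "\<forall>s S. wg s S \<longrightarrow> vp v S = - sp \<psi> s"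
  shows "v \<in> H10div \<Omega>" "aeq (wd v) \<psi>" "aeq (grad (wd v)) (grad \<psi>)"
proof -
  have \<psi>: "\<psi> \<in> L2 \<Omega>" using H1_L2[OF H10_H1[OF assms(2)]] .
  have v: "v \<in> H0div \<Omega>" "aeq (wd v) \<psi>"
    using H0divI[OF assms(1) \<psi>] assms(3) by blast+
  show ae: "aeq (wd v) \<psi>" by (rule v(2))
  have L: "wd v \<in> L2 \<Omega>"
    using v(1) by (auto simp: H0div_def intro: wdiv_L2)
  show "v \<in> H10div \<Omega>"
    using v(1) H10_cong[OF assms(2) L ae] by (simp add: H10div_def)
  have "wg (wd v) (grad \<psi>)"
    using has_weak_grad_wgrad[OF H10_H1[OF assms(2)]] L wgrad_L2[OF H10_H1[OF assms(2)]] ae ae_eq_refl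
    by (rule has_weak_grad_cong)
  then show "aeq (grad (wd v)) (grad \<psi>)" by (rule wgrad_ae_eq)
qed

lemma E1_integrand:
  assumes "a \<in> L2 \<Omega>" "w \<in> L2 \<Omega>" "v \<in> L2 \<Omega>"
  shows "vp (\<lambda>x. P_field A x *c a x) (\<lambda>x. w x + lam *s (matrix_inv (A x) *c v x)) =
    - (vp a w + vp (\<lambda>x. Q x *c a x) w + lam * vp (\<lambda>x. Q x *c a x) v)"
proof -
  have "vp (\<lambda>x. P_field A x *c a x) (\<lambda>x. w x + lam *s (matrix_inv (A x) *c v x)) =
    (LINT x|lebesgue_on \<Omega>. - (vdot (a x) (w x) + vdot (Q x *c a x) (w x) + lam * vdot (Q x *c a x) (v x)))"
    unfolding vpair_vdot
  proof (rule Bochner_Integration.integral_cong)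
    fix x assume "x \<in> space (lebesgue_on \<Omega>)"
    then have x: "x \<in> \<Omega>" by (simp add: space_restrict_space)
    show "vdot (P_field A x *c a x) (w x + lam *s (matrix_inv (A x) *c v x)) =
      - (vdot (a x) (w x) + vdot (Q x *c a x) (w x) + lam * vdot (Q x *c a x) (v x))"
      using vdot_P_field[of A x "a x" "w x" lam "v x", OF A_spd[OF x] A_shift_pos[OF x]]
      unfolding cmv_mat_1_plus vdot_simps(1) .
  qed simp
  also have "\<dots> = - (vp a w + vp (\<lambda>x. Q x *c a x) w + lam * vp (\<lambda>x. Q x *c a x) v)"
    using integrable_vdot[OF assms(1,2)] integrable_vdot[OF L2_Q[OF assms(1)] assms(2)]
      integrable_vdot[OF L2_Q[OF assms(1)] assms(3)]
    by (simp add: vpair_vdot)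
  finally show ?thesis .
qed

text \<open>Eliminates \<open>P_field\<close> and the inverse of \<open>A\<close>, and expands
  \<open>mat 1 + Q\<close>, so that both problems are phrased with the same pairings. The overall
  sign drops out because the right side is zero.\<close>

lemma eigenpair_E1_iff:
  "eigenpair_E1 \<Omega> A lam u \<longleftrightarrow> lam \<noteq> 0 \<and> u \<in> H10div \<Omega> \<and> \<not> aeq u (\<lambda>x. 0) \<and>
    (\<forall>v\<in>H10div \<Omega>. let a = (\<lambda>x. grad (wd u) x + lam *s u x); w = grad (wd v) in
       vp a w + vp (\<lambda>x. Q x *c a x) w + lam * vp (\<lambda>x. Q x *c a x) v = 0)"
proof -
  have "vp (\<lambda>x. P_field A x *c (grad (wd u) x + lam *s u x))
                (\<lambda>x. grad (wd v) x + lam *s (matrix_inv (A x) *c v x)) =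
    - (let a = (\<lambda>x. grad (wd u) x + lam *s u x); w = grad (wd v) in
       vp a w + vp (\<lambda>x. Q x *c a x) w + lam * vp (\<lambda>x. Q x *c a x) v)"
    if "u \<in> H10div \<Omega>" "v \<in> H10div \<Omega>" for v
    unfolding Let_def using H10divD[OF that(1)] H10divD[OF that(2)]
    by (intro E1_integrand L2_add L2_smult)
  then show ?thesis
    unfolding eigenpair_E1_def by (metis (no_types, lifting) neg_equal_0_iff_equal)
qed

text \<open>The three equations are quantified over a common triple, but each contains one of its
  components only; since every factor of \<open>V_space\<close> is nonempty, they can be
  separated.\<close>

lemma eigenpair_E2_iff:
  assumes "\<phi> \<in> H10 \<Omega>" "\<phi> \<in> L2_mean0 \<Omega>" "y \<in> L2 \<Omega>" "r \<in> H1 \<Omega>" "r \<in> L2_mean0 \<Omega>"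
  shows "eigenpair_E2 \<Omega> A lam (\<phi>, y, r) \<longleftrightarrow> lam \<noteq> 0 \<and>
    \<not> (aeq \<phi> (\<lambda>x. 0) \<and> aeq y (\<lambda>x. 0) \<and> aeq r (\<lambda>x. 0)) \<and>
    (\<forall>\<psi>\<in>H10 \<Omega> \<inter> L2_mean0 \<Omega>. vp (grad \<phi>) (grad \<psi>) + vp (\<lambda>x. Q x *c (grad \<phi> x + y x)) (grad \<psi>)
        = lam * (sp \<phi> \<psi> + sp r \<psi>)) \<and>
    (\<forall>z\<in>L2 \<Omega>. vp (\<lambda>x. Q x *c (grad \<phi> x + y x)) z = vp (grad r) z) \<and>
    (\<forall>s\<in>H1 \<Omega> \<inter> L2_mean0 \<Omega>. - vp y (grad s) = lam * sp \<phi> s)"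
  (is "_ \<longleftrightarrow> _ \<and> ?nonzero \<and> ?E1 \<and> ?E2 \<and> ?E3")
proof -
  let ?E1' = "\<forall>\<psi>\<in>H10 \<Omega> \<inter> L2_mean0 \<Omega>. vp (\<lambda>x. (mat 1 + Q x) *c grad \<phi> x) (grad \<psi>)
      + vp (\<lambda>x. Q x *c y x) (grad \<psi>) = lam * (sp \<phi> \<psi> + sp r \<psi>)"
  let ?E2' = "\<forall>z\<in>L2 \<Omega>. vp (\<lambda>x. Q x *c grad \<phi> x) z + vp (\<lambda>x. Q x *c y x) z - vp (grad r) z = 0"
  note g = wgrad_L2[OF H10_H1[OF assms(1)]]
  have split: "vp (\<lambda>x. Q x *c (grad \<phi> x + y x)) z =
      vp (\<lambda>x. Q x *c grad \<phi> x) z + vp (\<lambda>x. Q x *c y x) z" if "z \<in> L2 \<Omega>" for z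
    unfolding cmv_add_right using L2_Q[OF g] L2_Q[OF assms(3)] that by (rule vpair_add_left)
  have split': "vp (\<lambda>x. (mat 1 + Q x) *c grad \<phi> x) z = vp (grad \<phi>) z + vp (\<lambda>x. Q x *c grad \<phi> x) z"
    if "z \<in> L2 \<Omega>" for z
    unfolding cmv_mat_1_plus using g L2_Q[OF g] that by (rule vpair_add_left)
  have zeros: "(\<lambda>x. 0) \<in> H10 \<Omega> \<inter> L2_mean0 \<Omega>" "(\<lambda>x. 0) \<in> (L2 \<Omega> :: (real^'d \<Rightarrow> complex^'d) set)"
    "(\<lambda>x. 0) \<in> H1 \<Omega> \<inter> L2_mean0 \<Omega>"
    using zero_in_H10 H10_H1 L2_zero by (auto simp: L2_mean0_def spair_zero)
  have prod: "(\<forall>(\<psi>, z, s)\<in>X \<times> Y \<times> Z. p \<psi> \<and> q z \<and> t s) \<longleftrightarrow> (\<forall>\<psi>\<in>X. p \<psi>) \<and> (\<forall>z\<in>Y. q z) \<and> (\<forall>s\<in>Z. t s)"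
    if "X \<noteq> {}" "Y \<noteq> {}" "Z \<noteq> {}" for X :: "'p set" and Y :: "'q set" and Z :: "'t set" and p q t
    using that by auto
  have V: "V_space \<Omega> = (H10 \<Omega> \<inter> L2_mean0 \<Omega>) \<times> L2 \<Omega> \<times> (H1 \<Omega> \<inter> L2_mean0 \<Omega>)"
    by (simp add: V_space_def)
  have in_V: "(\<phi>, y, r) \<in> V_space \<Omega>" using assms by (simp add: V_space_def)
  have grad_L2: "grad \<psi> \<in> L2 \<Omega>" if "\<psi> \<in> H10 \<Omega> \<inter> L2_mean0 \<Omega>" for \<psi>
    using that wgrad_L2 H10_H1 by blast
  have e1: "?E1' \<longleftrightarrow> ?E1"
    by (intro ball_cong refl, subst split[OF grad_L2], assumption, subst split'[OF grad_L2], assumption)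
      (simp add: add.assoc)
  have e2: "?E2' \<longleftrightarrow> ?E2"
    by (intro ball_cong refl) (simp add: split)
  have "eigenpair_E2 \<Omega> A lam (\<phi>, y, r) \<longleftrightarrow> lam \<noteq> 0 \<and> (\<phi>, y, r) \<in> V_space \<Omega> \<and> ?nonzero \<and> ?E1' \<and> ?E2' \<and> ?E3"
    unfolding eigenpair_E2_def prod.case V
    by (subst prod) (use zeros in blast)+
  then show ?thesis
    unfolding e1 e2 using in_V by blast
qed

lemma E2_imp_E1:
  assumes "eigenpair_E2 \<Omega> A lam (\<phi>, y, r)"
  shows "eigenpair_E1 \<Omega> A lam (\<lambda>x. (1 / lam) *s y x)"
proof -
  have mem: "\<phi> \<in> H10 \<Omega>" "\<phi> \<in> L2_mean0 \<Omega>" "y \<in> L2 \<Omega>" "r \<in> H1 \<Omega>" "r \<in> L2_mean0 \<Omega>"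
    using assms by (auto simp: eigenpair_E2_def V_space_def)
  have lam: "lam \<noteq> 0"
    and nz: "\<not> (aeq \<phi> (\<lambda>x. 0) \<and> aeq y (\<lambda>x. 0) \<and> aeq r (\<lambda>x. 0))"
    and e1: "\<And>\<psi>. \<psi> \<in> H10 \<Omega> \<Longrightarrow> \<psi> \<in> L2_mean0 \<Omega> \<Longrightarrow>
      vp (grad \<phi>) (grad \<psi>) + vp (\<lambda>x. Q x *c (grad \<phi> x + y x)) (grad \<psi>)
        = lam * (sp \<phi> \<psi> + sp r \<psi>)"
    and e2: "\<And>z. z \<in> L2 \<Omega> \<Longrightarrow> vp (\<lambda>x. Q x *c (grad \<phi> x + y x)) z = vp (grad r) z"
    and e3: "\<And>s. s \<in> H1 \<Omega> \<Longrightarrow> s \<in> L2_mean0 \<Omega> \<Longrightarrow> - vp y (grad s) = lam * sp \<phi> s"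
    using assms unfolding eigenpair_E2_iff[OF mem] by blast+
  have L: "\<phi> \<in> L2 \<Omega>" "r \<in> L2 \<Omega>" "grad \<phi> \<in> L2 \<Omega>" "grad r \<in> L2 \<Omega>"
    using mem H1_L2 H10_H1 wgrad_L2 by blast+
  \<comment> \<open>Subtracting a constant from \<open>s\<close> changes neither side: the gradient
    stays the same, and \<phi> has mean zero. Thus the third equation holds for all of
    \<open>H1\<close>, which encodes the vanishing normal trace of \<open>y\<close>.\<close>
  have y_grad: "vp y S = - lam * sp \<phi> s" if sS: "wg s S" for s S
  proof -
    obtain c where c: "mean0_grad (\<lambda>x. s x - c) S"
      using has_weak_grad_mean0[OF sS] by blast
    let ?s = "\<lambda>x. s x - c"
    have s: "wg ?s S" "?s \<in> H1 \<Omega>" "?s \<in> L2_mean0 \<Omega>"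
      using c by (auto simp: mean0_grad_def L2_mean0_def H1_L2 H1I)
    have "vp y (grad ?s) = vp y S"
      using mem(3) wgrad_L2[OF s(2)] sS wgrad_ae_eq[OF s(1)]
      by (intro vpair_cong_ae ae_eq_refl) (auto simp: has_weak_grad_def)
    moreover have "sp \<phi> ?s = sp \<phi> s"
    proof -
      have "s \<in> L2 \<Omega>" using sS by (simp add: has_weak_grad_def)
      then have "sp ?s \<phi> = sp s \<phi> - sp (\<lambda>x. c) \<phi>"
        using L2_const L(1) by (rule spair_diff_left)
      moreover have "sp (\<lambda>x. c) \<phi> = c * sp \<phi> (\<lambda>x. 1)"
        by (simp add: spair_def)
      ultimately show ?thesis using mem(2) by (simp add: spair_commute L2_mean0_def)
    qed
    ultimately have "- (- vp y S) = - (lam * sp \<phi> s)"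
      using e3[OF s(2,3)] by simp
    then show ?thesis by simp
  qed
  define u where "u x = (1 / lam) *s y x" for x
  have u: "u \<in> L2 \<Omega>" unfolding u_def using mem(3) by (rule L2_smult)
  have lam_u: "lam *s u x = y x" for x using lam by (simp add: u_def vec_eq_iff)
  have "\<forall>s S. wg s S \<longrightarrow> vp u S = - sp \<phi> s"
    using y_grad lam by (simp add: u_def[abs_def] vpair_smult_left)
  note u_div = H10divI[OF u mem(1) this]
  \<comment> \<open>A vanishing \<open>u\<close> would make the whole triple trivial:
    \<open>y\<close> is a multiple of it and \<phi> its divergence; then \<open>grad r\<close>
    vanishes by the second equation and \<open>r\<close> by its mean value.\<close>
  have "\<not> aeq u (\<lambda>x. 0)"
  proof
    assume u0: "aeq u (\<lambda>x. 0)"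
    have y0: "aeq y (\<lambda>x. 0)"
      using u0 unfolding ae_eq_def by eventually_elim (simp flip: lam_u)
    have "vp u S = - sp (\<lambda>x. 0) s" if "wg s S" for s S
      using vpair_cong_ae[OF u _ L2_zero _ u0 ae_eq_refl, of S] that
      by (simp add: vpair_zero spair_zero has_weak_grad_def)
    then have "aeq (wd u) (\<lambda>x. 0)"
      by (rule H0divI(2)[OF u L2_zero])
    then have \<phi>0: "aeq \<phi> (\<lambda>x. 0)"
      using u_div(2) ae_eq_sym ae_eq_trans by blast
    have "wg \<phi> (\<lambda>x. 0)"
      using has_weak_grad_const L(1) L2_zero \<phi>0 ae_eq_refl by (rule has_weak_grad_cong)
    then have g0: "aeq (grad \<phi>) (\<lambda>x. 0)" by (rule wgrad_ae_eq)
    have "aeq (\<lambda>x. Q x *c (grad \<phi> x + y x)) (\<lambda>x. 0)"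
      using g0 y0 unfolding ae_eq_def by eventually_elim (simp add: vec_eq_iff cmv_nth)
    then have "vp (\<lambda>x. Q x *c (grad \<phi> x + y x)) z = vp (\<lambda>x. 0) z" if "z \<in> L2 \<Omega>" for z
      using L2_Q[OF L2_add[OF L(3) mem(3)]] that L2_zero by (intro vpair_cong_ae ae_eq_refl)
    then have "vp (grad r) (\<lambda>x. vcnj (grad r x)) = 0"
      using e2[OF L2_vcnj[OF L(4)]] L2_vcnj[OF L(4)] by (simp add: vpair_zero)
    then have "aeq (grad r) (\<lambda>x. 0)"
      by (rule vpair_vcnj_self_eq_0[OF L(4)])
    moreover have "mean0_grad r (grad r)"
      using has_weak_grad_wgrad[OF mem(4)] mem(5) by (simp add: mean0_grad_def L2_mean0_def)
    ultimately have "aeq r (\<lambda>x. 0)" using mean0_grad_zero by blast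
    with nz \<phi>0 y0 show False by blast
  qed
  \<comment> \<open>The first equation is used with the divergence of \<open>v\<close> as \<psi>,
    the second with \<open>z = v\<close> followed by Green's formula for \<open>r\<close>; the
    pairings with \<open>wd v\<close> then cancel.\<close>
  moreover have "vp a w + vp (\<lambda>x. Q x *c a x) w + lam * vp (\<lambda>x. Q x *c a x) v = 0"
    if v: "v \<in> H10div \<Omega>" and a_def: "a = (\<lambda>x. grad (wd u) x + lam *s u x)" and w_def: "w = grad (wd v)" for v a w
  proof -
    note vD = H10divD[OF v]
    let ?a = "\<lambda>x. grad \<phi> x + y x"
    have La: "a \<in> L2 \<Omega>" "?a \<in> L2 \<Omega>"
      unfolding a_def using H10divD(6)[OF u_div(1)] u mem(3) L(3) by (auto intro: L2_add L2_smult)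
    have aea: "aeq a ?a"
      using u_div(3) unfolding ae_eq_def a_def by eventually_elim (simp add: lam_u)
    then have aeQ: "aeq (\<lambda>x. Q x *c a x) (\<lambda>x. Q x *c ?a x)"
      unfolding ae_eq_def by eventually_elim simp
    have w: "w \<in> L2 \<Omega>" unfolding w_def by (rule vD(6))
    have "vp a w = vp ?a w"
      using La w aea by (intro vpair_cong_ae ae_eq_refl)
    also have "\<dots> = vp (grad \<phi>) w + vp y w"
      using L(3) mem(3) w by (rule vpair_add_left)
    also have "vp y w = - lam * sp \<phi> (wd v)"
      unfolding w_def by (rule y_grad[OF vD(4)])
    finally have aw: "vp a w = vp (grad \<phi>) w - lam * sp \<phi> (wd v)" by simp
    have Q: "vp (\<lambda>x. Q x *c a x) z = vp (\<lambda>x. Q x *c ?a x) z" if "z \<in> L2 \<Omega>" for z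
      using L2_Q[OF La(1)] L2_Q[OF La(2)] that aeQ by (intro vpair_cong_ae ae_eq_refl)
    have "vp (grad \<phi>) w + vp (\<lambda>x. Q x *c ?a x) w = lam * (sp \<phi> (wd v) + sp r (wd v))"
      unfolding w_def by (rule e1[OF vD(3,7)])
    then have Qw: "vp (\<lambda>x. Q x *c a x) w = lam * (sp \<phi> (wd v) + sp r (wd v)) - vp (grad \<phi>) w"
      unfolding Q[OF w] by (simp only: eq_diff_eq add.commute[of "vp (\<lambda>x. Q x *c ?a x) w"])
    have Qv: "vp (\<lambda>x. Q x *c a x) v = - sp r (wd v)"
      unfolding Q[OF vD(1)] using e2[OF vD(1)] H0div_green[OF vD(2) has_weak_grad_wgrad[OF mem(4)]]
      by (simp add: vpair_commute spair_commute)
    show ?thesis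
      unfolding aw Qw Qv by (simp add: algebra_simps)
  qed
  ultimately have "eigenpair_E1 \<Omega> A lam u"
    unfolding eigenpair_E1_iff Let_def using lam u_div(1) by blast
  then show ?thesis by (simp add: u_def[abs_def])
qed

lemma E1_imp_E2:
  assumes "eigenpair_E1 \<Omega> A lam u"
  shows "\<exists>r \<in> H1 \<Omega> \<inter> L2_mean0 \<Omega>. eigenpair_E2 \<Omega> A lam (wd u, \<lambda>x. lam *s u x, r)"
proof -
  define \<phi> where "\<phi> = wd u"
  define y where "y x = lam *s u x" for x
  define a where "a x = grad \<phi> x + y x" for x
  define F where "F x = Q x *c a x" for x
  have lam: "lam \<noteq> 0" and u: "u \<in> H10div \<Omega>" and nz: "\<not> aeq u (\<lambda>x. 0)"
    and E1: "\<And>v. v \<in> H10div \<Omega> \<Longrightarrow> vp a (grad (wd v)) + vp F (grad (wd v)) + lam * vp F v = 0"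
    using assms unfolding eigenpair_E1_iff Let_def \<phi>_def y_def[abs_def] a_def[abs_def] F_def[abs_def] by blast+
  note uD = H10divD[OF u, folded \<phi>_def]
  have y: "y \<in> L2 \<Omega>" unfolding y_def using uD(1) by (rule L2_smult)
  have La: "a \<in> L2 \<Omega>" unfolding a_def using uD(6) y by (rule L2_add)
  have LF: "F \<in> L2 \<Omega>" unfolding F_def using La by (rule L2_Q)
  have y_grad: "vp y S = - lam * sp \<phi> s" if "wg s S" for s S
    using H0div_green[OF uD(2) that] by (simp add: y_def[abs_def] vpair_smult_left \<phi>_def)
  \<comment> \<open>This is the projection of \<open>F\<close> onto gradients: the Neumann problem
    with the field \<open>F\<close> and no source.\<close>
  obtain r R where r: "wg r R" "sp r (\<lambda>x. 1) = 0"
    and R: "\<And>s S. wg s S \<Longrightarrow> vp R S = vp F S + sp (\<lambda>x. 0) s"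
    using neumann_solution[OF LF L2_zero spair_zero(1)] by blast
  have LR: "R \<in> L2 \<Omega>" using r(1) by (simp add: has_weak_grad_def)
  define d where "d x = F x - R x" for x
  have Ld: "d \<in> L2 \<Omega>" unfolding d_def using LF LR by (rule L2_diff)
  note Lc = L2_vcnj[OF Ld]
  \<comment> \<open>The conjugate of \<open>d\<close> is the right test field, since only the
    pairing of \<open>d\<close> with \<open>vcnj d\<close> yields a norm. Orthogonality to gradients
    passes to the conjugate because weak gradients are stable under conjugation.\<close>
  have perp: "vp (\<lambda>x. vcnj (d x)) S = 0" if sS: "wg s S" for s S
  proof -
    note c = has_weak_grad_cnj[OF sS]
    have "vp d (\<lambda>x. vcnj (S x)) = vp F (\<lambda>x. vcnj (S x)) - vp R (\<lambda>x. vcnj (S x))"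
      unfolding d_def using LF LR c by (intro vpair_diff_left) (auto simp: has_weak_grad_def)
    also have "\<dots> = 0" using R[OF c] by (simp add: spair_zero)
    finally have "cnj (vp d (\<lambda>x. vcnj (S x))) = 0" by simp
    moreover have e: "cnj (vdot (d x) (vcnj (S x))) = vdot (vcnj (d x)) (S x)" for x
      by (simp add: vdot_def vcnj_def)
    have "cnj (vp d (\<lambda>x. vcnj (S x))) = vp (\<lambda>x. vcnj (d x)) S"
      unfolding vpair_vdot by (subst Bochner_Integration.integral_cnj[symmetric]) (simp only: e)
    ultimately show ?thesis by simp
  qed
  then have "\<forall>s S. wg s S \<longrightarrow> vp (\<lambda>x. vcnj (d x)) S = - sp (\<lambda>x. 0) s"
    by (simp add: spair_zero)
  note c_div = H10divI[OF Lc zero_in_H10 this]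
  have "aeq (grad (wd (\<lambda>x. vcnj (d x)))) (\<lambda>x. 0)"
    using c_div(3) wgrad_ae_eq[OF has_weak_grad_const] ae_eq_trans by blast
  then have g0: "vp f (grad (wd (\<lambda>x. vcnj (d x)))) = 0" if "f \<in> L2 \<Omega>" for f
    using vpair_cong_ae[OF that H10divD(6)[OF c_div(1)] that L2_zero ae_eq_refl] by (simp add: vpair_zero)
  \<comment> \<open>The test field has zero divergence, so only the term with the factor
    \<open>lam\<close> survives in (E1), and \<open>lam\<close> is nonzero.\<close>
  have "vp F (\<lambda>x. vcnj (d x)) = 0"
    using E1[OF c_div(1)] g0[OF La] g0[OF LF] lam by simp
  moreover have "vp R (\<lambda>x. vcnj (d x)) = 0"
    using perp[OF r(1)] by (simp add: vpair_commute)
  ultimately have "vp d (\<lambda>x. vcnj (d x)) = 0"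
    unfolding d_def using vpair_diff_left[OF LF LR Lc] by (simp add: d_def)
  then have "aeq d (\<lambda>x. 0)" by (rule vpair_vcnj_self_eq_0[OF Ld])
  then have FR: "aeq F R"
    unfolding ae_eq_def d_def by eventually_elim simp
  have rH: "r \<in> H1 \<Omega>" "r \<in> L2_mean0 \<Omega>"
    using r H1I[OF r(1)] by (auto simp: L2_mean0_def H1_L2)
  have e2: "vp F z = vp (grad r) z" if "z \<in> L2 \<Omega>" for z
    using LF that wgrad_L2[OF rH(1)] ae_eq_trans[OF FR ae_eq_sym[OF wgrad_ae_eq[OF r(1)]]]
    by (intro vpair_cong_ae ae_eq_refl)
  have e1: "vp (grad \<phi>) (grad \<psi>) + vp F (grad \<psi>) = lam * (sp \<phi> \<psi> + sp r \<psi>)"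
    if \<psi>: "\<psi> \<in> H10 \<Omega>" "\<psi> \<in> L2_mean0 \<Omega>" for \<psi>
  proof -
    have L\<psi>: "\<psi> \<in> L2 \<Omega>" "grad \<psi> \<in> L2 \<Omega>" and g\<psi>: "wg \<psi> (grad \<psi>)"
      using H10_H1[OF \<psi>(1)] by (auto intro: H1_L2 wgrad_L2 has_weak_grad_wgrad)
    have neg: "sp (\<lambda>x. (- 1) * \<psi> x) s = - sp \<psi> s" for s
      by (simp add: spair_def)
    have m0: "sp (\<lambda>x. (- 1) * \<psi> x) (\<lambda>x. 1) = 0"
      using \<psi>(2) unfolding neg by (simp add: L2_mean0_def)
    \<comment> \<open>The source is \<open>- \<psi>\<close> because Green's formula carries the
      opposite sign of the divergence; thus \<open>v\<close>, itself a gradient, has divergence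
      \<psi> and no normal trace.\<close>
    obtain p v where v: "wg p v"
      "\<And>s S. wg s S \<Longrightarrow> vp v S = vp (\<lambda>x. 0) S + sp (\<lambda>x. (- 1) * \<psi> x) s"
      by (rule neumann_solution[OF L2_zero L2_cmult[OF L\<psi>(1)] m0]) (rule that, assumption+)
    have Lv: "v \<in> L2 \<Omega>" using v(1) by (simp add: has_weak_grad_def)
    have v_grad: "vp v S = - sp \<psi> s" if "wg s S" for s S
      using v(2)[OF that] unfolding neg by (simp add: vpair_zero)
    then have "\<forall>s S. wg s S \<longrightarrow> vp v S = - sp \<psi> s" by blast
    note v_div = H10divI[OF Lv \<psi>(1) this]
    have "vp f (grad (wd v)) = vp f (grad \<psi>)" if "f \<in> L2 \<Omega>" for f
      using that H10divD(6)[OF v_div(1)] L\<psi>(2) v_div(3) by (intro vpair_cong_ae ae_eq_refl)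
    then have "vp a (grad \<psi>) + vp F (grad \<psi>) + lam * vp F v = 0"
      using E1[OF v_div(1)] La LF by simp
    moreover have "vp F v = - sp r \<psi>"
      using e2[OF Lv] v_grad[OF has_weak_grad_wgrad[OF rH(1)]] by (simp add: vpair_commute spair_commute)
    moreover have "vp a (grad \<psi>) = vp (grad \<phi>) (grad \<psi>) + vp y (grad \<psi>)"
      unfolding a_def using uD(6) y L\<psi>(2) by (rule vpair_add_left)
    moreover have "vp y (grad \<psi>) = - lam * sp \<phi> \<psi>"
      by (rule y_grad[OF g\<psi>])
    ultimately show ?thesis by (simp add: algebra_simps)
  qed
  have "\<not> aeq y (\<lambda>x. 0)"
  proof
    assume "aeq y (\<lambda>x. 0)"
    then have "aeq u (\<lambda>x. 0)"
      unfolding ae_eq_def y_def by eventually_elim (use lam in \<open>simp add: vec_eq_iff\<close>)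
    with nz show False by blast
  qed
  moreover have "- vp y (grad s) = lam * sp \<phi> s" if "s \<in> H1 \<Omega>" for s
    using y_grad[OF has_weak_grad_wgrad[OF that]] by simp
  ultimately have "eigenpair_E2 \<Omega> A lam (\<phi>, y, r)"
    unfolding eigenpair_E2_iff[OF uD(3,7) y rH] using lam e1 e2 unfolding F_def a_def by blast
  then show ?thesis
    using rH unfolding \<phi>_def y_def[abs_def] by blast
qed

text \<open>The second equation determines the gradient of the third component almost everywhere,
  and the mean value fixes the remaining constant, by the Poincare inequality for the
  difference.\<close>

lemma E2_unique:
  assumes "eigenpair_E2 \<Omega> A lam (\<phi>, y, r)" "eigenpair_E2 \<Omega> A lam (\<phi>, y, r')"
  shows "aeq r' r"
proof -
  have mem: "\<phi> \<in> H10 \<Omega>" "\<phi> \<in> L2_mean0 \<Omega>" "y \<in> L2 \<Omega>" "r \<in> H1 \<Omega>" "r \<in> L2_mean0 \<Omega>" "r' \<in> H1 \<Omega>" "r' \<in> L2_mean0 \<Omega>"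
    using assms by (auto simp: eigenpair_E2_def V_space_def)
  let ?d = "\<lambda>x. grad r' x - grad r x"
  have L: "grad r \<in> L2 \<Omega>" "grad r' \<in> L2 \<Omega>" "r \<in> L2 \<Omega>" "r' \<in> L2 \<Omega>"
    using mem wgrad_L2 H1_L2 by blast+
  have Ld: "?d \<in> L2 \<Omega>" using L(2,1) by (rule L2_diff)
  have "vp (grad r') z = vp (grad r) z" if "z \<in> L2 \<Omega>" for z
    using assms that unfolding eigenpair_E2_iff[OF mem(1-5)] eigenpair_E2_iff[OF mem(1-3,6,7)] by auto
  then have "vp ?d (\<lambda>x. vcnj (?d x)) = 0"
    using vpair_diff_left[OF L(2,1) L2_vcnj[OF Ld]] L2_vcnj[OF Ld] by simp
  then have "aeq ?d (\<lambda>x. 0)" by (rule vpair_vcnj_self_eq_0[OF Ld])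
  moreover have "mean0_grad (\<lambda>x. r' x - r x) ?d"
    using has_weak_grad_diff[OF has_weak_grad_wgrad[OF mem(6)] has_weak_grad_wgrad[OF mem(4)]]
      spair_diff_left[OF L(4,3) L2_const[of 1]] mem(5,7)
    by (simp add: mean0_grad_def L2_mean0_def)
  ultimately have "aeq (\<lambda>x. r' x - r x) (\<lambda>x. 0)"
    using mean0_grad_zero by blast
  then show ?thesis unfolding ae_eq_def by eventually_elim simp
qed

end

theorem theorem2p5:
  fixes \<Omega> :: "(real ^ 'd) set" and A :: "real ^ 'd \<Rightarrow> real ^ 'd ^ 'd"
  assumes "CARD('d) = 2 \<or> CARD('d) = 3"
    and "polyhedral_domain \<Omega>"
    and "A \<in> borel_measurable (lebesgue_on \<Omega>)"
    and "\<forall>x\<in>\<Omega>. spd (A x)"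
    and "1 < kappa_lower \<Omega> A" and "kappa_lower \<Omega> A \<le> kappa_upper \<Omega> A" and "kappa_upper \<Omega> A < \<infinity>"
  shows "(\<forall>lam \<phi> y r. eigenpair_E2 \<Omega> A lam (\<phi>, y, r)
            \<longrightarrow> eigenpair_E1 \<Omega> A lam (\<lambda>x. (1 / lam) *s y x)) \<and>
         (\<forall>lam u. eigenpair_E1 \<Omega> A lam u
            \<longrightarrow> (\<exists>r \<in> H1 \<Omega> \<inter> L2_mean0 \<Omega>.
                   eigenpair_E2 \<Omega> A lam (wdiv \<Omega> u, \<lambda>x. lam *s u x, r) \<and>
                   (\<forall>r' \<in> H1 \<Omega> \<inter> L2_mean0 \<Omega>.
                      eigenpair_E2 \<Omega> A lam (wdiv \<Omega> u, \<lambda>x. lam *s u x, r') \<longrightarrow> ae_eq \<Omega> r' r)))"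
proof -
  interpret bounded_domain \<Omega>
    using assms(2) by (rule polyhedral_domain_bounded_domain)
  have "\<Omega> \<noteq> {}" using assms(2) by (simp add: polyhedral_domain_def)
  obtain K where K: "K \<ge> 0" "\<And>s G. has_weak_grad \<Omega> s G \<Longrightarrow> spair \<Omega> s (\<lambda>x. 1) = 0 \<Longrightarrow>
    sqint \<Omega> s \<le> K * sqint \<Omega> G"
    using poincare_polyhedral[OF assms(2)] by blast
  obtain \<delta> where \<delta>: "\<delta> > 0" "\<And>x \<xi>. x \<in> \<Omega> \<Longrightarrow> \<xi> \<bullet> ((A x - mat 1) *v \<xi>) \<ge> \<delta> * (norm \<xi>)\<^sup>2"
    using kappa_lower_coercive[OF assms(5)] by blast
  interpret coefficient_domain \<Omega> K A \<delta>
    by unfold_locales (use \<open>\<Omega> \<noteq> {}\<close> K assms(3,4) \<delta> in auto)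
  show ?thesis
  proof (intro conjI allI impI)
    show "eigenpair_E1 \<Omega> A lam (\<lambda>x. (1 / lam) *s y x)" if "eigenpair_E2 \<Omega> A lam (\<phi>, y, r)" for lam \<phi> y r
      using that by (rule E2_imp_E1)
    fix lam u assume "eigenpair_E1 \<Omega> A lam u"
    then obtain r where "r \<in> H1 \<Omega> \<inter> L2_mean0 \<Omega>" "eigenpair_E2 \<Omega> A lam (wdiv \<Omega> u, \<lambda>x. lam *s u x, r)"
      using E1_imp_E2 by blast
    then show "\<exists>r \<in> H1 \<Omega> \<inter> L2_mean0 \<Omega>. eigenpair_E2 \<Omega> A lam (wdiv \<Omega> u, \<lambda>x. lam *s u x, r) \<and>
      (\<forall>r' \<in> H1 \<Omega> \<inter> L2_mean0 \<Omega>. eigenpair_E2 \<Omega> A lam (wdiv \<Omega> u, \<lambda>x. lam *s u x, r') \<longrightarrow> ae_eq \<Omega> r' r)"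
      using E2_unique by blast
  qed
qed

end
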